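(* In the setting described in the context, assume that for some $\delta>0$, $Q_1\ge 0$, $Q_2\ge 0$, $G_1\ge 0$, $G_2\ge 0$, $R_1\ge \delta I$ and $R_2\ge\delta I$. Assume that the equilibrium Riccati equation (ERE) admits a solution $(P_1,P_2)$ on $[0,T]$, with associated $\bar\Theta_1$. Define, for $t\in[0,T]$, $x\in\mathbb{R}^n$, $u\in\mathbb{R}^{m_1}$, $$u^*(t,x)=\bar\Theta_1(t)x,$$ $$v^*(t,x,u)=-\big[(R_2+D_2^\top P_2D_2)^{-1}(B_2^\top P_2+D_2^\top P_2C)\big](t)\,x-\big[(R_2+D_2^\top P_2D_2)^{-1}D_2^\top P_2D_1\big](t)\,u.$$ Then $(u^*,v^* )$ is a feedback Stackelberg equilibrium, i.e. $(u^*,v^* )\in\mathcal{U}\times\mathcal{V}$ and for every $(t,x)\in[0,T]\times\mathbb{R}^n$ and all $(u,v)\in\mathcal{U}\times\mathcal{V}$, $$\mathcal{J}_2\big(t,x;u^*,v^*(u^* )\big)\le\mathcal{J}_2\big(t,x;u^*,v(u^* )\big),\qquad \mathcal{J}_1\big(t,x;u^*,v^*(u^* )\big)\le\mathcal{J}_1\big(t,x;u,v^*(u)\big).$$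
   Context: **Setting.** $W$ is a standard one-dimensional Brownian motion on a complete filtered probability space $(\Omega,\mathcal{F},\mathbb{F},\mathbb{P})$, where $\mathbb{F}=\{\mathcal{F}_t\}$ is the augmented natural filtration of $W$; $\mathbb{E}_t=\mathbb{E}[\,\cdot\mid\mathcal{F}_t]$; $\mathbb{S}^n$ is the space of real symmetric $n\times n$ matrices and $\mathbb{S}^n_+$ the subset of positive semidefinite ones; inequalities between symmetric matrices are in the Loewner order (for matrix functions of time, almost everywhere on $[0,T]$). Let $T>0$ and $n,m_1,m_2\in\mathbb{N}$. The coefficients are deterministic: $A,C\in L^\infty(0,T;\mathbb{R}^{n\times n})$, $B_1,D_1\in L^\infty(0,T;\mathbb{R}^{n\times m_1})$, $B_2,D_2\in L^\infty(0,T;\mathbb{R}^{n\times m_2})$, $Q_1,Q_2\in L^\infty(0,T;\mathbb{S}^n)$, $R_1\in L^\infty(0,T;\mathbb{S}^{m_1})$, $R_2\in L^\infty(0,T;\mathbb{S}^{m_2})$, $G_1,G_2\in\mathbb{S}^n$. The time argument is often suppressed. **Strategies.** $\mathcal{U}$ is the set of $u:[0,T]\times\mathbb{R}^n\to\mathbb{R}^{m_1}$ such that $u(s,x)$ is Lipschitz continuous in $x$; $\mathcal{V}$ is the set of $v:[0,T]\times\mathbb{R}^n\times\mathbb{R}^{m_1}\to\mathbb{R}^{m_2}$ such that $v(s,x,u)$ is Lipschitz continuous in $(x,u)$. For $u\in\mathcal{U}$, $v\in\mathcal{V}$, $v(u)$ denotes the feedback $(s,x)\mapsto v(s,x,u(s,x))$.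 **Costs.** For $(t,x)\in[0,T]\times\mathbb{R}^n$ and $(u,v)\in\mathcal{U}\times\mathcal{V}$, let $X$ be the solution on $[t,T]$ of $$dX=\big(AX+B_1u(s,X)+B_2v(s,X,u(s,X))\big)ds+\big(CX+D_1u(s,X)+D_2v(s,X,u(s,X))\big)dW(s),\qquad X(t)=x,$$ and, writing $u_s=u(s,X(s))$, $v_s=v(s,X(s),u(s,X(s)))$, $$\mathcal{J}_1(t,x;u,v(u))=\tfrac12\mathbb{E}_t\Big[\int_t^T\big(\langle Q_1X,X\rangle+\langle R_1u_s,u_s\rangle\big)ds+\langle G_1X(T),X(T)\rangle\Big],$$ $$\mathcal{J}_2(t,x;u,v(u))=\tfrac12\mathbb{E}_t\Big[\int_t^T\big(\langle Q_2X,X\rangle+\langle R_2v_s,v_s\rangle\big)ds+\langle G_2X(T),X(T)\rangle\Big].$$ **Equilibrium Riccati equation (ERE).** Put $$\mathbf{B}(P_2)=B_1-B_2(R_2+D_2^\top P_2D_2)^{-1}D_2^\top P_2D_1,\qquad \mathbf{D}(P_2)=D_1-D_2(R_2+D_2^\top P_2D_2)^{-1}D_2^\top P_2D_1,$$ $$\mathbf{A}(\Theta_1,P_2)=A-B_2(R_2+D_2^\top P_2D_2)^{-1}(B_2^\top P_2+D_2^\top P_2C)+\mathbf{B}(P_2)\Theta_1,$$ $$\mathbf{C}(\Theta_1,P_2)=C-D_2(R_2+D_2^\top P_2D_2)^{-1}(B_2^\top P_2+D_2^\top P_2C)+\mathbf{D}(P_2)\Theta_1.$$ The ERE is the system on $[0,T]$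 $$\dot P_2=-\big[\mathbf{A}(\bar\Theta_1,P_2)^\top P_2+P_2\mathbf{A}(\bar\Theta_1,P_2)+\mathbf{C}(\bar\Theta_1,P_2)^\top P_2\mathbf{C}(\bar\Theta_1,P_2)+Q_2+(\Theta_2^* )^\top R_2\Theta_2^*\big],\quad P_2(T)=G_2,$$ $$\dot P_1=-\big[\mathbf{A}(\bar\Theta_1,P_2)^\top P_1+P_1\mathbf{A}(\bar\Theta_1,P_2)+\mathbf{C}(\bar\Theta_1,P_2)^\top P_1\mathbf{C}(\bar\Theta_1,P_2)+Q_1+\bar\Theta_1^\top R_1\bar\Theta_1\big],\quad P_1(T)=G_1,$$ where $$\Theta_2^*=-\big[R_2+D_2^\top P_2D_2\big]^{-1}\big[B_2^\top P_2+D_2^\top P_2(C+D_1\bar\Theta_1)\big],$$ $$\bar\Theta_1=-\big[R_1+\mathbf{D}(P_2)^\top P_1\mathbf{D}(P_2)\big]^{-1}\Big\{\mathbf{B}(P_2)^\top P_1+\mathbf{D}(P_2)^\top P_1\big[C-D_2(R_2+D_2^\top P_2D_2)^{-1}(B_2^\top P_2+D_2^\top P_2C)\big]\Big\}.$$ A solution is a pair $(P_1,P_2)\in C([0,T];\mathbb{S}^n_+\times\mathbb{S}^n_+)$ satisfying this system. *)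

theory Defs
  imports "HOL-Probability.Probability"
begin

section \<open>Symmetric matrices and essentially bounded coefficients\<close>

definition sym_mat :: "real^'n^'n \<Rightarrow> bool" where
  "sym_mat S \<longleftrightarrow> transpose S = S"

text \<open>The Loewner order; it is only applied to symmetric matrices.\<close>

definition loewner_le :: "real^'n^'n \<Rightarrow> real^'n^'n \<Rightarrow> bool" where
  "loewner_le S S' \<longleftrightarrow> (\<forall>x. (S *v x) \<bullet> x \<le> (S' *v x) \<bullet> x)"

definition psd_mat :: "real^'n^'n \<Rightarrow> bool" where
  "psd_mat S \<longleftrightarrow> sym_mat S \<and> loewner_le 0 S"

definition Linf :: "real \<Rightarrow> (real \<Rightarrow> 'a::euclidean_space) \<Rightarrow> bool" where
  "Linf T f \<longleftrightarrow> f \<in> borel_measurable (lebesgue_on {0..T}) \<and>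
     (\<exists>K. AE s in lebesgue_on {0..T}. norm (f s) \<le> K)"

definition Linf_sym :: "real \<Rightarrow> (real \<Rightarrow> real^'n^'n) \<Rightarrow> bool" where
  "Linf_sym T f \<longleftrightarrow> Linf T f \<and> (AE s in lebesgue_on {0..T}. sym_mat (f s))"


section \<open>Brownian motion and the augmented natural filtration\<close>

definition aug_filtration :: "'w measure \<Rightarrow> (real \<Rightarrow> 'w \<Rightarrow> real) \<Rightarrow> real \<Rightarrow> 'w measure" where
  "aug_filtration M W t = sigma (space M)
     ({W s -` B \<inter> space M | s B. 0 \<le> s \<and> s \<le> t \<and> B \<in> sets borel} \<union> null_sets M)"

definition brownian_motion ::
  "'w measure \<Rightarrow> (real \<Rightarrow> 'w measure) \<Rightarrow> (real \<Rightarrow> 'w \<Rightarrow> real) \<Rightarrow> bool" where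
  "brownian_motion M F W \<longleftrightarrow>
     (\<forall>t\<ge>0. W t \<in> borel_measurable M \<and> W t \<in> borel_measurable (F t)) \<and>
     (AE \<omega> in M. W 0 \<omega> = 0) \<and>
     (AE \<omega> in M. continuous_on {0..} (\<lambda>t. W t \<omega>)) \<and>
     (\<forall>s t. 0 \<le> s \<and> s < t \<longrightarrow>
        distributed M lborel (\<lambda>\<omega>. W t \<omega> - W s \<omega>) (normal_density 0 (sqrt (t - s))) \<and>
        prob_space.indep_set M (sets (F s))
          {(\<lambda>\<omega>. W t \<omega> - W s \<omega>) -` B \<inter> space M | B. B \<in> sets borel})"


section \<open>The Ito integral of square-integrable integrands\<close>

text \<open>
  The simple process with data \<open>(k, \<tau>, \<xi>)\<close> is \<open>\<Sum>i<k. \<xi> i 1\<^bsub>(\<tau> i, \<tau> (i+1)]\<^esub>\<close>, where \<open>\<xi> i\<close> is bounded and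
  measurable with respect to the information available at time \<open>\<tau> i\<close>.
\<close>

definition simple_data ::
  "'w measure \<Rightarrow> (real \<Rightarrow> 'w measure) \<Rightarrow> real \<Rightarrow> real \<Rightarrow>
   nat \<Rightarrow> (nat \<Rightarrow> real) \<Rightarrow> (nat \<Rightarrow> 'w \<Rightarrow> 'a::euclidean_space) \<Rightarrow> bool" where
  "simple_data M F a b k \<tau> \<xi> \<longleftrightarrow>
     (\<forall>i\<le>k. a \<le> \<tau> i \<and> \<tau> i \<le> b) \<and> (\<forall>i<k. \<tau> i \<le> \<tau> (Suc i)) \<and>
     (\<forall>i<k. \<xi> i \<in> borel_measurable (F (\<tau> i)) \<and> (\<exists>K. \<forall>\<omega>\<in>space M. norm (\<xi> i \<omega>) \<le> K))"

definition simple_proc ::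
  "nat \<Rightarrow> (nat \<Rightarrow> real) \<Rightarrow> (nat \<Rightarrow> 'w \<Rightarrow> 'a::euclidean_space) \<Rightarrow> real \<Rightarrow> 'w \<Rightarrow> 'a" where
  "simple_proc k \<tau> \<xi> s \<omega> = (\<Sum>i<k. indicator {\<tau> i<..\<tau> (Suc i)} s *\<^sub>R \<xi> i \<omega>)"

definition simple_ito ::
  "(real \<Rightarrow> 'w \<Rightarrow> real) \<Rightarrow> nat \<Rightarrow> (nat \<Rightarrow> real) \<Rightarrow> (nat \<Rightarrow> 'w \<Rightarrow> 'a::euclidean_space) \<Rightarrow> 'w \<Rightarrow> 'a" where
  "simple_ito W k \<tau> \<xi> \<omega> = (\<Sum>i<k. (W (\<tau> (Suc i)) \<omega> - W (\<tau> i) \<omega>) *\<^sub>R \<xi> i \<omega>)"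

text \<open>
  \<open>has_ito_integral M F W a b \<phi> I\<close> says that \<open>I\<close> is a version of \<open>\<integral>\<^sub>a\<^sup>b \<phi> dW\<close>: there are adapted
  simple processes that converge to \<open>\<phi>\<close> in \<open>L\<^sup>2([a,b] \<times> \<Omega>)\<close> and whose integrals converge to \<open>I\<close>
  in \<open>L\<^sup>2(\<Omega>)\<close>.  By the Ito isometry \<open>I\<close> is unique almost surely.
\<close>

definition has_ito_integral ::
  "'w measure \<Rightarrow> (real \<Rightarrow> 'w measure) \<Rightarrow> (real \<Rightarrow> 'w \<Rightarrow> real) \<Rightarrow> real \<Rightarrow> real \<Rightarrow>
   (real \<Rightarrow> 'w \<Rightarrow> 'a::euclidean_space) \<Rightarrow> ('w \<Rightarrow> 'a) \<Rightarrow> bool" where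
  "has_ito_integral M F W a b \<phi> I \<longleftrightarrow>
     (\<lambda>(s, \<omega>). \<phi> s \<omega>) \<in> borel_measurable (lebesgue_on {a..b} \<Otimes>\<^sub>M M) \<and>
     I \<in> borel_measurable M \<and>
     (\<exists>k \<tau> \<xi>. (\<forall>j::nat. simple_data M F a b (k j) (\<tau> j) (\<xi> j)) \<and>
        (\<lambda>j. \<integral>\<^sup>+ (s, \<omega>). ennreal ((norm (\<phi> s \<omega> - simple_proc (k j) (\<tau> j) (\<xi> j) s \<omega>))\<^sup>2)
               \<partial>(lebesgue_on {a..b} \<Otimes>\<^sub>M M)) \<longlonglongrightarrow> 0 \<and>
        (\<lambda>j. \<integral>\<^sup>+ \<omega>. ennreal ((norm (I \<omega> - simple_ito W (k j) (\<tau> j) (\<xi> j) \<omega>))\<^sup>2) \<partial>M) \<longlonglongrightarrow> 0)"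


section \<open>Data of the game\<close>

text \<open>\<open>hor\<close> is the horizon \<open>T\<close>; a prefix \<open>c\<close> marks the coefficients of the state equation, \<open>w\<close> the
  weights of the costs.\<close>

record ('n, 'm1, 'm2) lq_game =
  hor :: real
  cA :: "real \<Rightarrow> real^'n^'n"
  cC :: "real \<Rightarrow> real^'n^'n"
  cB1 :: "real \<Rightarrow> real^'m1^'n"
  cD1 :: "real \<Rightarrow> real^'m1^'n"
  cB2 :: "real \<Rightarrow> real^'m2^'n"
  cD2 :: "real \<Rightarrow> real^'m2^'n"
  wQ1 :: "real \<Rightarrow> real^'n^'n"
  wQ2 :: "real \<Rightarrow> real^'n^'n"
  wR1 :: "real \<Rightarrow> real^'m1^'m1"
  wR2 :: "real \<Rightarrow> real^'m2^'m2"
  wG1 :: "real^'n^'n"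
  wG2 :: "real^'n^'n"

definition lq_data :: "('n::finite, 'm1::finite, 'm2::finite) lq_game \<Rightarrow> bool" where
  "lq_data g \<longleftrightarrow> 0 < hor g \<and>
     Linf (hor g) (cA g) \<and> Linf (hor g) (cC g) \<and>
     Linf (hor g) (cB1 g) \<and> Linf (hor g) (cD1 g) \<and>
     Linf (hor g) (cB2 g) \<and> Linf (hor g) (cD2 g) \<and>
     Linf_sym (hor g) (wQ1 g) \<and> Linf_sym (hor g) (wQ2 g) \<and>
     Linf_sym (hor g) (wR1 g) \<and> Linf_sym (hor g) (wR2 g) \<and>
     sym_mat (wG1 g) \<and> sym_mat (wG2 g)"


section \<open>Strategies, state equation and costs\<close>

text \<open>
  A strategy is Lipschitz continuous in the space variables at every time and measurable in time.
  The Lipschitz constant is essentially bounded in time; since the coefficients are only classes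
  modulo null sets, a bound at literally every time would depend on the representatives.
\<close>

definition leader_strategies :: "real \<Rightarrow> (real \<Rightarrow> real^'n \<Rightarrow> real^'m1) set" where
  "leader_strategies T = {u.
     (\<forall>x. (\<lambda>s. u s x) \<in> borel_measurable (lebesgue_on {0..T})) \<and>
     (\<exists>L K. (\<forall>s\<in>{0..T}. (L s)-lipschitz_on UNIV (u s)) \<and>
            (AE s in lebesgue_on {0..T}. L s \<le> K))}"

definition follower_strategies ::
  "real \<Rightarrow> (real \<Rightarrow> real^'n \<Rightarrow> real^'m1 \<Rightarrow> real^'m2) set" where
  "follower_strategies T = {v.
     (\<forall>x w. (\<lambda>s. v s x w) \<in> borel_measurable (lebesgue_on {0..T})) \<and>
     (\<exists>L K. (\<forall>s\<in>{0..T}. (L s)-lipschitz_on UNIV (\<lambda>(x, w). v s x w)) \<and>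
            (AE s in lebesgue_on {0..T}. L s \<le> K))}"

definition response ::
  "(real \<Rightarrow> real^'n \<Rightarrow> real^'m1 \<Rightarrow> real^'m2) \<Rightarrow> (real \<Rightarrow> real^'n \<Rightarrow> real^'m1) \<Rightarrow>
   real \<Rightarrow> real^'n \<Rightarrow> real^'m2" where
  "response v u = (\<lambda>s x. v s x (u s x))"

text \<open>Adaptedness is not part of the next definition: it is only applied to deterministic functions
  of time and of an adapted state.\<close>

definition L2_process ::
  "'w measure \<Rightarrow> real \<Rightarrow> real \<Rightarrow> (real \<Rightarrow> 'w \<Rightarrow> 'a::euclidean_space) \<Rightarrow> bool" where
  "L2_process M a b \<phi> \<longleftrightarrow>
     (\<lambda>(s, \<omega>). \<phi> s \<omega>) \<in> borel_measurable (lebesgue_on {a..b} \<Otimes>\<^sub>M M) \<and>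
     (\<integral>\<^sup>+ (s, \<omega>). ennreal ((norm (\<phi> s \<omega>))\<^sup>2) \<partial>(lebesgue_on {a..b} \<Otimes>\<^sub>M M)) < \<infinity>"

text \<open>
  \<open>state_process g M F W t x u w X\<close>: \<open>X\<close> solves the state equation on \<open>[t,T]\<close> started at \<open>x\<close> under
  the feedback laws \<open>u\<close> and \<open>w\<close>, in the usual solution space of continuous adapted processes with
  \<open>E sup |X|\<^sup>2 < \<infinity>\<close> and with square-integrable controls.  The last condition makes the costs finite;
  it is automatic if \<open>u(\<cdot>,0)\<close> and \<open>w(\<cdot>,0)\<close> are square-integrable in time.
\<close>

definition state_process ::
  "('n::finite, 'm1::finite, 'm2::finite) lq_game \<Rightarrow>
   'w measure \<Rightarrow> (real \<Rightarrow> 'w measure) \<Rightarrow> (real \<Rightarrow> 'w \<Rightarrow> real) \<Rightarrow> real \<Rightarrow> real^'n \<Rightarrow>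
   (real \<Rightarrow> real^'n \<Rightarrow> real^'m1) \<Rightarrow> (real \<Rightarrow> real^'n \<Rightarrow> real^'m2) \<Rightarrow>
   (real \<Rightarrow> 'w \<Rightarrow> real^'n) \<Rightarrow> bool" where
  "state_process g M F W t x u w X \<longleftrightarrow>
     (\<forall>s\<in>{t..hor g}. X s \<in> borel_measurable (F s)) \<and>
     (\<forall>\<omega>\<in>space M. continuous_on {t..hor g} (\<lambda>s. X s \<omega>)) \<and>
     (\<integral>\<^sup>+ \<omega>. (SUP s\<in>{t..hor g}. ennreal ((norm (X s \<omega>))\<^sup>2)) \<partial>M) < \<infinity> \<and>
     L2_process M t (hor g) (\<lambda>s \<omega>. u s (X s \<omega>)) \<and>
     L2_process M t (hor g) (\<lambda>s \<omega>. w s (X s \<omega>)) \<and>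
     (\<forall>r\<in>{t..hor g}. \<exists>I.
        has_ito_integral M F W t r
          (\<lambda>s \<omega>. cC g s *v X s \<omega> + cD1 g s *v u s (X s \<omega>) + cD2 g s *v w s (X s \<omega>)) I \<and>
        (AE \<omega> in M. X r \<omega> = x
           + integral\<^sup>L (lebesgue_on {t..r})
               (\<lambda>s. cA g s *v X s \<omega> + cB1 g s *v u s (X s \<omega>) + cB2 g s *v w s (X s \<omega>))
           + I \<omega>))"

definition quad_cost ::
  "'w measure \<Rightarrow> (real \<Rightarrow> 'w measure) \<Rightarrow> real \<Rightarrow> (real \<Rightarrow> real^'n^'n) \<Rightarrow> (real \<Rightarrow> real^'m^'m) \<Rightarrow>
   real^'n^'n \<Rightarrow> real \<Rightarrow> (real \<Rightarrow> 'w \<Rightarrow> real^'n) \<Rightarrow> (real \<Rightarrow> 'w \<Rightarrow> real^'m) \<Rightarrow> 'w \<Rightarrow> real" where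
  "quad_cost M F T Q R G t X c = (\<lambda>\<omega>. 1/2 * real_cond_exp M (F t) (\<lambda>\<omega>'.
       integral\<^sup>L (lebesgue_on {t..T})
         (\<lambda>s. (Q s *v X s \<omega>') \<bullet> X s \<omega>' + (R s *v c s \<omega>') \<bullet> c s \<omega>')
       + (G *v X T \<omega>') \<bullet> X T \<omega>') \<omega>)"

text \<open>\<open>J1\<close> and \<open>J2\<close> are the costs along a given solution \<open>X\<close> of the state equation, which carries the
  initial pair \<open>(t,x)\<close> and the strategy of the other player.\<close>

definition J1 ::
  "('n::finite, 'm1::finite, 'm2::finite) lq_game \<Rightarrow> 'w measure \<Rightarrow> (real \<Rightarrow> 'w measure) \<Rightarrow> real \<Rightarrow>
   (real \<Rightarrow> 'w \<Rightarrow> real^'n) \<Rightarrow> (real \<Rightarrow> real^'n \<Rightarrow> real^'m1) \<Rightarrow> 'w \<Rightarrow> real" where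
  "J1 g M F t X u = quad_cost M F (hor g) (wQ1 g) (wR1 g) (wG1 g) t X (\<lambda>s \<omega>. u s (X s \<omega>))"

definition J2 ::
  "('n::finite, 'm1::finite, 'm2::finite) lq_game \<Rightarrow> 'w measure \<Rightarrow> (real \<Rightarrow> 'w measure) \<Rightarrow> real \<Rightarrow>
   (real \<Rightarrow> 'w \<Rightarrow> real^'n) \<Rightarrow> (real \<Rightarrow> real^'n \<Rightarrow> real^'m2) \<Rightarrow> 'w \<Rightarrow> real" where
  "J2 g M F t X w = quad_cost M F (hor g) (wQ2 g) (wR2 g) (wG2 g) t X (\<lambda>s \<omega>. w s (X s \<omega>))"

definition feedback_stackelberg_equilibrium ::
  "('n::finite, 'm1::finite, 'm2::finite) lq_game \<Rightarrow>
   'w measure \<Rightarrow> (real \<Rightarrow> 'w measure) \<Rightarrow> (real \<Rightarrow> 'w \<Rightarrow> real) \<Rightarrow>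
   (real \<Rightarrow> real^'n \<Rightarrow> real^'m1) \<Rightarrow> (real \<Rightarrow> real^'n \<Rightarrow> real^'m1 \<Rightarrow> real^'m2) \<Rightarrow> bool" where
  "feedback_stackelberg_equilibrium g M F W us vs \<longleftrightarrow>
     us \<in> leader_strategies (hor g) \<and> vs \<in> follower_strategies (hor g) \<and>
     (\<forall>t\<in>{0..hor g}. \<forall>x. \<forall>u\<in>leader_strategies (hor g). \<forall>v\<in>follower_strategies (hor g).
        \<forall>X. state_process g M F W t x us (response vs us) X \<longrightarrow>
          (\<forall>Y. state_process g M F W t x us (response v us) Y \<longrightarrow>
             (AE \<omega> in M. J2 g M F t X (response vs us) \<omega> \<le> J2 g M F t Y (response v us) \<omega>)) \<and>
          (\<forall>Y. state_process g M F W t x u (response vs u) Y \<longrightarrow>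
             (AE \<omega> in M. J1 g M F t X us \<omega> \<le> J1 g M F t Y u \<omega>)))"


section \<open>The equilibrium Riccati equation\<close>

definition S2inv ::
  "('n::finite, 'm1::finite, 'm2::finite) lq_game \<Rightarrow> (real \<Rightarrow> real^'n^'n) \<Rightarrow> real \<Rightarrow> real^'m2^'m2" where
  "S2inv g P2 s = matrix_inv (wR2 g s + transpose (cD2 g s) ** P2 s ** cD2 g s)"

definition gain_x ::
  "('n::finite, 'm1::finite, 'm2::finite) lq_game \<Rightarrow> (real \<Rightarrow> real^'n^'n) \<Rightarrow> real \<Rightarrow> real^'n^'m2" where
  "gain_x g P2 s =
     S2inv g P2 s ** (transpose (cB2 g s) ** P2 s + transpose (cD2 g s) ** P2 s ** cC g s)"

definition gain_u ::
  "('n::finite, 'm1::finite, 'm2::finite) lq_game \<Rightarrow> (real \<Rightarrow> real^'n^'n) \<Rightarrow> real \<Rightarrow> real^'m1^'m2" where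
  "gain_u g P2 s = S2inv g P2 s ** (transpose (cD2 g s) ** P2 s ** cD1 g s)"

definition bB ::
  "('n::finite, 'm1::finite, 'm2::finite) lq_game \<Rightarrow> (real \<Rightarrow> real^'n^'n) \<Rightarrow> real \<Rightarrow> real^'m1^'n" where
  "bB g P2 s = cB1 g s - cB2 g s ** gain_u g P2 s"

definition bD ::
  "('n::finite, 'm1::finite, 'm2::finite) lq_game \<Rightarrow> (real \<Rightarrow> real^'n^'n) \<Rightarrow> real \<Rightarrow> real^'m1^'n" where
  "bD g P2 s = cD1 g s - cD2 g s ** gain_u g P2 s"

definition bA ::
  "('n::finite, 'm1::finite, 'm2::finite) lq_game \<Rightarrow> (real \<Rightarrow> real^'n^'m1) \<Rightarrow>
   (real \<Rightarrow> real^'n^'n) \<Rightarrow> real \<Rightarrow> real^'n^'n" where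
  "bA g Th P2 s = cA g s - cB2 g s ** gain_x g P2 s + bB g P2 s ** Th s"

definition bC ::
  "('n::finite, 'm1::finite, 'm2::finite) lq_game \<Rightarrow> (real \<Rightarrow> real^'n^'m1) \<Rightarrow>
   (real \<Rightarrow> real^'n^'n) \<Rightarrow> real \<Rightarrow> real^'n^'n" where
  "bC g Th P2 s = cC g s - cD2 g s ** gain_x g P2 s + bD g P2 s ** Th s"

definition Theta1bar ::
  "('n::finite, 'm1::finite, 'm2::finite) lq_game \<Rightarrow> (real \<Rightarrow> real^'n^'n) \<Rightarrow> (real \<Rightarrow> real^'n^'n) \<Rightarrow>
   real \<Rightarrow> real^'n^'m1" where
  "Theta1bar g P1 P2 s =
     - (matrix_inv (wR1 g s + transpose (bD g P2 s) ** P1 s ** bD g P2 s) **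
        (transpose (bB g P2 s) ** P1 s
         + transpose (bD g P2 s) ** P1 s ** (cC g s - cD2 g s ** gain_x g P2 s)))"

definition Theta2star ::
  "('n::finite, 'm1::finite, 'm2::finite) lq_game \<Rightarrow> (real \<Rightarrow> real^'n^'n) \<Rightarrow> (real \<Rightarrow> real^'n^'n) \<Rightarrow>
   real \<Rightarrow> real^'n^'m2" where
  "Theta2star g P1 P2 s =
     - (S2inv g P2 s **
        (transpose (cB2 g s) ** P2 s
         + transpose (cD2 g s) ** P2 s ** (cC g s + cD1 g s ** Theta1bar g P1 P2 s)))"

definition lyap_rhs ::
  "real^'n^'n \<Rightarrow> real^'n^'n \<Rightarrow> real^'n^'n \<Rightarrow> real^'n^'n \<Rightarrow> real^'m^'m \<Rightarrow> real^'n^'m \<Rightarrow> real^'n^'n" where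
  "lyap_rhs A C P Q R Th =
     transpose A ** P + P ** A + transpose C ** P ** C + Q + transpose Th ** R ** Th"

text \<open>
  The coefficients are merely measurable in time, so \<open>dP/ds = - H\<close>, \<open>P(T) = G\<close> is meant in the sense
  of Caratheodory: \<open>H\<close> is integrable and \<open>P(t) = G + \<integral>\<^sub>t\<^sup>T H ds\<close>.
\<close>

definition backward_solution ::
  "real \<Rightarrow> (real \<Rightarrow> 'a::euclidean_space) \<Rightarrow> (real \<Rightarrow> 'a) \<Rightarrow> 'a \<Rightarrow> bool" where
  "backward_solution T P H G \<longleftrightarrow> integrable (lebesgue_on {0..T}) H \<and>
     (\<forall>t\<in>{0..T}. P t = G + integral\<^sup>L (lebesgue_on {t..T}) H)"

definition ERE_solution ::
  "('n::finite, 'm1::finite, 'm2::finite) lq_game \<Rightarrow> (real \<Rightarrow> real^'n^'n) \<Rightarrow> (real \<Rightarrow> real^'n^'n) \<Rightarrow>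
   bool" where
  "ERE_solution g P1 P2 \<longleftrightarrow>
     continuous_on {0..hor g} P1 \<and> continuous_on {0..hor g} P2 \<and>
     (\<forall>s\<in>{0..hor g}. psd_mat (P1 s) \<and> psd_mat (P2 s)) \<and>
     backward_solution (hor g) P2
       (\<lambda>s. lyap_rhs (bA g (Theta1bar g P1 P2) P2 s) (bC g (Theta1bar g P1 P2) P2 s) (P2 s)
              (wQ2 g s) (wR2 g s) (Theta2star g P1 P2 s)) (wG2 g) \<and>
     backward_solution (hor g) P1
       (\<lambda>s. lyap_rhs (bA g (Theta1bar g P1 P2) P2 s) (bC g (Theta1bar g P1 P2) P2 s) (P1 s)
              (wQ1 g s) (wR1 g s) (Theta1bar g P1 P2 s)) (wG1 g)"

end

theory Submission
  imports Defs
begin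

text \<open>
  For either player, with the other strategy inserted, the state satisfies
  \<open>dX = b ds + \<sigma> dW\<close>, and the claim follows from the identity
  \<open>E\<^sub>t[\<langle>P(T)X(T), X(T)\<rangle>] = \<langle>P(t)x, x\<rangle> + E\<^sub>t[\<integral> \<langle>P'X, X\<rangle> + \<langle>PX, b\<rangle> + \<langle>Pb, X\<rangle> + \<langle>P\<sigma>, \<sigma>\<rangle> ds]\<close>:
  by the Riccati equation and completion of squares the running cost plus the integrand equals
  \<open>\<langle>(R + D\<^sup>TPD)(c - \<Theta>X), c - \<Theta>X\<rangle> \<ge> 0\<close> for the control \<open>c\<close>, and vanishes for \<open>c = \<Theta>X\<close>.

  Since only expectations occur and \<open>P\<close> is deterministic, Ito's formula can be avoided.  For
  \<open>A\<close> in \<open>F t\<close> the second moments \<open>E[1\<^sub>A X\<^sub>i(r) X\<^sub>j(r)]\<close> are computed by expanding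
  \<open>X = x + \<integral> b ds + \<integral> \<sigma> dW\<close>: the product of the drift parts obeys the pathwise product rule, the
  product of the martingale parts is given by the Ito isometry, and in the mixed terms
  \<open>E[b(s) \<integral>\<^sub>t\<^sup>r \<sigma> dW] = E[b(s) \<integral>\<^sub>t\<^sup>s \<sigma> dW]\<close> by the martingale property.  Weighting by
  \<open>P\<^sub>i\<^sub>j\<close> is again the product rule.
\<close>

section \<open>Square-integrable functions\<close>

text \<open>Both players solve the same kind of problem once the opponent is substituted. For the
  follower the leader's feedback is frozen: the state matrices become A + B1 Theta and C + D1 Theta,
  the control matrices are B2 and D2. For the leader the follower's reaction is eliminated: B2 and
  D2 times \<open>gain_x\<close> are subtracted from the state matrices, and the control matrices
  become \<open>bB\<close> and \<open>bD\<close>. At the candidate feedback both closed loops are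
  the same pair \<open>bA\<close>, \<open>bC\<close>, which is why both Riccati equations can be
  read as Lyapunov equations along one closed loop. A deviation is an arbitrary Lipschitz feedback,
  so the deviating state need not be linear or Gaussian, but second moments suffice because the
  value is quadratic. Costs are conditional on \<open>F t\<close>, hence moments are tested on sets
  A in \<open>F t\<close>: multiplying by the indicator of A keeps an Ito process an Ito process,
  with a random starting value. As the coefficients are only measurable in time, P is only a
  primitive of an integrable function, and all time calculus is done with integrals instead of
  derivatives.\<close>

definition sq_int :: "'a measure \<Rightarrow> ('a \<Rightarrow> real) \<Rightarrow> bool" where
  "sq_int M f \<longleftrightarrow> f \<in> borel_measurable M \<and> integrable M (\<lambda>x. (f x)\<^sup>2)"

lemma sq_int_measurable: "sq_int M f \<Longrightarrow> f \<in> borel_measurable M"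
  by (simp add: sq_int_def)

lemma sq_int_integrable_power2: "sq_int M f \<Longrightarrow> integrable M (\<lambda>x. (f x)\<^sup>2)"
  by (simp add: sq_int_def)

lemma sq_int_iff_nn_integral:
  "sq_int M f \<longleftrightarrow> f \<in> borel_measurable M \<and> (\<integral>\<^sup>+x. ennreal ((f x)\<^sup>2) \<partial>M) < \<infinity>"
  by (auto simp: sq_int_def integrable_iff_bounded)

lemma abs_mult_le_sum_power2: "\<bar>x * y\<bar> \<le> x\<^sup>2 + (y::real)\<^sup>2"
proof -
  have "2 * (\<bar>x\<bar> * \<bar>y\<bar>) \<le> x\<^sup>2 + y\<^sup>2"
    using sum_squares_bound[of "\<bar>x\<bar>" "\<bar>y\<bar>"] by simp
  moreover have "0 \<le> \<bar>x\<bar> * \<bar>y\<bar>" by simp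
  ultimately show ?thesis unfolding abs_mult by linarith
qed

lemma sq_int_integrable_mult:
  assumes "sq_int M f" "sq_int M g"
  shows "integrable M (\<lambda>x. f x * g x)"
proof (rule Bochner_Integration.integrable_bound)
  show "integrable M (\<lambda>x. (f x)\<^sup>2 + (g x)\<^sup>2)"
    using assms by (auto simp: sq_int_def)
  show "(\<lambda>x. f x * g x) \<in> borel_measurable M"
    using assms by (auto simp: sq_int_def)
  show "AE x in M. norm (f x * g x) \<le> norm ((f x)\<^sup>2 + (g x)\<^sup>2)"
    using abs_mult_le_sum_power2[of "f _" "g _"] by (intro AE_I2) auto
qed

lemma sq_int_add:
  assumes "sq_int M f" "sq_int M g"
  shows "sq_int M (\<lambda>x. f x + g x)"
proof -
  have "integrable M (\<lambda>x. (f x)\<^sup>2 + (g x)\<^sup>2 + 2 * (f x * g x))"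
    using assms sq_int_integrable_mult[OF assms] by (auto simp: sq_int_def)
  then show ?thesis using assms
    by (auto simp: sq_int_def power2_sum mult.assoc)
qed

lemma sq_int_cmult: "sq_int M f \<Longrightarrow> sq_int M (\<lambda>x. c * f x)"
  by (auto simp: sq_int_def power_mult_distrib)

lemma sq_int_diff: "sq_int M f \<Longrightarrow> sq_int M g \<Longrightarrow> sq_int M (\<lambda>x. f x - g x)"
  using sq_int_add[of M f "\<lambda>x. (-1) * g x"] sq_int_cmult[of M g "-1"] by simp

lemma sq_int_zero: "sq_int M (\<lambda>x. 0)"
  by (simp add: sq_int_def)

lemma sq_int_sum: "(\<And>i. i \<in> I \<Longrightarrow> sq_int M (f i)) \<Longrightarrow> sq_int M (\<lambda>x. \<Sum>i\<in>I. f i x)"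
  by (induction I rule: infinite_finite_induct) (auto intro: sq_int_add sq_int_zero)

lemma sq_int_bounded_mult:
  assumes f: "sq_int M f" and g: "g \<in> borel_measurable M" and K: "AE x in M. \<bar>g x\<bar> \<le> K"
  shows "sq_int M (\<lambda>x. g x * f x)"
proof -
  have "integrable M (\<lambda>x. (g x * f x)\<^sup>2)"
  proof (rule Bochner_Integration.integrable_bound)
    show "integrable M (\<lambda>x. K\<^sup>2 * (f x)\<^sup>2)" using f by (auto simp: sq_int_def)
    show "(\<lambda>x. (g x * f x)\<^sup>2) \<in> borel_measurable M"
      using f g by (auto simp: sq_int_def)
    show "AE x in M. norm ((g x * f x)\<^sup>2) \<le> norm (K\<^sup>2 * (f x)\<^sup>2)"
      using K
    proof eventually_elim
      case (elim x)
      then have "(g x)\<^sup>2 \<le> K\<^sup>2" by (metis abs_ge_zero power2_abs power_mono)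
      then show ?case by (simp add: power_mult_distrib mult_right_mono)
    qed
  qed
  then show ?thesis using f g by (auto simp: sq_int_def)
qed

lemma (in finite_measure) sq_int_bounded:
  assumes "g \<in> borel_measurable M" "\<And>x. x \<in> space M \<Longrightarrow> \<bar>g x\<bar> \<le> K"
  shows "sq_int M g"
proof -
  have "sq_int M (\<lambda>x. g x * 1)"
    by (rule sq_int_bounded_mult[where K = K]) (use assms in \<open>auto simp: sq_int_def\<close>)
  then show ?thesis by simp
qed

lemma (in finite_measure) sq_int_imp_integrable: "sq_int M f \<Longrightarrow> integrable M f"
  using sq_int_integrable_mult[of M f "\<lambda>_. 1"] by (simp add: sq_int_def)

text \<open>Reduces to the inequality for nonnegative integrals of the absolute values; square
  integrability makes every extended real finite, so the estimate returns to the reals.\<close>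

lemma Cauchy_Schwarz_integral:
  assumes "sq_int M f" "sq_int M g"
  shows "(\<integral>x. f x * g x \<partial>M)\<^sup>2 \<le> (\<integral>x. (f x)\<^sup>2 \<partial>M) * (\<integral>x. (g x)\<^sup>2 \<partial>M)"
proof -
  have [measurable]: "f \<in> borel_measurable M" "g \<in> borel_measurable M"
    and i: "integrable M (\<lambda>x. (f x)\<^sup>2)" "integrable M (\<lambda>x. (g x)\<^sup>2)"
    using assms by (auto simp: sq_int_def)
  have ifg: "integrable M (\<lambda>x. \<bar>f x * g x\<bar>)"
    using sq_int_integrable_mult[OF assms] by (rule integrable_abs)
  have "ennreal ((\<integral>x. \<bar>f x * g x\<bar> \<partial>M)\<^sup>2) = (\<integral>\<^sup>+x. ennreal \<bar>f x\<bar> * ennreal \<bar>g x\<bar> \<partial>M)\<^sup>2"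
    using ifg by (simp add: nn_integral_eq_integral[symmetric] ennreal_power[symmetric]
        ennreal_mult[symmetric] abs_mult)
  also have "\<dots> \<le> (\<integral>\<^sup>+x. ennreal \<bar>f x\<bar>^2 \<partial>M) * (\<integral>\<^sup>+x. ennreal \<bar>g x\<bar>^2 \<partial>M)"
    by (rule Cauchy_Schwarz_nn_integral) auto
  also have "\<dots> = ennreal ((\<integral>x. (f x)\<^sup>2 \<partial>M) * (\<integral>x. (g x)\<^sup>2 \<partial>M))"
    using i by (simp add: ennreal_power nn_integral_eq_integral ennreal_mult)
  finally have "(\<integral>x. \<bar>f x * g x\<bar> \<partial>M)\<^sup>2 \<le> (\<integral>x. (f x)\<^sup>2 \<partial>M) * (\<integral>x. (g x)\<^sup>2 \<partial>M)"
    by (subst (asm) ennreal_le_iff) auto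
  moreover have "(\<integral>x. f x * g x \<partial>M)\<^sup>2 \<le> (\<integral>x. \<bar>f x * g x\<bar> \<partial>M)\<^sup>2"
    using integral_abs_bound[of M "\<lambda>x. f x * g x"] by (metis abs_ge_zero power2_abs power_mono)
  ultimately show ?thesis by linarith
qed

text \<open>Square integrability of the limit and of every term is part of the notion: the Bochner
  integral of a non-integrable function is 0, so the convergence in the last line alone would say
  nothing.\<close>

definition L2_tendsto :: "'a measure \<Rightarrow> (nat \<Rightarrow> 'a \<Rightarrow> real) \<Rightarrow> ('a \<Rightarrow> real) \<Rightarrow> bool" where
  "L2_tendsto M h f \<longleftrightarrow> sq_int M f \<and> (\<forall>j. sq_int M (h j)) \<and>
     (\<lambda>j. \<integral>x. (f x - h j x)\<^sup>2 \<partial>M) \<longlonglongrightarrow> 0"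

text \<open>\<open>has_ito_integral\<close> states its convergences with nonnegative integrals and a
  merely measurable limit. One approximant at finite distance already forces the limit into L2,
  after which the real-valued form makes sense.\<close>

lemma L2_tendstoI_nn_integral:
  assumes f: "f \<in> borel_measurable M" and h: "\<And>j. sq_int M (h j)"
    and lim: "(\<lambda>j. \<integral>\<^sup>+x. ennreal ((f x - h j x)\<^sup>2) \<partial>M) \<longlonglongrightarrow> 0"
  shows "L2_tendsto M h f"
proof -
  have "\<forall>\<^sub>F j in sequentially. (\<integral>\<^sup>+x. ennreal ((f x - h j x)\<^sup>2) \<partial>M) < 1"
    using lim by (rule order_tendstoD) simp
  then obtain j where j: "(\<integral>\<^sup>+x. ennreal ((f x - h j x)\<^sup>2) \<partial>M) < 1"
    by (auto simp: eventually_sequentially)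
  have "(\<integral>\<^sup>+x. ennreal ((f x - h j x)\<^sup>2) \<partial>M) < \<infinity>"
    using j by (rule less_trans) simp
  then have "sq_int M (\<lambda>x. f x - h j x)"
    using f h[of j] unfolding sq_int_iff_nn_integral by auto
  from sq_int_add[OF this h[of j]] have sf: "sq_int M f" by simp
  have "(\<lambda>j. enn2real (\<integral>\<^sup>+x. ennreal ((f x - h j x)\<^sup>2) \<partial>M)) \<longlonglongrightarrow> 0"
    using lim by (intro tendsto_enn2real) simp_all
  moreover have "(\<integral>x. (f x - h j x)\<^sup>2 \<partial>M) = enn2real (\<integral>\<^sup>+x. ennreal ((f x - h j x)\<^sup>2) \<partial>M)" for j
    using sf h[of j] by (intro integral_eq_nn_integral) (auto simp: sq_int_def)
  ultimately show ?thesis using sf h by (simp add: L2_tendsto_def)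
qed

lemma L2_tendsto_integral_mult_left:
  assumes Z: "sq_int M Z" and h: "L2_tendsto M h f"
  shows "(\<lambda>j. \<integral>x. Z x * h j x \<partial>M) \<longlonglongrightarrow> (\<integral>x. Z x * f x \<partial>M)"
proof -
  let ?d = "\<lambda>j. \<integral>x. (f x - h j x)\<^sup>2 \<partial>M"
  have sd: "sq_int M (\<lambda>x. f x - h j x)" for j
    using h by (auto simp: L2_tendsto_def intro: sq_int_diff)
  have "(\<lambda>j. (\<integral>x. Z x * (f x - h j x) \<partial>M)\<^sup>2) \<longlonglongrightarrow> 0"
  proof (rule tendsto_sandwich[where f = "\<lambda>_. 0"])
    have "(\<lambda>j. (\<integral>x. (Z x)\<^sup>2 \<partial>M) * ?d j) \<longlonglongrightarrow> (\<integral>x. (Z x)\<^sup>2 \<partial>M) * 0"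
      using h by (intro tendsto_intros) (simp add: L2_tendsto_def)
    then show "(\<lambda>j. (\<integral>x. (Z x)\<^sup>2 \<partial>M) * ?d j) \<longlonglongrightarrow> 0" by simp
  qed (use Cauchy_Schwarz_integral[OF Z sd] in auto)
  then have "(\<lambda>j. \<integral>x. Z x * (f x - h j x) \<partial>M) \<longlonglongrightarrow> 0"
    by simp
  moreover have "(\<integral>x. Z x * (f x - h j x) \<partial>M) = (\<integral>x. Z x * f x \<partial>M) - (\<integral>x. Z x * h j x \<partial>M)" for j
  proof -
    have "integrable M (\<lambda>x. Z x * f x)" "integrable M (\<lambda>x. Z x * h j x)"
      using h Z by (auto simp: L2_tendsto_def intro: sq_int_integrable_mult)
    then show ?thesis by (simp add: right_diff_distrib)
  qed
  ultimately have "(\<lambda>j. (\<integral>x. Z x * f x \<partial>M) - ((\<integral>x. Z x * f x \<partial>M) - (\<integral>x. Z x * h j x \<partial>M)))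
      \<longlonglongrightarrow> (\<integral>x. Z x * f x \<partial>M) - 0"
    by (intro tendsto_intros) simp
  then show ?thesis by simp
qed

text \<open>Both factors move, so the product is expanded around the limits: h k = (f - h)(g - k) +
  f k + g h - f g. The first term tends to 0 by Cauchy-Schwarz, the next two have one fixed
  factor.\<close>

lemma L2_tendsto_integral_mult:
  assumes h: "L2_tendsto M h f" and k: "L2_tendsto M k g"
  shows "(\<lambda>j. \<integral>x. h j x * k j x \<partial>M) \<longlonglongrightarrow> (\<integral>x. f x * g x \<partial>M)"
proof -
  have sq: "sq_int M f" "sq_int M g" "\<And>j. sq_int M (h j)" "\<And>j. sq_int M (k j)"
    "\<And>j. sq_int M (\<lambda>x. f x - h j x)" "\<And>j. sq_int M (\<lambda>x. g x - k j x)"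
    using h k by (auto simp: L2_tendsto_def intro: sq_int_diff)
  note int = sq[THEN sq_int_integrable_mult]
  have "(\<lambda>j. (\<integral>x. (f x - h j x) * (g x - k j x) \<partial>M)\<^sup>2) \<longlonglongrightarrow> 0"
  proof (rule tendsto_sandwich[where f = "\<lambda>_. 0"])
    have "(\<lambda>j. (\<integral>x. (f x - h j x)\<^sup>2 \<partial>M) * (\<integral>x. (g x - k j x)\<^sup>2 \<partial>M)) \<longlonglongrightarrow> 0 * 0"
      using h k by (intro tendsto_mult) (simp_all add: L2_tendsto_def)
    then show "(\<lambda>j. (\<integral>x. (f x - h j x)\<^sup>2 \<partial>M) * (\<integral>x. (g x - k j x)\<^sup>2 \<partial>M)) \<longlonglongrightarrow> 0" by simp
  qed (use Cauchy_Schwarz_integral[OF sq(5,6)] in auto)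
  then have "(\<lambda>j. \<integral>x. (f x - h j x) * (g x - k j x) \<partial>M) \<longlonglongrightarrow> 0"
    by simp
  moreover have "(\<integral>x. h j x * k j x \<partial>M) = (\<integral>x. (f x - h j x) * (g x - k j x) \<partial>M)
      + (\<integral>x. f x * k j x \<partial>M) + (\<integral>x. g x * h j x \<partial>M) - (\<integral>x. f x * g x \<partial>M)" for j
  proof -
    have "h j x * k j x = (f x - h j x) * (g x - k j x) + f x * k j x + g x * h j x - f x * g x" for x
      by (simp add: algebra_simps)
    then show ?thesis
      by (simp add: sq sq_int_integrable_mult)
  qed
  moreover have "(\<lambda>j. (\<integral>x. (f x - h j x) * (g x - k j x) \<partial>M)
      + (\<integral>x. f x * k j x \<partial>M) + (\<integral>x. g x * h j x \<partial>M) - (\<integral>x. f x * g x \<partial>M))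
      \<longlonglongrightarrow> 0 + (\<integral>x. f x * g x \<partial>M) + (\<integral>x. g x * f x \<partial>M) - (\<integral>x. f x * g x \<partial>M)"
    by (intro tendsto_intros L2_tendsto_integral_mult_left sq h k calculation)
  ultimately show ?thesis by (simp add: mult.commute)
qed

section \<open>The Ito isometry and the martingale property\<close>

text \<open>The stochastic arguments rest on the defining properties of Brownian motion relative to
  \<open>F\<close> and on the monotonicity of the family; the augmented filtration is put in at the
  end by \<open>adapted_bm_aug_filtration\<close>.\<close>

locale adapted_bm = prob_space M for M :: "'w measure" +
  fixes F :: "real \<Rightarrow> 'w measure" and W :: "real \<Rightarrow> 'w \<Rightarrow> real"
  assumes bm: "brownian_motion M F W"
    and subalg: "0 \<le> t \<Longrightarrow> subalgebra M (F t)"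
    and filtration_mono: "0 \<le> s \<Longrightarrow> s \<le> t \<Longrightarrow> subalgebra (F t) (F s)"
begin

lemma adapted_measurable: "0 \<le> t \<Longrightarrow> f \<in> borel_measurable (F t) \<Longrightarrow> f \<in> borel_measurable M"
  using measurable_from_subalg[OF subalg] by auto

lemma adapted_mono:
  "0 \<le> s \<Longrightarrow> s \<le> t \<Longrightarrow> f \<in> borel_measurable (F s) \<Longrightarrow> f \<in> borel_measurable (F t)"
  using measurable_from_subalg[OF filtration_mono] by auto

lemma W_measurable: "0 \<le> t \<Longrightarrow> W t \<in> borel_measurable M"
  and W_adapted: "0 \<le> t \<Longrightarrow> W t \<in> borel_measurable (F t)"
  using bm by (auto simp: brownian_motion_def)

lemma increment_normal:
  "0 \<le> c \<Longrightarrow> c < d \<Longrightarrow>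
    distributed M lborel (\<lambda>w. W d w - W c w) (normal_density 0 (sqrt (d - c)))"
  using bm by (auto simp: brownian_motion_def)

lemma increment_moments:
  assumes "0 \<le> c" "c \<le> d"
  shows "sq_int M (\<lambda>w. W d w - W c w)" (is ?A)
    and "expectation (\<lambda>w. W d w - W c w) = 0" (is ?B)
    and "expectation (\<lambda>w. (W d w - W c w)\<^sup>2) = d - c" (is ?C)
proof -
  have [measurable]: "W d \<in> borel_measurable M" "W c \<in> borel_measurable M"
    using assms W_measurable by auto
  have "?A \<and> ?B \<and> ?C"
  proof (cases "c = d")
    case True
    then show ?thesis by (simp add: sq_int_zero)
  next
    case False
    with assms have cd: "c < d" "0 < sqrt (d - c)" by auto
    note D = increment_normal[OF assms(1) cd(1)]
    have e: ?B using normal_distributed_expectation[OF cd(2) D] .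
    moreover have v: ?C using normal_distributed_variance[OF cd(2) D] e cd(1) by simp
    \<comment> \<open>The integral of a non-integrable function is 0, whereas this one equals d - c
      > 0; so the known variance itself yields integrability.\<close>
    moreover have "integrable M (\<lambda>w. (W d w - W c w)\<^sup>2)"
      using v cd(1) not_integrable_integral_eq by force
    ultimately show ?thesis by (simp add: sq_int_def)
  qed
  then show ?A ?B ?C by auto
qed

text \<open>\<open>brownian_motion\<close> gives independence of two families of sets,
  \<open>indep_var\<close> asks for it on generated sigma-algebras. Preimages under Y lie in
  \<open>F c\<close>, so on that side one only passes to a smaller family.\<close>

lemma indep_increment:
  assumes "0 \<le> c" "c < d" and Y: "Y \<in> borel_measurable (F c)"
  shows "indep_var borel Y borel (\<lambda>w. W d w - W c w)"
proof -
  let ?D = "\<lambda>w. W d w - W c w"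
  let ?G = "{?D -` B \<inter> space M | B. B \<in> sets (borel :: real measure)}"
  have [measurable]: "W d \<in> borel_measurable M" "W c \<in> borel_measurable M" "Y \<in> borel_measurable M"
    using assms W_measurable adapted_measurable by auto
  have sp: "space (F c) = space M" using subalg[OF assms(1)] by (simp add: subalgebra_def)
  have "indep_set (sets (F c)) ?G"
    using bm assms by (auto simp: brownian_motion_def)
  then have i: "indep_sets (case_bool (sets (F c)) ?G) UNIV" by (simp add: indep_set_def)
  have 1: "sigma_sets (space M) {Y -` A \<inter> space M |A. A \<in> sets borel} \<subseteq> sets (F c)"
    using measurable_sets[OF Y] sp by (intro sets.sigma_sets_subset[of _ "F c", unfolded sp]) auto
  \<comment> \<open>The preimages of all Borel sets under one map already form a sigma-algebra, so
    generating adds nothing on the side of the increment.\<close>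
  have 2: "sigma_sets (space M) ?G = ?G"
  proof -
    have "sets (vimage_algebra (space M) ?D borel) = ?G"
      by (rule sets_vimage_algebra2) auto
    then show ?thesis
      using sets.sigma_sets_eq[of "vimage_algebra (space M) ?D borel"] by simp
  qed
  have "indep_set (sigma_sets (space M) {Y -` A \<inter> space M |A. A \<in> sets borel}) (sigma_sets (space M) ?G)"
    unfolding 2 indep_set_def
    by (rule indep_sets_mono_sets[OF i]) (use 1 in \<open>auto split: bool.split_asm\<close>)
  then show ?thesis unfolding indep_var_eq by simp
qed

text \<open>Independence splits the expectation, and the increment has mean 0. The case c = d is
  separate because \<open>brownian_motion\<close> speaks of strict increments; there both claims are
  trivial.\<close>

lemma increment_orthogonal:
  assumes c: "0 \<le> c" "c \<le> d" and Y: "Y \<in> borel_measurable (F c)" and iY: "integrable M Y"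
  shows "integrable M (\<lambda>w. Y w * (W d w - W c w))" (is ?A)
    and "expectation (\<lambda>w. Y w * (W d w - W c w)) = 0" (is ?B)
proof -
  have "?A \<and> ?B"
  proof (cases "c = d")
    case False
    then have cd: "c < d" using c by simp
    note iW = sq_int_imp_integrable[OF increment_moments(1)[OF c]]
    note i = indep_increment[OF c(1) cd Y]
    show ?thesis
      using indep_var_integrable[OF i iY iW] indep_var_lebesgue_integral[OF i iY iW]
        increment_moments(2)[OF c] by simp
  qed simp
  then show ?A ?B by auto
qed

lemma increment_squared:
  assumes c: "0 \<le> c" "c \<le> d" and Y: "Y \<in> borel_measurable (F c)" and iY: "integrable M Y"
  shows "integrable M (\<lambda>w. Y w * (W d w - W c w)\<^sup>2)" (is ?A)
    and "expectation (\<lambda>w. Y w * (W d w - W c w)\<^sup>2) = expectation Y * (d - c)" (is ?B)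
proof -
  have "?A \<and> ?B"
  proof (cases "c = d")
    case False
    then have cd: "c < d" using c by simp
    note iW = sq_int_integrable_power2[OF increment_moments(1)[OF c]]
    have i: "indep_var borel Y borel (\<lambda>w. (W d w - W c w)\<^sup>2)"
      using indep_var_compose[OF indep_increment[OF c(1) cd Y], of "\<lambda>x. x" borel "\<lambda>x. x\<^sup>2" borel]
      by (simp add: comp_def)
    show ?thesis
      using indep_var_integrable[OF i iY iW] indep_var_lebesgue_integral[OF i iY iW]
        increment_moments(3)[OF c] by simp
  qed simp
  then show ?A ?B by auto
qed

lemma weighted_increment_sq_int:
  assumes "0 \<le> a" "a \<le> b" "\<xi> \<in> borel_measurable M" "\<And>w. w \<in> space M \<Longrightarrow> \<bar>\<xi> w\<bar> \<le> K"
  shows "sq_int M (\<lambda>w. \<xi> w * (W b w - W a w))"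
  using increment_moments(1)[OF assms(1,2)] assms(3,4) by (intro sq_int_bounded_mult) auto

text \<open>The length of the overlap is what the time integral of the two indicators will give, so
  this is the isometry for a single pair of summands. Both increments are cut at c and at e = min b
  d; all products of pieces vanish except the square over the common piece from c to e.\<close>

lemma increment_product_aux:
  assumes o: "0 \<le> a" "a \<le> b" "a \<le> c" "c \<le> d"
    and \<xi>: "\<xi> \<in> borel_measurable (F a)" "\<And>w. w \<in> space M \<Longrightarrow> \<bar>\<xi> w\<bar> \<le> K"
    and \<zeta>: "\<zeta> \<in> borel_measurable (F c)" "\<And>w. w \<in> space M \<Longrightarrow> \<bar>\<zeta> w\<bar> \<le> L"
  shows "expectation (\<lambda>w. (\<xi> w * (W b w - W a w)) * (\<zeta> w * (W d w - W c w)))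
       = expectation (\<lambda>w. \<xi> w * \<zeta> w) * measure lborel ({a<..b} \<inter> {c<..d})"
proof -
  have c0: "0 \<le> c" using o by linarith
  have \<xi>c: "\<xi> \<in> borel_measurable (F c)" using adapted_mono[OF o(1,3) \<xi>(1)] .
  have m[measurable]: "\<xi> \<in> borel_measurable M" "\<zeta> \<in> borel_measurable M"
    using adapted_measurable[OF c0] \<xi>c \<zeta>(1) by auto
  have Wc: "W s \<in> borel_measurable (F r)" if "0 \<le> s" "s \<le> r" for s r
    using adapted_mono[OF that W_adapted[OF that(1)]] .
  have isum: "integrable M (\<lambda>w. (\<xi> w * \<zeta> w) * (W s w - W r w))" if "0 \<le> r" "r \<le> s" for r s
  proof -
    have "integrable M (\<lambda>w. (\<xi> w * (W s w - W r w)) * \<zeta> w)"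
      by (intro sq_int_integrable_mult weighted_increment_sq_int[OF that m(1) \<xi>(2)]
          sq_int_bounded[OF m(2) \<zeta>(2)])
    then show ?thesis by (simp add: mult_ac)
  qed
  have iY: "integrable M (\<lambda>w. \<xi> w * \<zeta> w)"
    by (intro sq_int_integrable_mult sq_int_bounded[OF m(1) \<xi>(2)] sq_int_bounded[OF m(2) \<zeta>(2)])
  have Yc: "(\<lambda>w. \<xi> w * \<zeta> w) \<in> borel_measurable (F c)" using \<xi>c \<zeta>(1) by simp
  show ?thesis
  proof (cases "b \<le> c")
    \<comment> \<open>With disjoint intervals the whole first increment is known at time c and joins
      the factor in front of the later increment.\<close>
    case True
    have "(\<lambda>w. (\<xi> w * \<zeta> w) * (W b w - W a w)) \<in> borel_measurable (F c)"
      using Yc Wc[of b c] Wc[of a c] True o by simp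
    from increment_orthogonal(2)[OF c0 o(4) this isum]
    have "expectation (\<lambda>w. (\<xi> w * \<zeta> w) * (W b w - W a w) * (W d w - W c w)) = 0" using o by simp
    moreover have "measure lborel ({a<..b} \<inter> {c<..d}) = 0"
    proof -
      have "{a<..b} \<inter> {c<..d} = {}" using True by auto
      then show ?thesis by (simp only: measure_empty)
    qed
    ultimately show ?thesis by (simp only: mult_ac mult_zero_right)
  next
    case False
    define e where "e = min b d"
    have e: "c \<le> e" "e \<le> b" "e \<le> d" "0 \<le> e" using False o by (auto simp: e_def)
    define Y where "Y w = \<xi> w * \<zeta> w" for w
    have Ye: "Y \<in> borel_measurable (F e)" using adapted_mono[OF c0 e(1) Yc] by (simp add: Y_def[abs_def])
    have i1: "integrable M (\<lambda>w. Y w * (W c w - W a w) * (W d w - W c w))"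
      "expectation (\<lambda>w. Y w * (W c w - W a w) * (W d w - W c w)) = 0"
    proof -
      have "(\<lambda>w. Y w * (W c w - W a w)) \<in> borel_measurable (F c)"
        using Yc Wc[of c c] Wc[of a c] o c0 by (simp add: Y_def)
      from increment_orthogonal[OF c0 o(4) this] isum[OF o(1,3)]
      show "integrable M (\<lambda>w. Y w * (W c w - W a w) * (W d w - W c w))"
        "expectation (\<lambda>w. Y w * (W c w - W a w) * (W d w - W c w)) = 0"
        by (simp_all add: Y_def)
    qed
    have i2: "integrable M (\<lambda>w. Y w * (W e w - W c w)\<^sup>2)"
      "expectation (\<lambda>w. Y w * (W e w - W c w)\<^sup>2) = expectation Y * (e - c)"
      using increment_squared[OF c0 e(1) Yc iY] by (simp_all add: Y_def[abs_def])
    have Yec: "(\<lambda>w. Y w * (W e w - W c w)) \<in> borel_measurable (F e)"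
      using Ye Wc[of e e] Wc[of c e] e c0 by simp
    have i3: "integrable M (\<lambda>w. Y w * (W e w - W c w) * (W s w - W e w))"
      "expectation (\<lambda>w. Y w * (W e w - W c w) * (W s w - W e w)) = 0" if "e \<le> s" for s
      using increment_orthogonal[OF e(4) that Yec] isum[OF c0 e(1)] by (simp_all add: Y_def)
    \<comment> \<open>As e is one of b and d, one of the two remainders beyond e vanishes, and the
      product of the remainders drops out of the expansion.\<close>
    have z: "(W b w - W e w) * (W d w - W e w) = 0" for w
      by (auto simp: e_def min_def)
    have eq: "(\<xi> w * (W b w - W a w)) * (\<zeta> w * (W d w - W c w)) =
      Y w * (W c w - W a w) * (W d w - W c w) + Y w * (W e w - W c w)\<^sup>2
      + Y w * (W e w - W c w) * (W d w - W e w) + Y w * (W e w - W c w) * (W b w - W e w)" for w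
    proof -
      have "(\<xi> w * (W b w - W a w)) * (\<zeta> w * (W d w - W c w)) =
      Y w * (W c w - W a w) * (W d w - W c w) + Y w * (W e w - W c w)\<^sup>2
      + Y w * (W e w - W c w) * (W d w - W e w) + Y w * (W e w - W c w) * (W b w - W e w)
      + Y w * ((W b w - W e w) * (W d w - W e w))"
        unfolding Y_def by algebra
      then show ?thesis unfolding z by simp
    qed
    have "{a<..b} \<inter> {c<..d} = {c<..e}" using o by (auto simp: e_def)
    then show ?thesis
      unfolding eq using i1 i2 i3[OF e(3)] i3[OF e(2)] e(1) by (simp add: Y_def[abs_def])
  qed
qed

lemma increment_product:
  assumes o: "0 \<le> a" "a \<le> b" "0 \<le> c" "c \<le> d"
    and \<xi>: "\<xi> \<in> borel_measurable (F a)" "\<And>w. w \<in> space M \<Longrightarrow> \<bar>\<xi> w\<bar> \<le> K"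
    and \<zeta>: "\<zeta> \<in> borel_measurable (F c)" "\<And>w. w \<in> space M \<Longrightarrow> \<bar>\<zeta> w\<bar> \<le> L"
  shows "expectation (\<lambda>w. (\<xi> w * (W b w - W a w)) * (\<zeta> w * (W d w - W c w)))
       = expectation (\<lambda>w. \<xi> w * \<zeta> w) * measure lborel ({a<..b} \<inter> {c<..d})"
proof (cases "a \<le> c")
  case True
  then show ?thesis using increment_product_aux[OF o(1,2) True o(4) \<xi> \<zeta>] by simp
next
  case False
  then have "c \<le> a" by simp
  from increment_product_aux[OF o(3,4) this o(2) \<zeta> \<xi>] show ?thesis
    by (simp add: mult_ac Int_commute)
qed

end

section \<open>Products of a time interval with a probability space\<close>

lemma finite_measure_lebesgue_on_Icc: "finite_measure (lebesgue_on {a..b::real})"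
  by (rule finite_measure_lebesgue_on) simp

lemma (in pair_sigma_finite) integral_pair_mult:
  fixes p q :: "_ \<Rightarrow> real"
  assumes p: "integrable M1 p" and q: "integrable M2 q"
  shows "integrable (M1 \<Otimes>\<^sub>M M2) (\<lambda>(x, y). p x * q y)" (is ?A)
    and "(\<integral>(x, y). p x * q y \<partial>(M1 \<Otimes>\<^sub>M M2)) = (\<integral>x. p x \<partial>M1) * (\<integral>y. q y \<partial>M2)" (is ?B)
proof -
  have [measurable]: "p \<in> borel_measurable M1" "q \<in> borel_measurable M2" using p q by auto
  show i: ?A
  proof (rule Fubini_integrable)
    show "(\<lambda>(x, y). p x * q y) \<in> borel_measurable (M1 \<Otimes>\<^sub>M M2)" by measurable
    show "integrable M1 (\<lambda>x. \<integral>y. norm (case (x, y) of (x, y) \<Rightarrow> p x * q y) \<partial>M2)"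
      using p by (simp add: abs_mult)
    show "AE x in M1. integrable M2 (\<lambda>y. case (x, y) of (x, y) \<Rightarrow> p x * q y)"
      using q by simp
  qed
  show ?B using integral_fst'[OF i] by simp
qed

lemma pair_sigma_finite_lebesgue_on:
  "prob_space M \<Longrightarrow> pair_sigma_finite (lebesgue_on {a..b::real}) M"
  using finite_measure_lebesgue_on_Icc[of a b]
  by (auto simp: pair_sigma_finite_def prob_space_imp_sigma_finite
      intro: finite_measure.axioms)

lemma finite_measure_pair:
  assumes "finite_measure N" "finite_measure M"
  shows "finite_measure (N \<Otimes>\<^sub>M M)"
proof -
  interpret N: finite_measure N by fact
  interpret M: finite_measure M by fact
  show ?thesis
    by (rule finite_measureI)
       (simp add: space_pair_measure M.emeasure_pair_measure_Times ennreal_mult_eq_top_iff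
         N.emeasure_finite M.emeasure_finite)
qed

lemma integral_double_sum:
  fixes f :: "nat \<Rightarrow> nat \<Rightarrow> 'a \<Rightarrow> real"
  assumes "\<And>i j. i < k \<Longrightarrow> j < l \<Longrightarrow> integrable M (f i j)"
  shows "(\<integral>x. (\<Sum>i<k. \<Sum>j<l. f i j x) \<partial>M) = (\<Sum>i<k. \<Sum>j<l. \<integral>x. f i j x \<partial>M)"
proof -
  have "(\<integral>x. (\<Sum>i<k. \<Sum>j<l. f i j x) \<partial>M) = (\<Sum>i<k. \<integral>x. (\<Sum>j<l. f i j x) \<partial>M)"
    by (rule Bochner_Integration.integral_sum) (use assms in auto)
  also have "\<dots> = (\<Sum>i<k. \<Sum>j<l. \<integral>x. f i j x \<partial>M)"
    by (intro sum.cong refl Bochner_Integration.integral_sum) (use assms in auto)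
  finally show ?thesis .
qed

lemma borel_measurable_lebesgue_onI:
  "f \<in> borel_measurable borel \<Longrightarrow> f \<in> borel_measurable (lebesgue_on S)"
  by (rule measurable_restrict_space1, rule measurable_completion) simp

lemma borel_measurable_indicator_Ioc [measurable]:
  "(indicator {p<..q::real} :: real \<Rightarrow> real) \<in> borel_measurable (lebesgue_on S)"
  by (rule borel_measurable_lebesgue_onI) simp

text \<open>Evaluates the deterministic half of the isometry in exactly the form of
  \<open>increment_product\<close>. The first interval lies in [a,b], so restricting Lebesgue
  measure to [a,b] loses nothing of the overlap.\<close>

lemma measure_lebesgue_on_Ioc_Int:
  assumes "a \<le> p" "p' \<le> b"
  shows "(\<integral>s. indicator {p<..p'} s * indicator {q<..q'} s \<partial>lebesgue_on {a..b}) =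
     measure lborel ({p<..p'} \<inter> {q<..q'::real})"
proof -
  let ?S = "{p<..p'} \<inter> {q<..q'}"
  have S: "?S \<subseteq> {a..b}" using assms by auto
  have "(\<integral>s. indicator {p<..p'} s * indicator {q<..q'} s \<partial>lebesgue_on {a..b}) =
     (\<integral>s. indicat_real ?S s \<partial>lebesgue_on {a..b})"
    by (simp only: indicator_inter_arith)
  also have "\<dots> = measure (lebesgue_on {a..b}) ?S"
  proof -
    have "?S \<inter> space (lebesgue_on {a..b}) = ?S" using S by auto
    then show ?thesis by (simp only: Bochner_Integration.integral_indicator)
  qed
  also have "\<dots> = measure lebesgue ?S" by (rule measure_restrict_space) (use S in auto)
  also have "\<dots> = measure lborel ?S" by (rule measure_completion) simp
  finally show ?thesis .
qed

section \<open>The isometry for simple and for general integrands\<close>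

context adapted_bm
begin

abbreviation PM :: "real \<Rightarrow> real \<Rightarrow> (real \<times> 'w) measure" where
  "PM a b \<equiv> lebesgue_on {a..b} \<Otimes>\<^sub>M M"

lemma finite_PM: "finite_measure (PM a b)"
  by (intro finite_measure_pair finite_measure_lebesgue_on_Icc finite_measure_axioms)

lemma PM_pair: "pair_sigma_finite (lebesgue_on {a..b::real}) M"
  by (rule pair_sigma_finite_lebesgue_on) (rule prob_space_axioms)

lemma simple_dataD:
  fixes \<xi> :: "nat \<Rightarrow> 'w \<Rightarrow> real"
  assumes sd: "simple_data M F a b k \<tau> \<xi>" and a: "0 \<le> a" and i: "i < k"
  shows "a \<le> \<tau> i" "0 \<le> \<tau> i" "\<tau> i \<le> \<tau> (Suc i)" "\<tau> (Suc i) \<le> b"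
    "\<xi> i \<in> borel_measurable (F (\<tau> i))" "\<xi> i \<in> borel_measurable M"
    "\<exists>K. \<forall>w\<in>space M. \<bar>\<xi> i w\<bar> \<le> K"
proof -
  show 1: "a \<le> \<tau> i" "\<tau> i \<le> \<tau> (Suc i)" "\<tau> (Suc i) \<le> b" "\<xi> i \<in> borel_measurable (F (\<tau> i))"
    "\<exists>K. \<forall>w\<in>space M. \<bar>\<xi> i w\<bar> \<le> K"
    using sd i by (auto simp: simple_data_def)
  then show "0 \<le> \<tau> i" using a by linarith
  then show "\<xi> i \<in> borel_measurable M" using 1(4) adapted_measurable by blast
qed

lemma simple_ito_sq_int:
  fixes \<xi> :: "nat \<Rightarrow> 'w \<Rightarrow> real"
  assumes "simple_data M F a b k \<tau> \<xi>" "0 \<le> a"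
  shows "sq_int M (simple_ito W k \<tau> \<xi>)"
proof -
  have "sq_int M (\<lambda>w. \<Sum>i<k. \<xi> i w * (W (\<tau> (Suc i)) w - W (\<tau> i) w))"
  proof (rule sq_int_sum)
    fix i assume "i \<in> {..<k}"
    then have i: "i < k" by simp
    note D = simple_dataD[OF assms i]
    from D(7) obtain K where "\<And>w. w \<in> space M \<Longrightarrow> \<bar>\<xi> i w\<bar> \<le> K" by blast
    then show "sq_int M (\<lambda>w. \<xi> i w * (W (\<tau> (Suc i)) w - W (\<tau> i) w))"
      by (rule weighted_increment_sq_int[OF D(2,3,6)])
  qed
  then show ?thesis by (simp add: simple_ito_def[abs_def] mult.commute)
qed

lemma simple_proc_sq_int:
  fixes \<xi> :: "nat \<Rightarrow> 'w \<Rightarrow> real"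
  assumes "simple_data M F a b k \<tau> \<xi>" "0 \<le> a"
  shows "sq_int (PM c d) (\<lambda>(s, w). simple_proc k \<tau> \<xi> s w)"
proof -
  interpret P: finite_measure "PM c d" by (rule finite_PM)
  have "sq_int (PM c d) (\<lambda>x. \<Sum>i<k. indicator {\<tau> i<..\<tau> (Suc i)} (fst x) * \<xi> i (snd x))"
  proof (rule sq_int_sum)
    fix i assume "i \<in> {..<k}"
    then have i: "i < k" by simp
    note D = simple_dataD[OF assms i]
    from D(7) obtain K where K: "\<And>w. w \<in> space M \<Longrightarrow> \<bar>\<xi> i w\<bar> \<le> K" by blast
    have [measurable]: "\<xi> i \<in> borel_measurable M" by (rule D(6))
    show "sq_int (PM c d) (\<lambda>x. indicator {\<tau> i<..\<tau> (Suc i)} (fst x) * \<xi> i (snd x))"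
    proof (rule P.sq_int_bounded)
      fix x assume "x \<in> space (PM c d)"
      then have "\<bar>\<xi> i (snd x)\<bar> \<le> K" using K by (auto simp: space_pair_measure)
      then show "\<bar>indicator {\<tau> i<..\<tau> (Suc i)} (fst x) * \<xi> i (snd x)\<bar> \<le> K"
        by (auto simp: indicator_def)
    qed measurable
  qed
  then show ?thesis by (simp add: simple_proc_def case_prod_unfold)
qed

text \<open>The two processes may use different partitions: \<open>increment_product\<close> handles
  every pair of intervals however they overlap, so expanding both sides into double sums suffices
  and no common refinement is formed.\<close>

lemma simple_isometry:
  fixes \<xi> \<zeta> :: "nat \<Rightarrow> 'w \<Rightarrow> real"
  assumes \<xi>: "simple_data M F a b k \<tau> \<xi>" and \<zeta>: "simple_data M F a b l \<sigma> \<zeta>" and a: "0 \<le> a"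
  shows "expectation (\<lambda>w. simple_ito W k \<tau> \<xi> w * simple_ito W l \<sigma> \<zeta> w) =
    (\<integral>x. simple_proc k \<tau> \<xi> (fst x) (snd x) * simple_proc l \<sigma> \<zeta> (fst x) (snd x) \<partial>PM a b)"
proof -
  interpret P: finite_measure "PM a b" by (rule finite_PM)
  interpret Q: pair_sigma_finite "lebesgue_on {a..b}" M by (rule PM_pair)
  interpret L: finite_measure "lebesgue_on {a..b}" by (rule finite_measure_lebesgue_on_Icc)
  let ?I = "\<lambda>i w. \<xi> i w * (W (\<tau> (Suc i)) w - W (\<tau> i) w)"
  let ?J = "\<lambda>j w. \<zeta> j w * (W (\<sigma> (Suc j)) w - W (\<sigma> j) w)"
  let ?p = "\<lambda>i j s. indicator {\<tau> i<..\<tau> (Suc i)} s * (indicator {\<sigma> j<..\<sigma> (Suc j)} s :: real)"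
  have one: "integrable M (\<lambda>w. ?I i w * ?J j w)"
    "integrable (PM a b) (\<lambda>(s, w). ?p i j s * (\<xi> i w * \<zeta> j w))"
    "expectation (\<lambda>w. ?I i w * ?J j w) = (\<integral>(s, w). ?p i j s * (\<xi> i w * \<zeta> j w) \<partial>PM a b)"
    if i: "i < k" and j: "j < l" for i j
  proof -
    note D = simple_dataD[OF \<xi> a i] and E = simple_dataD[OF \<zeta> a j]
    from D(7) obtain K where K: "\<And>w. w \<in> space M \<Longrightarrow> \<bar>\<xi> i w\<bar> \<le> K" by blast
    from E(7) obtain L where L: "\<And>w. w \<in> space M \<Longrightarrow> \<bar>\<zeta> j w\<bar> \<le> L" by blast
    show "integrable M (\<lambda>w. ?I i w * ?J j w)"
      by (intro sq_int_integrable_mult weighted_increment_sq_int[OF D(2,3,6) K]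
          weighted_increment_sq_int[OF E(2,3,6) L])
    have q: "integrable M (\<lambda>w. \<xi> i w * \<zeta> j w)"
      by (intro sq_int_integrable_mult sq_int_bounded[OF D(6) K] sq_int_bounded[OF E(6) L])
    have p: "integrable (lebesgue_on {a..b}) (?p i j)"
    proof (rule L.integrable_const_bound[where B = 1])
      show "?p i j \<in> borel_measurable (lebesgue_on {a..b})" by measurable
    qed (auto simp: indicator_def)
    show "integrable (PM a b) (\<lambda>(s, w). ?p i j s * (\<xi> i w * \<zeta> j w))"
      by (rule Q.integral_pair_mult(1)[OF p q])
    show "expectation (\<lambda>w. ?I i w * ?J j w) = (\<integral>(s, w). ?p i j s * (\<xi> i w * \<zeta> j w) \<partial>PM a b)"
      unfolding Q.integral_pair_mult(2)[OF p q] measure_lebesgue_on_Ioc_Int[OF D(1,4)]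
      using increment_product[OF D(2,3) E(2,3) D(5) K E(5) L] by (simp add: mult.commute)
  qed
  have "expectation (\<lambda>w. simple_ito W k \<tau> \<xi> w * simple_ito W l \<sigma> \<zeta> w) =
      expectation (\<lambda>w. \<Sum>i<k. \<Sum>j<l. ?I i w * ?J j w)"
    by (simp add: simple_ito_def sum_product mult.commute)
  also have "\<dots> = (\<Sum>i<k. \<Sum>j<l. expectation (\<lambda>w. ?I i w * ?J j w))"
    by (rule integral_double_sum) (rule one(1))
  also have "\<dots> = (\<Sum>i<k. \<Sum>j<l. \<integral>(s, w). ?p i j s * (\<xi> i w * \<zeta> j w) \<partial>PM a b)"
    using one(3) by simp
  also have "\<dots> = (\<integral>x. (\<Sum>i<k. \<Sum>j<l. case x of (s, w) \<Rightarrow> ?p i j s * (\<xi> i w * \<zeta> j w)) \<partial>PM a b)"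
    by (rule integral_double_sum[symmetric]) (rule one(2))
  also have "\<dots> = (\<integral>x. simple_proc k \<tau> \<xi> (fst x) (snd x) * simple_proc l \<sigma> \<zeta> (fst x) (snd x) \<partial>PM a b)"
    by (simp only: simple_proc_def sum_product case_prod_unfold real_scaleR_def mult_ac)
  finally show ?thesis .
qed

lemma has_ito_integralE:
  fixes \<phi> :: "real \<Rightarrow> 'w \<Rightarrow> real"
  assumes I: "has_ito_integral M F W a b \<phi> I" and a: "0 \<le> a"
  obtains k \<tau> \<xi> where "\<And>j. simple_data M F a b (k j) (\<tau> j) (\<xi> j)"
    "L2_tendsto (PM a b) (\<lambda>j (s, w). simple_proc (k j) (\<tau> j) (\<xi> j) s w) (\<lambda>(s, w). \<phi> s w)"
    "L2_tendsto M (\<lambda>j. simple_ito W (k j) (\<tau> j) (\<xi> j)) I"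
proof -
  from I obtain k \<tau> \<xi> where sd: "\<And>j::nat. simple_data M F a b (k j) (\<tau> j) (\<xi> j)" and
    1: "(\<lambda>j. \<integral>\<^sup>+ (s, w). ennreal ((norm (\<phi> s w - simple_proc (k j) (\<tau> j) (\<xi> j) s w))\<^sup>2)
               \<partial>PM a b) \<longlonglongrightarrow> 0" and
    2: "(\<lambda>j. \<integral>\<^sup>+ w. ennreal ((norm (I w - simple_ito W (k j) (\<tau> j) (\<xi> j) w))\<^sup>2) \<partial>M) \<longlonglongrightarrow> 0"
    and m: "(\<lambda>(s, w). \<phi> s w) \<in> borel_measurable (PM a b)" "I \<in> borel_measurable M"
    unfolding has_ito_integral_def by blast
  show thesis
  proof
    show "simple_data M F a b (k j) (\<tau> j) (\<xi> j)" for j by (rule sd)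
    show "L2_tendsto (PM a b) (\<lambda>j (s, w). simple_proc (k j) (\<tau> j) (\<xi> j) s w) (\<lambda>(s, w). \<phi> s w)"
      using 1 by (intro L2_tendstoI_nn_integral m simple_proc_sq_int[OF sd a]) (simp add: case_prod_unfold)
    show "L2_tendsto M (\<lambda>j. simple_ito W (k j) (\<tau> j) (\<xi> j)) I"
      using 2 by (intro L2_tendstoI_nn_integral m simple_ito_sq_int[OF sd a]) simp
  qed
qed

lemma has_ito_integral_sq_int:
  fixes \<phi> :: "real \<Rightarrow> 'w \<Rightarrow> real"
  assumes I: "has_ito_integral M F W a b \<phi> I" and a: "0 \<le> a"
  shows "sq_int M I" "sq_int (PM a b) (\<lambda>x. \<phi> (fst x) (snd x))"
proof -
  obtain k \<tau> \<xi> where "\<And>j. simple_data M F a b (k j) (\<tau> j) (\<xi> j)" and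
    "L2_tendsto (PM a b) (\<lambda>j (s, w). simple_proc (k j) (\<tau> j) (\<xi> j) s w) (\<lambda>(s, w). \<phi> s w)"
    "L2_tendsto M (\<lambda>j. simple_ito W (k j) (\<tau> j) (\<xi> j)) I"
    by (rule has_ito_integralE[OF I a]) (rule that)
  then show "sq_int M I" "sq_int (PM a b) (\<lambda>x. \<phi> (fst x) (snd x))"
    by (simp_all add: L2_tendsto_def case_prod_unfold)
qed

text \<open>Both sides are limits of the same real sequence, by the isometry for the simple
  approximants and the continuity of inner products in L2.\<close>

lemma ito_isometry:
  fixes \<phi> \<psi> :: "real \<Rightarrow> 'w \<Rightarrow> real"
  assumes I: "has_ito_integral M F W a b \<phi> I" and J: "has_ito_integral M F W a b \<psi> J" and a: "0 \<le> a"
  shows "expectation (\<lambda>w. I w * J w) = (\<integral>x. \<phi> (fst x) (snd x) * \<psi> (fst x) (snd x) \<partial>PM a b)"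
proof -
  obtain k \<tau> \<xi> where 1: "\<And>j. simple_data M F a b (k j) (\<tau> j) (\<xi> j)"
    "L2_tendsto (PM a b) (\<lambda>j (s, w). simple_proc (k j) (\<tau> j) (\<xi> j) s w) (\<lambda>(s, w). \<phi> s w)"
    "L2_tendsto M (\<lambda>j. simple_ito W (k j) (\<tau> j) (\<xi> j)) I"
    by (rule has_ito_integralE[OF I a]) (rule that)
  obtain l \<sigma> \<zeta> where 2: "\<And>j. simple_data M F a b (l j) (\<sigma> j) (\<zeta> j)"
    "L2_tendsto (PM a b) (\<lambda>j (s, w). simple_proc (l j) (\<sigma> j) (\<zeta> j) s w) (\<lambda>(s, w). \<psi> s w)"
    "L2_tendsto M (\<lambda>j. simple_ito W (l j) (\<sigma> j) (\<zeta> j)) J"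
    by (rule has_ito_integralE[OF J a]) (rule that)
  show ?thesis
    using L2_tendsto_integral_mult[OF 1(2) 2(2)] L2_tendsto_integral_mult[OF 1(3) 2(3)]
    unfolding simple_isometry[OF 1(1) 2(1) a] case_prod_unfold by (rule LIMSEQ_unique[rotated])
qed

text \<open>The constant sequence approximates. This makes the isometry applicable to the difference
  between an integral and one of its approximants.\<close>

lemma has_ito_integral_simple:
  fixes \<xi> :: "nat \<Rightarrow> 'w \<Rightarrow> real"
  assumes sd: "simple_data M F a b k \<tau> \<xi>" and a: "0 \<le> a"
  shows "has_ito_integral M F W a b (simple_proc k \<tau> \<xi>) (simple_ito W k \<tau> \<xi>)"
  unfolding has_ito_integral_def
proof (intro conjI exI)
  show "\<forall>j::nat. simple_data M F a b k \<tau> \<xi>" using sd by simp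
  show "simple_ito W k \<tau> \<xi> \<in> borel_measurable M"
    using simple_ito_sq_int[OF sd a] by (rule sq_int_measurable)
  show "(\<lambda>(s, w). simple_proc k \<tau> \<xi> s w) \<in> borel_measurable (PM a b)"
    using simple_proc_sq_int[OF sd a] by (rule sq_int_measurable)
qed (simp_all add: case_prod_unfold)

text \<open>Expanding the square reduces the claim to three instances of the product form, so an
  integral of the difference of the integrands is never formed.\<close>

lemma ito_isometry_diff:
  fixes \<phi> \<psi> :: "real \<Rightarrow> 'w \<Rightarrow> real"
  assumes I: "has_ito_integral M F W a b \<phi> I" and J: "has_ito_integral M F W a b \<psi> J" and a: "0 \<le> a"
  shows "expectation (\<lambda>w. (I w - J w)\<^sup>2) =
    (\<integral>x. (\<phi> (fst x) (snd x) - \<psi> (fst x) (snd x))\<^sup>2 \<partial>PM a b)"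
proof -
  note si = has_ito_integral_sq_int[OF I a] and sj = has_ito_integral_sq_int[OF J a]
  have e: "(x - y)\<^sup>2 = x * x - 2 * (x * y) + y * y" for x y :: real
    by (simp add: power2_eq_square algebra_simps)
  show ?thesis
    unfolding e using si sj ito_isometry[OF I I a] ito_isometry[OF I J a] ito_isometry[OF J J a]
    by (simp add: sq_int_integrable_mult)
qed

lemma ito_zero_length:
  fixes \<phi> :: "real \<Rightarrow> 'w \<Rightarrow> real"
  assumes I: "has_ito_integral M F W a a \<phi> I" and a: "0 \<le> a"
  shows "AE w in M. I w = 0"
proof -
  interpret Q: pair_sigma_finite "lebesgue_on {a..a}" M by (rule PM_pair)
  have n: "emeasure (lebesgue_on {a..a}) {a..a} = 0"
    by (simp add: emeasure_restrict_space)
  have i: "integrable (PM a a) (\<lambda>x. \<phi> (fst x) (snd x) * \<phi> (fst x) (snd x))"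
    using has_ito_integral_sq_int(2)[OF I a] by (intro sq_int_integrable_mult)
  have "AE x in lebesgue_on {a..a}. False"
    using n by (intro AE_I[of _ _ "{a..a}"]) auto
  then have ae: "AE s in lebesgue_on {a..a}. (\<integral>w. \<phi> s w * \<phi> s w \<partial>M) = 0"
    by (rule eventually_mono) simp
  have "(\<integral>x. \<phi> (fst x) (snd x) * \<phi> (fst x) (snd x) \<partial>PM a a) =
      (\<integral>s. (\<integral>w. \<phi> s w * \<phi> s w \<partial>M) \<partial>lebesgue_on {a..a})"
    using Q.integral_fst'[OF i] by simp
  also have "\<dots> = 0"
    by (rule integral_eq_zero_AE[OF ae])
  finally have "expectation (\<lambda>w. I w * I w) = 0" using ito_isometry[OF I I a] by simp
  moreover have "integrable M (\<lambda>w. I w * I w)"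
    using has_ito_integral_sq_int(1)[OF I a] by (intro sq_int_integrable_mult)
  ultimately have "AE w in M. I w * I w = 0"
    by (subst (asm) integral_nonneg_eq_0_iff_AE) auto
  then show ?thesis by auto
qed

end

section \<open>Shorter time intervals and the martingale property\<close>

lemma id_measurable_lebesgue_on_subset:
  "S \<subseteq> T \<Longrightarrow> (\<lambda>x. x) \<in> lebesgue_on S \<rightarrow>\<^sub>M lebesgue_on T"
  by (rule measurable_restrict_space2) (auto intro: measurable_restrict_space1)

lemma id_measurable_pair_lebesgue_on_subset:
  assumes "S \<subseteq> T"
  shows "(\<lambda>x. x) \<in> lebesgue_on S \<Otimes>\<^sub>M M \<rightarrow>\<^sub>M lebesgue_on T \<Otimes>\<^sub>M M"
proof -
  have "(\<lambda>x. fst x) \<in> lebesgue_on S \<Otimes>\<^sub>M M \<rightarrow>\<^sub>M lebesgue_on T"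
    using measurable_compose[OF measurable_fst id_measurable_lebesgue_on_subset[OF assms]] .
  from measurable_Pair[OF this measurable_snd] show ?thesis by simp
qed

lemma measurable_pair_lebesgue_on_subset:
  assumes "f \<in> lebesgue_on T \<Otimes>\<^sub>M M \<rightarrow>\<^sub>M K" "S \<subseteq> T"
  shows "f \<in> lebesgue_on S \<Otimes>\<^sub>M M \<rightarrow>\<^sub>M K"
  using measurable_compose[OF id_measurable_pair_lebesgue_on_subset[OF assms(2)] assms(1)] by simp

context adapted_bm
begin

text \<open>Measures on products over different intervals are compared through the iterated
  integral: the inner expectation is common to both, and the outer integral is a Lebesgue integral
  against an indicator.\<close>

lemma nn_integral_PM_mono_interval:
  assumes f: "f \<in> borel_measurable (PM a b)" and S: "{c..d} \<subseteq> {a..b}"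
  shows "(\<integral>\<^sup>+x. f x \<partial>PM c d) \<le> (\<integral>\<^sup>+x. f x \<partial>PM a b)"
proof -
  have f': "f \<in> borel_measurable (PM c d)"
    by (rule measurable_pair_lebesgue_on_subset[OF f S])
  have "(\<integral>\<^sup>+x. f x \<partial>PM c d) = (\<integral>\<^sup>+s. (\<integral>\<^sup>+w. f (s, w) \<partial>M) \<partial>lebesgue_on {c..d})"
    by (rule nn_integral_fst[OF f', symmetric])
  also have "\<dots> = (\<integral>\<^sup>+s. (\<integral>\<^sup>+w. f (s, w) \<partial>M) * indicator {c..d} s \<partial>lebesgue)"
    by (rule nn_integral_restrict_space) simp
  also have "\<dots> \<le> (\<integral>\<^sup>+s. (\<integral>\<^sup>+w. f (s, w) \<partial>M) * indicator {a..b} s \<partial>lebesgue)"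
    by (intro nn_integral_mono mult_left_mono) (use S in \<open>auto simp: indicator_def\<close>)
  also have "\<dots> = (\<integral>\<^sup>+s. (\<integral>\<^sup>+w. f (s, w) \<partial>M) \<partial>lebesgue_on {a..b})"
    by (rule nn_integral_restrict_space[symmetric]) simp
  also have "\<dots> = (\<integral>\<^sup>+x. f x \<partial>PM a b)"
    by (rule nn_integral_fst[OF f])
  finally show ?thesis .
qed

lemma sq_int_PM_subset:
  assumes "sq_int (PM a b) f" "{c..d} \<subseteq> {a..b}"
  shows "sq_int (PM c d) f"
proof -
  have [measurable]: "f \<in> borel_measurable (PM a b)" using assms(1) by (rule sq_int_measurable)
  have "(\<integral>\<^sup>+x. ennreal ((f x)\<^sup>2) \<partial>PM c d) \<le> (\<integral>\<^sup>+x. ennreal ((f x)\<^sup>2) \<partial>PM a b)"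
    by (rule nn_integral_PM_mono_interval[OF _ assms(2)]) measurable
  also have "\<dots> < \<infinity>" using assms(1) by (simp add: sq_int_iff_nn_integral)
  finally show ?thesis
    using measurable_pair_lebesgue_on_subset[of f "{a..b}" M borel "{c..d}"] assms(2)
    by (simp add: sq_int_iff_nn_integral)
qed

lemma integral_sq_PM_mono_interval:
  assumes "sq_int (PM a b) f" "{c..d} \<subseteq> {a..b}"
  shows "(\<integral>x. (f x)\<^sup>2 \<partial>PM c d) \<le> (\<integral>x. (f x)\<^sup>2 \<partial>PM a b)"
proof -
  have [measurable]: "f \<in> borel_measurable (PM a b)" using assms(1) by (rule sq_int_measurable)
  have "ennreal (\<integral>x. (f x)\<^sup>2 \<partial>PM c d) = (\<integral>\<^sup>+x. ennreal ((f x)\<^sup>2) \<partial>PM c d)"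
    using sq_int_PM_subset[OF assms] by (simp add: nn_integral_eq_integral sq_int_def)
  also have "\<dots> \<le> (\<integral>\<^sup>+x. ennreal ((f x)\<^sup>2) \<partial>PM a b)"
    by (rule nn_integral_PM_mono_interval[OF _ assms(2)]) measurable
  also have "\<dots> = ennreal (\<integral>x. (f x)\<^sup>2 \<partial>PM a b)"
    using assms(1) by (simp add: nn_integral_eq_integral sq_int_def)
  finally show ?thesis by (subst (asm) ennreal_le_iff) auto
qed

text \<open>The partition is stopped at c. A coefficient with \<tau> i \<ge> c is replaced by 0,
  because its interval now starts at c while the coefficient need not be
  \<open>F c\<close>-measurable; up to time c the process is unaffected, since the original interval
  contained only times after c.\<close>

lemma simple_data_restrict:
  fixes \<xi> :: "nat \<Rightarrow> 'w \<Rightarrow> real"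
  assumes sd: "simple_data M F a b k \<tau> \<xi>" and c: "a \<le> c"
  defines "\<tau>' \<equiv> \<lambda>i. min (\<tau> i) c" and "\<xi>' \<equiv> \<lambda>i. if \<tau> i < c then \<xi> i else (\<lambda>_. 0)"
  shows "simple_data M F a c k \<tau>' \<xi>'"
    and "s \<le> c \<Longrightarrow> simple_proc k \<tau>' \<xi>' s w = simple_proc k \<tau> \<xi> s w"
proof -
  show "simple_data M F a c k \<tau>' \<xi>'"
    using sd c unfolding simple_data_def \<tau>'_def \<xi>'_def
    by (auto simp: min_def intro!: exI[of _ 0])
  show "simple_proc k \<tau>' \<xi>' s w = simple_proc k \<tau> \<xi> s w" if "s \<le> c"
    unfolding simple_proc_def using that
    by (intro sum.cong refl) (auto simp: \<tau>'_def \<xi>'_def indicator_def)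
qed

text \<open>Summands over intervals up to c are unchanged, those that start after c vanish by
  independence of the increment, and a summand that straddles c is cut there, its later part
  vanishing for the same reason.\<close>

lemma simple_ito_martingale:
  fixes \<xi> :: "nat \<Rightarrow> 'w \<Rightarrow> real"
  assumes sd: "simple_data M F a b k \<tau> \<xi>" and c: "0 \<le> a" "a \<le> c"
    and Z: "Z \<in> borel_measurable (F c)" "sq_int M Z"
  defines "\<tau>' \<equiv> \<lambda>i. min (\<tau> i) c" and "\<xi>' \<equiv> \<lambda>i. if \<tau> i < c then \<xi> i else (\<lambda>_. 0)"
  shows "expectation (\<lambda>w. Z w * simple_ito W k \<tau> \<xi> w) = expectation (\<lambda>w. Z w * simple_ito W k \<tau>' \<xi>' w)"
proof -
  have c0: "0 \<le> c" using c by simp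
  note sd' = simple_data_restrict(1)[OF sd c(2), folded \<tau>'_def \<xi>'_def]
  have int: "integrable M (\<lambda>w. Z w * (\<zeta> i w * (W (\<sigma> (Suc i)) w - W (\<sigma> i) w)))"
    if "simple_data M F a b' k \<sigma> \<zeta>" "i < k" for i b' \<sigma> and \<zeta> :: "nat \<Rightarrow> 'w \<Rightarrow> real"
  proof -
    note D = simple_dataD[OF that(1) c(1) that(2)]
    from D(7) obtain K where "\<And>w. w \<in> space M \<Longrightarrow> \<bar>\<zeta> i w\<bar> \<le> K" by blast
    then show ?thesis
      by (intro sq_int_integrable_mult[OF Z(2)] weighted_increment_sq_int[OF D(2,3,6)])
  qed
  have one: "expectation (\<lambda>w. Z w * (\<xi> i w * (W (\<tau> (Suc i)) w - W (\<tau> i) w))) =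
     expectation (\<lambda>w. Z w * (\<xi>' i w * (W (\<tau>' (Suc i)) w - W (\<tau>' i) w)))" if i: "i < k" for i
  proof -
    note D = simple_dataD[OF sd c(1) i]
    from D(7) obtain K where K: "\<And>w. w \<in> space M \<Longrightarrow> \<bar>\<xi> i w\<bar> \<le> K" by blast
    have iZ: "integrable M (\<lambda>w. Z w * \<xi> i w)"
      by (intro sq_int_integrable_mult Z sq_int_bounded[OF D(6) K])
    consider "\<tau> (Suc i) \<le> c" | "\<tau> i < c" "c < \<tau> (Suc i)" | "c \<le> \<tau> i" using D(3) by linarith
    then show ?thesis
    proof cases
      case 1
      show ?thesis
      \<comment> \<open>Stopping leaves such a summand alone, except when both ends equal c: then
        the coefficient was replaced by 0, which is harmless because the increment is 0 as
        well.\<close>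
      proof (cases "\<tau> i < c")
        case False
        then have "\<tau> (Suc i) = \<tau> i" using 1 D(3) by simp
        with False show ?thesis by (simp add: \<xi>'_def)
      qed (use 1 in \<open>simp add: \<tau>'_def \<xi>'_def\<close>)
    next
      case 2
      have "(\<lambda>w. Z w * \<xi> i w) \<in> borel_measurable (F c)"
        using Z(1) adapted_mono[OF D(2) _ D(5), of c] 2 by simp
      from increment_orthogonal[OF c0 less_imp_le[OF 2(2)] this iZ]
      have z: "integrable M (\<lambda>w. Z w * (\<xi> i w * (W (\<tau> (Suc i)) w - W c w)))"
        "expectation (\<lambda>w. Z w * (\<xi> i w * (W (\<tau> (Suc i)) w - W c w))) = 0" by (simp_all add: mult.assoc)
      have i': "integrable M (\<lambda>w. Z w * (\<xi> i w * (W c w - W (\<tau> i) w)))"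
        using int[OF sd' i] 2 by (simp add: \<tau>'_def \<xi>'_def)
      have "Z w * (\<xi> i w * (W (\<tau> (Suc i)) w - W (\<tau> i) w)) = Z w * (\<xi> i w * (W (\<tau> (Suc i)) w - W c w))
         + Z w * (\<xi> i w * (W c w - W (\<tau> i) w))" for w by (simp add: algebra_simps)
      then show ?thesis using z i' 2 by (simp add: \<tau>'_def \<xi>'_def)
    next
      case 3
      have "(\<lambda>w. Z w * \<xi> i w) \<in> borel_measurable (F (\<tau> i))"
        using D(5) adapted_mono[OF c0 3 Z(1)] by simp
      from increment_orthogonal(2)[OF D(2,3) this iZ] 3 show ?thesis
        by (simp add: \<xi>'_def mult.assoc)
    qed
  qed
  have eq: "expectation (\<lambda>w. Z w * simple_ito W k \<sigma> \<zeta> w) =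
     (\<Sum>i<k. expectation (\<lambda>w. Z w * (\<zeta> i w * (W (\<sigma> (Suc i)) w - W (\<sigma> i) w))))"
    if "simple_data M F a b' k \<sigma> \<zeta>" for b' \<sigma> and \<zeta> :: "nat \<Rightarrow> 'w \<Rightarrow> real"
  proof -
    have "expectation (\<lambda>w. Z w * simple_ito W k \<sigma> \<zeta> w) =
      expectation (\<lambda>w. \<Sum>i<k. Z w * (\<zeta> i w * (W (\<sigma> (Suc i)) w - W (\<sigma> i) w)))"
      by (simp add: simple_ito_def sum_distrib_left mult.commute[of "W _ _ - W _ _"])
    also have "\<dots> = (\<Sum>i<k. expectation (\<lambda>w. Z w * (\<zeta> i w * (W (\<sigma> (Suc i)) w - W (\<sigma> i) w))))"
      by (rule Bochner_Integration.integral_sum) (use int[OF that] in simp)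
    finally show ?thesis .
  qed
  show ?thesis unfolding eq[OF sd] eq[OF sd'] using one by (intro sum.cong) auto
qed

text \<open>\<open>I\<close> and \<open>I'\<close> are versions that are only known to be measurable
  on \<open>M\<close>, so the martingale property is stated weakly, by pairing with a
  square-integrable Z known at time c. The stopped approximants converge to the given
  \<open>I'\<close> because the isometry on [a,c] bounds their distance by the approximation error
  on [a,b].\<close>

lemma ito_martingale:
  fixes \<phi> :: "real \<Rightarrow> 'w \<Rightarrow> real"
  assumes I: "has_ito_integral M F W a b \<phi> I" and I': "has_ito_integral M F W a c \<phi> I'"
    and c: "0 \<le> a" "a \<le> c" "c \<le> b"
    and Z: "Z \<in> borel_measurable (F c)" "sq_int M Z"
  shows "expectation (\<lambda>w. Z w * I w) = expectation (\<lambda>w. Z w * I' w)"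
proof -
  obtain k \<tau> \<xi> where sd: "\<And>j. simple_data M F a b (k j) (\<tau> j) (\<xi> j)" and
    1: "L2_tendsto (PM a b) (\<lambda>j (s, w). simple_proc (k j) (\<tau> j) (\<xi> j) s w) (\<lambda>(s, w). \<phi> s w)" and
    2: "L2_tendsto M (\<lambda>j. simple_ito W (k j) (\<tau> j) (\<xi> j)) I"
    by (rule has_ito_integralE[OF I c(1)]) (rule that)
  define \<tau>' where "\<tau>' j i = min (\<tau> j i) c" for j i
  define \<xi>' where "\<xi>' j i = (if \<tau> j i < c then \<xi> j i else (\<lambda>_. 0))" for j i
  have eqs: "\<tau>' j = (\<lambda>i. min (\<tau> j i) c)" "\<xi>' j = (\<lambda>i. if \<tau> j i < c then \<xi> j i else (\<lambda>_. 0))" for j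
    by (simp_all add: \<tau>'_def[abs_def] \<xi>'_def[abs_def])
  have sd': "simple_data M F a c (k j) (\<tau>' j) (\<xi>' j)" for j
    unfolding eqs by (rule simple_data_restrict(1)[OF sd c(2)])
  have S: "{a..c} \<subseteq> {a..b}" using c by auto
  let ?d = "\<lambda>j x. \<phi> (fst x) (snd x) - simple_proc (k j) (\<tau> j) (\<xi> j) (fst x) (snd x)"
  have sq: "sq_int (PM a b) (?d j)" for j
    using 1 by (auto simp: L2_tendsto_def case_prod_unfold intro: sq_int_diff)
  have "L2_tendsto M (\<lambda>j. simple_ito W (k j) (\<tau>' j) (\<xi>' j)) I'"
    unfolding L2_tendsto_def
  proof (intro conjI allI)
    show "sq_int M I'" by (rule has_ito_integral_sq_int(1)[OF I' c(1)])
    show "sq_int M (simple_ito W (k j) (\<tau>' j) (\<xi>' j))" for j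
      by (rule simple_ito_sq_int[OF sd' c(1)])
    show "(\<lambda>j. expectation (\<lambda>x. (I' x - simple_ito W (k j) (\<tau>' j) (\<xi>' j) x)\<^sup>2)) \<longlonglongrightarrow> 0"
    proof (rule tendsto_sandwich[where f = "\<lambda>_. 0" and h = "\<lambda>j. \<integral>x. (?d j x)\<^sup>2 \<partial>PM a b"])
      show "(\<lambda>j. \<integral>x. (?d j x)\<^sup>2 \<partial>PM a b) \<longlonglongrightarrow> 0"
        using 1 by (simp add: L2_tendsto_def case_prod_unfold)
      have "expectation (\<lambda>x. (I' x - simple_ito W (k j) (\<tau>' j) (\<xi>' j) x)\<^sup>2) \<le> (\<integral>x. (?d j x)\<^sup>2 \<partial>PM a b)" for j
      proof -
        have "expectation (\<lambda>x. (I' x - simple_ito W (k j) (\<tau>' j) (\<xi>' j) x)\<^sup>2) =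
          (\<integral>x. (\<phi> (fst x) (snd x) - simple_proc (k j) (\<tau>' j) (\<xi>' j) (fst x) (snd x))\<^sup>2 \<partial>PM a c)"
          by (rule ito_isometry_diff[OF I' has_ito_integral_simple[OF sd' c(1)] c(1)])
        also have "\<dots> = (\<integral>x. (?d j x)\<^sup>2 \<partial>PM a c)"
          using simple_data_restrict(2)[OF sd c(2)]
          by (intro Bochner_Integration.integral_cong refl) (auto simp: eqs space_pair_measure)
        also have "\<dots> \<le> (\<integral>x. (?d j x)\<^sup>2 \<partial>PM a b)"
          by (rule integral_sq_PM_mono_interval[OF sq S])
        finally show ?thesis .
      qed
      then show "\<forall>\<^sub>F j in sequentially. expectation (\<lambda>x. (I' x - simple_ito W (k j) (\<tau>' j) (\<xi>' j) x)\<^sup>2)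
         \<le> (\<integral>x. (?d j x)\<^sup>2 \<partial>PM a b)" by simp
    qed simp_all
  qed
  from L2_tendsto_integral_mult_left[OF Z(2) this]
  have "(\<lambda>j. expectation (\<lambda>w. Z w * simple_ito W (k j) (\<tau> j) (\<xi> j) w)) \<longlonglongrightarrow> expectation (\<lambda>w. Z w * I' w)"
    unfolding eqs simple_ito_martingale[OF sd c(1,2) Z, symmetric] .
  with L2_tendsto_integral_mult_left[OF Z(2) 2] show ?thesis by (rule LIMSEQ_unique)
qed

text \<open>The martingale property at the starting time, where the integral is over a null set. The
  version over [a,a] is a hypothesis because existence of integrals is not part of the argument; an
  Ito process supplies one.\<close>

lemma ito_mean_zero:
  fixes \<phi> :: "real \<Rightarrow> 'w \<Rightarrow> real"
  assumes I: "has_ito_integral M F W a b \<phi> I" and I': "has_ito_integral M F W a a \<phi> I'"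
    and a: "0 \<le> a" "a \<le> b" and Z: "Z \<in> borel_measurable (F a)" "sq_int M Z"
  shows "expectation (\<lambda>w. Z w * I w) = 0"
proof -
  have "AE w in M. Z w * I' w = 0" using ito_zero_length[OF I' a(1)] by eventually_elim simp
  then show ?thesis
    unfolding ito_martingale[OF I I' a(1) order.refl a(2) Z] by (rule integral_eq_zero_AE)
qed

text \<open>Taking a component and multiplying by the indicator of a set in \<open>F a\<close> are
  both linear contractions that depend on w only through \<open>F a\<close>. Linearity moves such a
  map through the finite sums, the contraction bound preserves both L2 limits, and measurability at
  the starting time keeps the coefficients adapted.\<close>

lemma has_ito_integral_map:
  fixes \<phi> :: "real \<Rightarrow> 'w \<Rightarrow> 'a::euclidean_space" and h :: "'w \<Rightarrow> 'a \<Rightarrow> real"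
  assumes I: "has_ito_integral M F W a b \<phi> I" and a: "0 \<le> a"
    and lin: "\<And>w. linear (h w)" and bound: "\<And>w x. \<bar>h w x\<bar> \<le> norm x"
    and h: "(\<lambda>(w, x). h w x) \<in> borel_measurable (F a \<Otimes>\<^sub>M borel)"
  shows "has_ito_integral M F W a b (\<lambda>s w. h w (\<phi> s w)) (\<lambda>w. h w (I w))"
proof -
  from I obtain k \<tau> \<xi> where sd: "\<And>j::nat. simple_data M F a b (k j) (\<tau> j) (\<xi> j)" and
    1: "(\<lambda>j. \<integral>\<^sup>+ (s, w). ennreal ((norm (\<phi> s w - simple_proc (k j) (\<tau> j) (\<xi> j) s w))\<^sup>2)
               \<partial>PM a b) \<longlonglongrightarrow> 0" and
    2: "(\<lambda>j. \<integral>\<^sup>+ w. ennreal ((norm (I w - simple_ito W (k j) (\<tau> j) (\<xi> j) w))\<^sup>2) \<partial>M) \<longlonglongrightarrow> 0"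
    and m: "(\<lambda>(s, w). \<phi> s w) \<in> borel_measurable (PM a b)" "I \<in> borel_measurable M"
    unfolding has_ito_integral_def by blast
  let ?\<xi> = "\<lambda>j l w. h w (\<xi> j l w)"
  have p: "simple_proc (k j) (\<tau> j) (?\<xi> j) s w = h w (simple_proc (k j) (\<tau> j) (\<xi> j) s w)" for j s w
    by (simp add: simple_proc_def linear_sum[OF lin] linear_scale[OF lin] del: sum_mult_indicator)
  have q: "simple_ito W (k j) (\<tau> j) (?\<xi> j) w = h w (simple_ito W (k j) (\<tau> j) (\<xi> j) w)" for j w
    by (simp add: simple_ito_def linear_sum[OF lin] linear_scale[OF lin])
  have le: "ennreal ((norm (h w x - h w y))\<^sup>2) \<le> ennreal ((norm (x - y))\<^sup>2)" for x y w
    using bound[of w "x - y"] by (intro ennreal_leI power_mono) (simp_all add: linear_diff[OF lin])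
  have id: "(\<lambda>x. x) \<in> N \<rightarrow>\<^sub>M F a" if "subalgebra N (F a)" for N
    by (rule measurable_from_subalg[OF that]) simp
  have hF: "(\<lambda>w. h w (f w)) \<in> borel_measurable N"
    if "subalgebra N (F a)" "f \<in> borel_measurable N" for N f
    using measurable_compose[OF measurable_Pair[OF id[OF that(1)] that(2)] h] by simp
  show ?thesis
    unfolding has_ito_integral_def
  proof (intro conjI exI allI)
    show "(\<lambda>(s, w). h w (\<phi> s w)) \<in> borel_measurable (PM a b)"
      using measurable_compose[OF measurable_Pair[OF measurable_compose[OF measurable_snd id[OF subalg[OF a]]] m(1)] h]
      by (simp add: case_prod_unfold)
    show "(\<lambda>w. h w (I w)) \<in> borel_measurable M" by (rule hF[OF subalg[OF a] m(2)])
    show "simple_data M F a b (k j) (\<tau> j) (?\<xi> j)" for j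
    proof -
      have "\<exists>K. \<forall>w\<in>space M. norm (f w) \<le> K \<Longrightarrow> \<exists>K. \<forall>w\<in>space M. norm (h w (f w)) \<le> K" for f
        using bound order_trans unfolding real_norm_def by blast
      then show ?thesis using sd[of j] hF filtration_mono[OF a] less_imp_le unfolding simple_data_def by meson
    qed
    show "(\<lambda>j. \<integral>\<^sup>+ (s, w). ennreal ((norm (h w (\<phi> s w) - simple_proc (k j) (\<tau> j) (?\<xi> j) s w))\<^sup>2)
               \<partial>PM a b) \<longlonglongrightarrow> 0"
      unfolding p
      by (rule tendsto_sandwich[OF _ _ tendsto_const 1];
          intro always_eventually allI zero_le nn_integral_mono; simp only: case_prod_unfold le)
    show "(\<lambda>j. \<integral>\<^sup>+ w. ennreal ((norm (h w (I w) - simple_ito W (k j) (\<tau> j) (?\<xi> j) w))\<^sup>2) \<partial>M) \<longlonglongrightarrow> 0"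
      unfolding q
      by (rule tendsto_sandwich[OF _ _ tendsto_const 2];
          intro always_eventually allI zero_le nn_integral_mono; simp only: case_prod_unfold le)
  qed
qed

lemma has_ito_integral_mult_indicator:
  fixes \<phi> :: "real \<Rightarrow> 'w \<Rightarrow> real"
  assumes "has_ito_integral M F W a b \<phi> I" "0 \<le> a" and [measurable]: "A \<in> sets (F a)"
  shows "has_ito_integral M F W a b (\<lambda>s w. indicator A w * \<phi> s w) (\<lambda>w. indicator A w * I w)"
proof (rule has_ito_integral_map[OF assms(1,2)])
  show "linear (\<lambda>x. indicator A w * x :: real)" for w by (rule linearI) (simp_all add: distrib_left)
  show "\<bar>indicator A w * x\<bar> \<le> norm x" for w and x :: real by (simp add: indicator_def)
qed measurable

lemma has_ito_integral_component:
  fixes \<phi> :: "real \<Rightarrow> 'w \<Rightarrow> real^'d"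
  assumes "has_ito_integral M F W a b \<phi> I" "0 \<le> a"
  shows "has_ito_integral M F W a b (\<lambda>s w. \<phi> s w $ i) (\<lambda>w. I w $ i)"
proof (rule has_ito_integral_map[OF assms])
  show "linear (\<lambda>x::real^'d. x $ i)" by (rule linearI) simp_all
  have "(\<lambda>z. snd z $ i) \<in> borel_measurable (F a \<Otimes>\<^sub>M (borel :: (real^'d) measure))"
    by (rule borel_measurable_continuous_on[OF _ measurable_snd]) (intro continuous_intros)
  then show "(\<lambda>(w, x::real^'d). x $ i) \<in> borel_measurable (F a \<Otimes>\<^sub>M borel)"
    by (simp add: case_prod_unfold)
qed (rule component_le_norm_cart)

end

section \<open>The product rule\<close>

lemma id_borel_measurable_lebesgue_on [measurable]:
  "(\<lambda>x::real. x) \<in> borel_measurable (lebesgue_on S)"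
  by (rule borel_measurable_lebesgue_onI) simp

text \<open>Moves the variable upper limit into the integrand, so that all partial integrals live on
  one measure space, as Fubini and joint measurability require.\<close>

lemma integral_lebesgue_on_initial:
  fixes g :: "real \<Rightarrow> real"
  assumes "s \<le> b"
  shows "integral\<^sup>L (lebesgue_on {a..s}) g = (\<integral>v. indicator {..s} v * g v \<partial>lebesgue_on {a..b})"
proof -
  have "integral\<^sup>L (lebesgue_on {a..s}) g = (\<integral>v. indicator {a..s} v *\<^sub>R g v \<partial>lebesgue)"
    by (rule integral_restrict_space) simp
  also have "\<dots> = (\<integral>v. indicator {a..b} v *\<^sub>R (indicator {..s} v * g v) \<partial>lebesgue)"
    using assms by (intro Bochner_Integration.integral_cong) (auto simp: indicator_def)
  also have "\<dots> = (\<integral>v. indicator {..s} v * g v \<partial>lebesgue_on {a..b})"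
    by (rule integral_restrict_space[symmetric]) simp
  finally show ?thesis .
qed

text \<open>Integration by parts for primitives of merely integrable functions: the product of f x
  and g y is integrated over the square, which is cut along the diagonal into y \<le> x and x < y,
  and Fubini evaluates each half.\<close>

lemma product_rule_integral:
  fixes f g :: "real \<Rightarrow> real"
  assumes f: "integrable (lebesgue_on {a..b}) f" and g: "integrable (lebesgue_on {a..b}) g"
  defines "F \<equiv> \<lambda>s. integral\<^sup>L (lebesgue_on {a..s}) f" and "G \<equiv> \<lambda>s. integral\<^sup>L (lebesgue_on {a..s}) g"
  shows "integrable (lebesgue_on {a..b}) (\<lambda>s. f s * G s)" (is ?A)
    and "integrable (lebesgue_on {a..b}) (\<lambda>s. F s * g s)" (is ?B)
    and "F b * G b = (\<integral>s. f s * G s \<partial>lebesgue_on {a..b}) + (\<integral>s. F s * g s \<partial>lebesgue_on {a..b})" (is ?C)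
proof -
  let ?N = "lebesgue_on {a..b}"
  interpret N: finite_measure ?N by (rule finite_measure_lebesgue_on_Icc)
  interpret NN: pair_sigma_finite ?N ?N ..
  have [measurable]: "f \<in> borel_measurable ?N" "g \<in> borel_measurable ?N" using f g by auto
  have fg: "integrable (?N \<Otimes>\<^sub>M ?N) (\<lambda>(x, y). f x * g y)"
    by (rule NN.integral_pair_mult(1)[OF f g])
  let ?u = "\<lambda>x y. f x * (indicator {..x} y * g y)" and ?l = "\<lambda>x y. (indicator {..<y} x * f x) * g y"
  have ulm: "(\<lambda>(x, y). ?u x y) \<in> borel_measurable (?N \<Otimes>\<^sub>M ?N)" "(\<lambda>(x, y). ?l x y) \<in> borel_measurable (?N \<Otimes>\<^sub>M ?N)"
    unfolding indicator_def of_bool_def by simp_all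
  have u: "integrable (?N \<Otimes>\<^sub>M ?N) (\<lambda>(x, y). ?u x y)"
    by (rule Bochner_Integration.integrable_bound[OF fg ulm(1)]) (auto simp: indicator_def)
  have l: "integrable (?N \<Otimes>\<^sub>M ?N) (\<lambda>(x, y). ?l x y)"
    by (rule Bochner_Integration.integrable_bound[OF fg ulm(2)]) (auto simp: indicator_def)
  have Geq: "(\<integral>y. ?u x y \<partial>?N) = f x * G x" if "x \<in> space ?N" for x
    using that unfolding G_def by (subst integral_lebesgue_on_initial[of x b]) auto
  have Feq: "(\<integral>x. ?l x y \<partial>?N) = F y * g y" if y: "y \<in> space ?N" for y
  proof -
    \<comment> \<open>The half x < y leaves out the diagonal, whereas F y integrates up to and
      including y; a single point is negligible.\<close>
    have null: "{y} \<in> null_sets ?N" using y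
      by (simp add: null_sets_restrict_space)
    have "AE x in ?N. x \<notin> {y}" by (rule AE_not_in[OF null])
    then have "(\<integral>x. indicator {..<y} x * f x \<partial>?N) = (\<integral>x. indicator {..y} x * f x \<partial>?N)"
      by (intro integral_cong_AE) (auto simp: indicator_def of_bool_def)
    also have "\<dots> = F y" unfolding F_def using y by (subst integral_lebesgue_on_initial[of y b]) auto
    finally show ?thesis by simp
  qed
  have "integrable ?N (\<lambda>x. \<integral>y. ?u x y \<partial>?N) = ?A"
    by (rule Bochner_Integration.integrable_cong[OF refl]) (rule Geq)
  then show ?A using NN.integrable_fst'[OF u] by simp
  have "integrable ?N (\<lambda>y. \<integral>x. ?l x y \<partial>?N) = ?B"
    by (rule Bochner_Integration.integrable_cong[OF refl]) (rule Feq)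
  then show ?B using NN.integrable_snd[OF l] by simp
  have "F b * G b = (\<integral>(x, y). f x * g y \<partial>(?N \<Otimes>\<^sub>M ?N))"
    unfolding NN.integral_pair_mult(2)[OF f g] F_def G_def ..
  also have "\<dots> = (\<integral>z. (case z of (x, y) \<Rightarrow> ?u x y) + (case z of (x, y) \<Rightarrow> ?l x y) \<partial>(?N \<Otimes>\<^sub>M ?N))"
    by (intro Bochner_Integration.integral_cong refl) (auto simp: indicator_def)
  also have "\<dots> = (\<integral>(x, y). ?u x y \<partial>(?N \<Otimes>\<^sub>M ?N)) + (\<integral>(x, y). ?l x y \<partial>(?N \<Otimes>\<^sub>M ?N))"
    by (rule Bochner_Integration.integral_add[OF u l])
  also have "(\<integral>(x, y). ?u x y \<partial>(?N \<Otimes>\<^sub>M ?N)) = (\<integral>s. f s * G s \<partial>?N)"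
    unfolding NN.integral_fst'[OF u, symmetric] using Geq
    by (intro Bochner_Integration.integral_cong refl) auto
  also have "(\<integral>(x, y). ?l x y \<partial>(?N \<Otimes>\<^sub>M ?N)) = (\<integral>s. F s * g s \<partial>?N)"
    unfolding NN.integral_snd[OF l, symmetric] using Feq
    by (intro Bochner_Integration.integral_cong refl) auto
  finally show ?C .
qed

section \<open>Time integrals of square-integrable processes\<close>

context adapted_bm
begin

lemma sq_int_PM_snd:
  assumes "sq_int M \<eta>"
  shows "sq_int (PM a b) (\<lambda>x. \<eta> (snd x))"
proof -
  interpret Q: pair_sigma_finite "lebesgue_on {a..b}" M by (rule PM_pair)
  interpret L: finite_measure "lebesgue_on {a..b}" by (rule finite_measure_lebesgue_on_Icc)
  have "integrable (PM a b) (\<lambda>(s, w). 1 * (\<eta> w)\<^sup>2)"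
    by (rule Q.integral_pair_mult(1)) (use assms in \<open>auto simp: sq_int_def\<close>)
  then show ?thesis
    using measurable_compose[OF measurable_snd sq_int_measurable[OF assms]]
    by (simp add: sq_int_def case_prod_unfold)
qed

lemma sq_int_PM_AE_time:
  assumes "sq_int (PM a b) (\<lambda>x. f (fst x) (snd x))"
  shows "AE s in lebesgue_on {a..b}. sq_int M (f s)"
proof -
  interpret Q: pair_sigma_finite "lebesgue_on {a..b}" M by (rule PM_pair)
  have m: "(\<lambda>x. f (fst x) (snd x)) \<in> borel_measurable (PM a b)"
    and i: "integrable (PM a b) (\<lambda>x. (f (fst x) (snd x))\<^sup>2)" using assms by (auto simp: sq_int_def)
  have "AE s in lebesgue_on {a..b}. integrable M (\<lambda>w. (f s w)\<^sup>2)"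
    using Q.AE_integrable_fst'[OF i] by simp
  moreover have "AE s in lebesgue_on {a..b}. f s \<in> borel_measurable M"
    using measurable_compose[OF measurable_Pair1' m] by (intro AE_I2) simp
  ultimately show ?thesis by eventually_elim (simp add: sq_int_def)
qed

lemma sq_int_PM_AE_path:
  assumes "sq_int (PM a b) (\<lambda>x. f (fst x) (snd x))"
  shows "AE w in M. sq_int (lebesgue_on {a..b}) (\<lambda>s. f s w)"
proof -
  interpret Q: pair_sigma_finite "lebesgue_on {a..b}" M by (rule PM_pair)
  have m: "(\<lambda>x. f (fst x) (snd x)) \<in> borel_measurable (PM a b)"
    and i: "integrable (PM a b) (\<lambda>(s, w). (f s w)\<^sup>2)"
    using assms by (auto simp: sq_int_def case_prod_unfold)
  have "AE w in M. integrable (lebesgue_on {a..b}) (\<lambda>s. (f s w)\<^sup>2)"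
    using Q.AE_integrable_snd[OF i] .
  moreover have "AE w in M. (\<lambda>s. f s w) \<in> borel_measurable (lebesgue_on {a..b})"
    using measurable_compose[OF measurable_Pair2' m] by (intro AE_I2) simp
  ultimately show ?thesis by eventually_elim (simp add: sq_int_def)
qed

text \<open>One variable \<beta>, the integral of the absolute value over the whole interval,
  dominates all partial integrals of a path. Cauchy-Schwarz against the constant 1 bounds its square
  by the length c of the interval times the path integral of f^2, which has finite
  expectation.\<close>

lemma sq_int_time_integral:
  assumes sb: "sq_int (PM a b) (\<lambda>x. f (fst x) (snd x))"
  shows "sq_int (PM a b) (\<lambda>x. integral\<^sup>L (lebesgue_on {a..fst x}) (\<lambda>v. f v (snd x)))"
    and "sq_int M (\<lambda>w. integral\<^sup>L (lebesgue_on {a..b}) (\<lambda>v. f v w))"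
proof -
  let ?N = "lebesgue_on {a..b}"
  interpret Q: pair_sigma_finite ?N M by (rule PM_pair)
  interpret N: finite_measure ?N by (rule finite_measure_lebesgue_on_Icc)
  have m[measurable]: "(\<lambda>x. f (fst x) (snd x)) \<in> borel_measurable (PM a b)"
    and i: "integrable (PM a b) (\<lambda>(s, w). (f s w)\<^sup>2)"
    using sb by (auto simp: sq_int_def case_prod_unfold)
  define \<beta> where "\<beta> w = (\<integral>v. \<bar>f v w\<bar> \<partial>?N)" for w
  have sw: "(\<lambda>x. f (snd x) (fst x)) \<in> borel_measurable (M \<Otimes>\<^sub>M ?N)"
    using measurable_compose[OF measurable_pair_swap' m] by (simp add: case_prod_unfold)
  have [measurable]: "\<beta> \<in> borel_measurable M"
    unfolding \<beta>_def[abs_def] by (rule Q.M1.borel_measurable_lebesgue_integral) (use sw in \<open>simp add: case_prod_unfold\<close>)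
  define c where "c = measure ?N {a..b}"
  have b2: "AE w in M. norm ((\<beta> w)\<^sup>2) \<le> norm (c * (\<integral>v. (f v w)\<^sup>2 \<partial>?N))"
    using sq_int_PM_AE_path[OF sb]
  proof eventually_elim
    case (elim w)
    have 1: "sq_int ?N (\<lambda>_. 1)" and 2: "sq_int ?N (\<lambda>v. \<bar>f v w\<bar>)"
      using elim by (auto simp: sq_int_def)
    have "(\<beta> w)\<^sup>2 \<le> c * (\<integral>v. (f v w)\<^sup>2 \<partial>?N)"
      using Cauchy_Schwarz_integral[OF 1 2] by (simp add: \<beta>_def c_def)
    then show ?case by simp
  qed
  have i\<beta>: "integrable M (\<lambda>w. (\<beta> w)\<^sup>2)"
    by (rule Bochner_Integration.integrable_bound[OF _ _ b2]) (use Q.integrable_snd[OF i] in auto)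
  then have s\<beta>: "sq_int M \<beta>" by (simp add: sq_int_def)
  have bound: "AE w in M. \<forall>s\<in>{a..b}. \<bar>integral\<^sup>L (lebesgue_on {a..s}) (\<lambda>v. f v w)\<bar> \<le> \<beta> w"
    using sq_int_PM_AE_path[OF sb]
  proof eventually_elim
    case (elim w)
    have int: "integrable ?N (\<lambda>v. f v w)" by (rule N.sq_int_imp_integrable[OF elim])
    show ?case
    proof
      fix s assume s: "s \<in> {a..b}"
      have "\<bar>\<integral>v. indicator {..s} v * f v w \<partial>?N\<bar> \<le> (\<integral>v. \<bar>indicator {..s} v * f v w\<bar> \<partial>?N)"
        by (rule integral_abs_bound)
      also have "\<dots> \<le> \<beta> w" unfolding \<beta>_def
      proof (rule integral_mono)
        show "integrable ?N (\<lambda>v. \<bar>indicator {..s} v * f v w\<bar>)"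
        proof (rule Bochner_Integration.integrable_bound[OF int])
          show "(\<lambda>v. \<bar>indicator {..s} v * f v w\<bar>) \<in> borel_measurable ?N"
            using int borel_measurable_lebesgue_onI[of "indicator {..s} :: real \<Rightarrow> real"] by simp
        qed (auto simp: indicator_def)
      qed (use int in \<open>auto simp: indicator_def\<close>)
      finally show "\<bar>integral\<^sup>L (lebesgue_on {a..s}) (\<lambda>v. f v w)\<bar> \<le> \<beta> w"
        using s by (subst integral_lebesgue_on_initial[of s b]) auto
    qed
  qed
  \<comment> \<open>Measurability in the upper limit and w together: with the limit moved into an
    indicator, the integrand is measurable in three variables, and one of them is integrated
    out.\<close>
  have Bm: "(\<lambda>x. integral\<^sup>L (lebesgue_on {a..fst x}) (\<lambda>v. f v (snd x))) \<in> borel_measurable (PM a b)"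
  proof -
    have "(\<lambda>x. \<integral>v. indicator {..fst x} v * f v (snd x) \<partial>?N) \<in> borel_measurable (PM a b)"
    proof (rule Q.M1.borel_measurable_lebesgue_integral)
      have 1: "(\<lambda>z. f (snd z) (snd (fst z))) \<in> borel_measurable (PM a b \<Otimes>\<^sub>M ?N)"
      proof -
        have "(\<lambda>z. (snd z, snd (fst z))) \<in> PM a b \<Otimes>\<^sub>M ?N \<rightarrow>\<^sub>M ?N \<Otimes>\<^sub>M M" by simp
        from measurable_compose[OF this m] show ?thesis by simp
      qed
      have 2: "(\<lambda>z. fst (fst z)) \<in> borel_measurable (PM a b \<Otimes>\<^sub>M ?N)"
        "(\<lambda>z. snd z) \<in> borel_measurable (PM a b \<Otimes>\<^sub>M ?N)"
        using measurable_compose[OF measurable_compose[OF measurable_fst measurable_fst] id_borel_measurable_lebesgue_on]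
          measurable_compose[OF measurable_snd id_borel_measurable_lebesgue_on] by auto
      have 3: "{z \<in> space (PM a b \<Otimes>\<^sub>M ?N). snd z \<le> fst (fst z)} \<in> sets (PM a b \<Otimes>\<^sub>M ?N)"
        using 2 by (intro borel_measurable_le)
      have "(\<lambda>z. if snd z \<le> fst (fst z) then f (snd z) (snd (fst z)) else 0) \<in> borel_measurable (PM a b \<Otimes>\<^sub>M ?N)"
        by (rule measurable_If[OF 1 _ 3]) simp
      moreover have "(\<lambda>z. if snd z \<le> fst (fst z) then f (snd z) (snd (fst z)) else 0) =
          (\<lambda>(x, v). indicator {..fst x} v * f v (snd x))"
        by (auto simp: indicator_def)
      ultimately show "(\<lambda>(x, v). indicator {..fst x} v * f v (snd x)) \<in> borel_measurable (PM a b \<Otimes>\<^sub>M ?N)"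
        by simp
    qed
    moreover have "integral\<^sup>L (lebesgue_on {a..fst x}) (\<lambda>v. f v (snd x)) =
        (\<integral>v. indicator {..fst x} v * f v (snd x) \<partial>?N)" if "x \<in> space (PM a b)" for x
      using that by (intro integral_lebesgue_on_initial) (auto simp: space_pair_measure)
    ultimately show ?thesis by (simp cong: measurable_cong)
  qed
  have ae: "AE x in PM a b. norm ((integral\<^sup>L (lebesgue_on {a..fst x}) (\<lambda>v. f v (snd x)))\<^sup>2) \<le> norm ((\<beta> (snd x))\<^sup>2)"
  proof (rule Q.AE_pair_measure)
    show "{x \<in> space (PM a b). norm ((integral\<^sup>L (lebesgue_on {a..fst x}) (\<lambda>v. f v (snd x)))\<^sup>2) \<le> norm ((\<beta> (snd x))\<^sup>2)}
       \<in> sets (PM a b)"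
      using Bm by (intro borel_measurable_le) simp_all
    show "AE x in ?N. AE y in M. norm ((integral\<^sup>L (lebesgue_on {a..fst (x, y)}) (\<lambda>v. f v (snd (x, y))))\<^sup>2)
      \<le> norm ((\<beta> (snd (x, y)))\<^sup>2)"
    proof (rule AE_I2)
      fix x assume "x \<in> space ?N"
      then have x: "x \<in> {a..b}" by simp
      show "AE y in M. norm ((integral\<^sup>L (lebesgue_on {a..fst (x, y)}) (\<lambda>v. f v (snd (x, y))))\<^sup>2)
        \<le> norm ((\<beta> (snd (x, y)))\<^sup>2)"
        using bound
      proof eventually_elim
        case (elim y)
        from bspec[OF elim x] have "\<bar>integral\<^sup>L (lebesgue_on {a..x}) (\<lambda>v. f v y)\<bar>\<^sup>2 \<le> (\<beta> y)\<^sup>2"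
          by (intro power_mono) auto
        then show ?case by simp
      qed
    qed
  qed
  have "integrable (PM a b) (\<lambda>x. (integral\<^sup>L (lebesgue_on {a..fst x}) (\<lambda>v. f v (snd x)))\<^sup>2)"
    by (rule Bochner_Integration.integrable_bound[OF _ _ ae])
       (use sq_int_PM_snd[OF s\<beta>] Bm in \<open>auto simp: sq_int_def\<close>)
  then show "sq_int (PM a b) (\<lambda>x. integral\<^sup>L (lebesgue_on {a..fst x}) (\<lambda>v. f v (snd x)))"
    using Bm by (simp add: sq_int_def)
  show "sq_int M (\<lambda>w. integral\<^sup>L (lebesgue_on {a..b}) (\<lambda>v. f v w))"
  proof -
    have Bm: "(\<lambda>w. integral\<^sup>L (lebesgue_on {a..b}) (\<lambda>v. f v w)) \<in> borel_measurable M"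
      by (rule Q.M1.borel_measurable_lebesgue_integral) (use sw in \<open>simp add: case_prod_unfold\<close>)
    have "integrable M (\<lambda>w. (integral\<^sup>L (lebesgue_on {a..b}) (\<lambda>v. f v w))\<^sup>2)"
    proof (rule Bochner_Integration.integrable_bound[OF i\<beta>])
      show "AE w in M. norm ((integral\<^sup>L (lebesgue_on {a..b}) (\<lambda>v. f v w))\<^sup>2) \<le> norm ((\<beta> w)\<^sup>2)"
      proof (rule AE_I2)
        fix w
        have "\<bar>integral\<^sup>L (lebesgue_on {a..b}) (\<lambda>v. f v w)\<bar>\<^sup>2 \<le> (\<beta> w)\<^sup>2"
          unfolding \<beta>_def by (intro power_mono integral_abs_bound abs_ge_zero)
        then show "norm ((integral\<^sup>L (lebesgue_on {a..b}) (\<lambda>v. f v w))\<^sup>2) \<le> norm ((\<beta> w)\<^sup>2)" by simp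
      qed
    qed (use Bm in simp)
    then show ?thesis using Bm by (simp add: sq_int_def)
  qed
qed

end

section \<open>Second moments of Ito processes\<close>

context adapted_bm
begin

text \<open>The starting value is random because multiplication by an indicator of
  \<open>F t\<close> produces such processes. Each r may use its own version of the integral.
  Adaptedness of \<sigma> is contained in its approximability by adapted simple processes.\<close>

definition ito_process ::
  "real \<Rightarrow> real \<Rightarrow> ('w \<Rightarrow> real) \<Rightarrow> (real \<Rightarrow> 'w \<Rightarrow> real) \<Rightarrow> (real \<Rightarrow> 'w \<Rightarrow> real) \<Rightarrow>
   (real \<Rightarrow> 'w \<Rightarrow> real) \<Rightarrow> bool" where
  "ito_process t T \<eta> b \<sigma> X \<longleftrightarrow>
     0 \<le> t \<and> t \<le> T \<and> \<eta> \<in> borel_measurable (F t) \<and> sq_int M \<eta> \<and>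
     sq_int (PM t T) (\<lambda>x. b (fst x) (snd x)) \<and> (\<forall>s\<in>{t..T}. b s \<in> borel_measurable (F s)) \<and>
     sq_int (PM t T) (\<lambda>x. X (fst x) (snd x)) \<and> (\<forall>s\<in>{t..T}. X s \<in> borel_measurable (F s)) \<and>
     (\<forall>r\<in>{t..T}. \<exists>I. has_ito_integral M F W t r \<sigma> I \<and>
        (AE w in M. X r w = \<eta> w + integral\<^sup>L (lebesgue_on {t..r}) (\<lambda>s. b s w) + I w))"

lemma ito_process_restrict:
  assumes "ito_process t T \<eta> b \<sigma> X" "r \<in> {t..T}"
  shows "ito_process t r \<eta> b \<sigma> X"
  using assms unfolding ito_process_def by (auto intro: sq_int_PM_subset[of t T])

text \<open>Turns an expectation over a set A in \<open>F t\<close> into a plain expectation of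
  another Ito process, which is how conditional statements are reached.\<close>

lemma ito_process_mult_indicator:
  assumes X: "ito_process t T \<eta> b \<sigma> X" and A: "A \<in> sets (F t)"
  shows "ito_process t T (\<lambda>w. indicator A w * \<eta> w) (\<lambda>s w. indicator A w * b s w)
    (\<lambda>s w. indicator A w * \<sigma> s w) (\<lambda>s w. indicator A w * X s w)"
proof -
  have t: "0 \<le> t" using X by (simp add: ito_process_def)
  have AM[measurable]: "A \<in> sets M" using A subalg[OF t] by (auto simp: subalgebra_def)
  have As: "A \<in> sets (F s)" if "t \<le> s" for s
    using A filtration_mono[OF t that] by (auto simp: subalgebra_def)
  have 1: "sq_int M (\<lambda>w. indicator A w * f w)" if "sq_int M f" for f
    by (rule sq_int_bounded_mult[OF that, of _ 1]) (auto simp: indicator_def)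
  have 2: "sq_int (PM t T) (\<lambda>x. indicator A (snd x) * f (fst x) (snd x))"
    if "sq_int (PM t T) (\<lambda>x. f (fst x) (snd x))" for f
    by (rule sq_int_bounded_mult[OF that, of _ 1]) (auto simp: indicator_def)
  have "\<exists>I. has_ito_integral M F W t r (\<lambda>s w. indicator A w * \<sigma> s w) I \<and>
        (AE w in M. indicator A w * X r w = indicator A w * \<eta> w +
           integral\<^sup>L (lebesgue_on {t..r}) (\<lambda>s. indicator A w * b s w) + I w)"
    if r: "r \<in> {t..T}" for r
  proof -
    from X r obtain I where I: "has_ito_integral M F W t r \<sigma> I"
      "AE w in M. X r w = \<eta> w + integral\<^sup>L (lebesgue_on {t..r}) (\<lambda>s. b s w) + I w"
      unfolding ito_process_def by blast
    have "AE w in M. indicator A w * X r w = indicator A w * \<eta> w +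
           integral\<^sup>L (lebesgue_on {t..r}) (\<lambda>s. indicator A w * b s w) + indicator A w * I w"
      using I(2) by eventually_elim (simp add: algebra_simps)
    with has_ito_integral_mult_indicator[OF I(1) t A] show ?thesis by blast
  qed
  moreover have "(\<lambda>w. indicator A w * f w) \<in> borel_measurable (F s)"
    if "f \<in> borel_measurable (F s)" "t \<le> s" for s and f :: "'w \<Rightarrow> real"
    using As[OF that(2)] that(1) by simp
  ultimately show ?thesis using X 1 2 unfolding ito_process_def by simp
qed

text \<open>Let Y be \<eta> plus the integral of b, that is X without its martingale part, and
  likewise Y'. The drift parts contribute b Y' + b' Y, the mixed terms b (X' - Y') + b' (X - Y), and
  together these are b X' + b' X.\<close>

theorem ito_product:
  assumes X: "ito_process t T \<eta> b \<sigma> X" and X': "ito_process t T \<eta>' b' \<sigma>' X'"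
  shows "expectation (\<lambda>w. X T w * X' T w) = expectation (\<lambda>w. \<eta> w * \<eta>' w) +
    (\<integral>x. b (fst x) (snd x) * X' (fst x) (snd x) + b' (fst x) (snd x) * X (fst x) (snd x)
        + \<sigma> (fst x) (snd x) * \<sigma>' (fst x) (snd x) \<partial>PM t T)"
proof -
  let ?N = "lebesgue_on {t..T}"
  interpret Q: pair_sigma_finite ?N M by (rule PM_pair)
  interpret N: finite_measure ?N by (rule finite_measure_lebesgue_on_Icc)
  define B where "B f s w = integral\<^sup>L (lebesgue_on {t..s}) (\<lambda>v. f v w)" for f :: "real \<Rightarrow> 'w \<Rightarrow> real" and s w
  have t: "0 \<le> t" "t \<le> T" using X by (auto simp: ito_process_def)
  \<comment> \<open>Stated for arbitrary data because it is used twice with exchanged roles. The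
    versions of the integral at different times s are chosen separately and need not be jointly
    measurable in (s, w); X' minus its start and drift is a jointly measurable substitute that
    agrees with them almost surely at each s.\<close>
  have cross: "expectation (\<lambda>w. (\<eta> w + B b T w) * I' w) =
      (\<integral>x. b (fst x) (snd x) * (X' (fst x) (snd x) - (\<eta>' (snd x) + B b' (fst x) (snd x))) \<partial>PM t T)"
    if X: "ito_process t T \<eta> b \<sigma> X" and X': "ito_process t T \<eta>' b' \<sigma>' X'" and
      I': "has_ito_integral M F W t T \<sigma>' I'"
    for \<eta> b \<sigma> X \<eta>' b' \<sigma>' X' I'
  proof -
    have sb: "sq_int (PM t T) (\<lambda>x. b (fst x) (snd x))" and b: "\<And>s. s \<in> {t..T} \<Longrightarrow> b s \<in> borel_measurable (F s)"
      using X by (auto simp: ito_process_def)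
    have sX': "sq_int (PM t T) (\<lambda>x. X' (fst x) (snd x))" and sb': "sq_int (PM t T) (\<lambda>x. b' (fst x) (snd x))"
      and s\<eta>': "sq_int M \<eta>'"
      using X' by (auto simp: ito_process_def)
    have s\<eta>: "sq_int M \<eta>" "\<eta> \<in> borel_measurable (F t)" using X by (auto simp: ito_process_def)
    have sI: "sq_int M I'" by (rule has_ito_integral_sq_int(1)[OF I' t(1)])
    have sB: "sq_int M (B b T)" unfolding B_def[abs_def] by (rule sq_int_time_integral(2)[OF sb])
    have sB': "sq_int (PM t T) (\<lambda>x. B b' (fst x) (snd x))"
      unfolding B_def[abs_def] by (rule sq_int_time_integral(1)[OF sb'])
    from X' t obtain I0 where "has_ito_integral M F W t t \<sigma>' I0"
      unfolding ito_process_def by (meson atLeastAtMost_iff order.refl)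
    from ito_mean_zero[OF I' this t s\<eta>(2,1)] have z: "expectation (\<lambda>w. \<eta> w * I' w) = 0" .
    have i1: "integrable (PM t T) (\<lambda>(s, w). b s w * I' w)"
      using sq_int_integrable_mult[OF sb sq_int_PM_snd[OF sI]] by (simp add: case_prod_unfold)
    have i2: "integrable (PM t T) (\<lambda>x. b (fst x) (snd x) * (X' (fst x) (snd x) - (\<eta>' (snd x) + B b' (fst x) (snd x))))"
      by (intro sq_int_integrable_mult[OF sb] sq_int_diff sX' sq_int_add sq_int_PM_snd s\<eta>' sB')
    have ae: "AE s in ?N. expectation (\<lambda>w. b s w * I' w) =
        expectation (\<lambda>w. b s w * (X' s w - (\<eta>' w + B b' s w)))"
      using sq_int_PM_AE_time[OF sb] sq_int_PM_AE_time[OF sX'] sq_int_PM_AE_time[OF sB'] AE_space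
    proof eventually_elim
      case (elim s)
      then have s: "s \<in> {t..T}" by simp
      with X' obtain I where I: "has_ito_integral M F W t s \<sigma>' I"
        "AE w in M. X' s w = \<eta>' w + B b' s w + I w"
        unfolding ito_process_def B_def by blast
      have "expectation (\<lambda>w. b s w * I' w) = expectation (\<lambda>w. b s w * I w)"
        using s by (intro ito_martingale[OF I' I(1) t(1)] b elim) auto
      also have "\<dots> = expectation (\<lambda>w. b s w * (X' s w - (\<eta>' w + B b' s w)))"
      proof (rule integral_cong_AE)
        show "AE w in M. b s w * I w = b s w * (X' s w - (\<eta>' w + B b' s w))"
          using I(2) by eventually_elim simp
      qed (use elim s\<eta>' has_ito_integral_sq_int(1)[OF I(1) t(1)] in \<open>auto simp: sq_int_def\<close>)
      finally show ?case .
    qed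
    have "expectation (\<lambda>w. (\<eta> w + B b T w) * I' w) = expectation (\<lambda>w. B b T w * I' w)"
      using z s\<eta>(1) sB sI by (simp add: distrib_right sq_int_integrable_mult)
    also have "\<dots> = expectation (\<lambda>w. \<integral>s. b s w * I' w \<partial>?N)" by (simp add: B_def)
    also have "\<dots> = (\<integral>(s, w). b s w * I' w \<partial>PM t T)" by (rule Q.integral_snd[OF i1])
    also have "\<dots> = (\<integral>s. expectation (\<lambda>w. b s w * I' w) \<partial>?N)" using Q.integral_fst'[OF i1] by simp
    also have "\<dots> = (\<integral>s. expectation (\<lambda>w. b s w * (X' s w - (\<eta>' w + B b' s w))) \<partial>?N)"
      using Q.integrable_fst'[OF i1] Q.integrable_fst'[OF i2] by (intro integral_cong_AE ae) auto
    also have "\<dots> = (\<integral>x. b (fst x) (snd x) * (X' (fst x) (snd x) - (\<eta>' (snd x) + B b' (fst x) (snd x))) \<partial>PM t T)"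
      using Q.integral_fst'[OF i2] by simp
    finally show ?thesis .
  qed
  have sq: "sq_int (PM t T) (\<lambda>x. b (fst x) (snd x))" "sq_int (PM t T) (\<lambda>x. b' (fst x) (snd x))"
    "sq_int (PM t T) (\<lambda>x. X (fst x) (snd x))" "sq_int (PM t T) (\<lambda>x. X' (fst x) (snd x))"
    "sq_int M \<eta>" "sq_int M \<eta>'"
    using X X' by (auto simp: ito_process_def)
  note sB = sq_int_time_integral(1)[OF sq(1), folded B_def] sq_int_time_integral(1)[OF sq(2), folded B_def]
    sq_int_time_integral(2)[OF sq(1), folded B_def] sq_int_time_integral(2)[OF sq(2), folded B_def]
  define Y where "Y = (\<lambda>x. \<eta> (snd x) + B b (fst x) (snd x))"
  define Y' where "Y' = (\<lambda>x. \<eta>' (snd x) + B b' (fst x) (snd x))"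
  have sY: "sq_int (PM t T) Y" "sq_int (PM t T) Y'"
    unfolding Y_def Y'_def by (intro sq_int_add sq_int_PM_snd sq sB)+
  have drift: "expectation (\<lambda>w. (\<eta> w + B b T w) * (\<eta>' w + B b' T w)) =
      expectation (\<lambda>w. \<eta> w * \<eta>' w) + (\<integral>x. b (fst x) (snd x) * Y' x + b' (fst x) (snd x) * Y x \<partial>PM t T)"
  proof -
    have i: "integrable (PM t T) (\<lambda>(s, w). b s w * Y' (s, w) + b' s w * Y (s, w))"
      using sq_int_integrable_mult[OF sq(1) sY(2)] sq_int_integrable_mult[OF sq(2) sY(1)]
      by (simp add: case_prod_unfold)
    have ae: "AE w in M. (\<eta> w + B b T w) * (\<eta>' w + B b' T w) = \<eta> w * \<eta>' w +
        (\<integral>s. b s w * Y' (s, w) + b' s w * Y (s, w) \<partial>?N)"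
      using sq_int_PM_AE_path[OF sq(1)] sq_int_PM_AE_path[OF sq(2)]
    proof eventually_elim
      case (elim w)
      note int = elim[THEN N.sq_int_imp_integrable]
      note pr = product_rule_integral[OF int, folded B_def]
      have "(\<integral>s. b s w * Y' (s, w) + b' s w * Y (s, w) \<partial>?N) =
        (\<integral>s. b s w * \<eta>' w + b s w * B b' s w + (b' s w * \<eta> w + B b s w * b' s w) \<partial>?N)"
        by (simp add: Y_def Y'_def algebra_simps)
      also have "\<dots> = B b T w * \<eta>' w + B b' T w * \<eta> w + B b T w * B b' T w"
        using int pr by (simp add: B_def[of _ T])
      finally show ?case by (simp add: algebra_simps)
    qed
    have "expectation (\<lambda>w. (\<eta> w + B b T w) * (\<eta>' w + B b' T w)) = expectation (\<lambda>w. \<eta> w * \<eta>' w +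
        (\<integral>s. b s w * Y' (s, w) + b' s w * Y (s, w) \<partial>?N))"
      using Q.integrable_snd[OF i] sq(5,6) sB(3,4)
      by (intro integral_cong_AE ae) (auto simp: sq_int_def)
    also have "\<dots> = expectation (\<lambda>w. \<eta> w * \<eta>' w) +
        expectation (\<lambda>w. \<integral>s. b s w * Y' (s, w) + b' s w * Y (s, w) \<partial>?N)"
      by (intro Bochner_Integration.integral_add sq_int_integrable_mult sq Q.integrable_snd[OF i])
    also have "expectation (\<lambda>w. \<integral>s. b s w * Y' (s, w) + b' s w * Y (s, w) \<partial>?N) =
       (\<integral>x. b (fst x) (snd x) * Y' x + b' (fst x) (snd x) * Y x \<partial>PM t T)"
      unfolding Q.integral_snd[OF i] by (simp add: case_prod_unfold)
    finally show ?thesis .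
  qed
  from X t obtain I where I: "has_ito_integral M F W t T \<sigma> I"
    "AE w in M. X T w = \<eta> w + B b T w + I w"
    unfolding ito_process_def B_def by force
  from X' t obtain I' where I': "has_ito_integral M F W t T \<sigma>' I'"
    "AE w in M. X' T w = \<eta>' w + B b' T w + I' w"
    unfolding ito_process_def B_def by force
  note sI = has_ito_integral_sq_int[OF I(1) t(1)] and sI' = has_ito_integral_sq_int[OF I'(1) t(1)]
  have sZ: "sq_int M (\<lambda>w. \<eta> w + B b T w)" "sq_int M (\<lambda>w. \<eta>' w + B b' T w)"
    by (intro sq_int_add sq sB)+
  have "expectation (\<lambda>w. X T w * X' T w) =
      expectation (\<lambda>w. (\<eta> w + B b T w + I w) * (\<eta>' w + B b' T w + I' w))"
  proof (rule integral_cong_AE)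
    have "X T \<in> borel_measurable (F T)" "X' T \<in> borel_measurable (F T)"
      using X X' by (auto simp: ito_process_def)
    then have "X T \<in> borel_measurable M" "X' T \<in> borel_measurable M"
      using adapted_measurable t by (meson order_trans)+
    then show "(\<lambda>w. X T w * X' T w) \<in> borel_measurable M" by simp
    show "(\<lambda>w. (\<eta> w + B b T w + I w) * (\<eta>' w + B b' T w + I' w)) \<in> borel_measurable M"
      using sq(5,6) sB(3,4) sI(1) sI'(1) by (auto simp: sq_int_def)
    show "AE w in M. X T w * X' T w = (\<eta> w + B b T w + I w) * (\<eta>' w + B b' T w + I' w)"
      using I(2) I'(2) by eventually_elim simp
  qed
  also have "\<dots> = expectation (\<lambda>w. (\<eta> w + B b T w) * (\<eta>' w + B b' T w) + (\<eta> w + B b T w) * I' w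
      + (\<eta>' w + B b' T w) * I w + I w * I' w)"
    by (simp add: algebra_simps)
  also have "\<dots> = expectation (\<lambda>w. (\<eta> w + B b T w) * (\<eta>' w + B b' T w)) +
      expectation (\<lambda>w. (\<eta> w + B b T w) * I' w) + expectation (\<lambda>w. (\<eta>' w + B b' T w) * I w) +
      expectation (\<lambda>w. I w * I' w)"
    using sZ sI(1) sI'(1) by (simp add: sq_int_integrable_mult)
  also have "\<dots> = expectation (\<lambda>w. \<eta> w * \<eta>' w) +
      ((\<integral>x. b (fst x) (snd x) * Y' x + b' (fst x) (snd x) * Y x \<partial>PM t T) +
       (\<integral>x. b (fst x) (snd x) * (X' (fst x) (snd x) - Y' x) \<partial>PM t T) +
       (\<integral>x. b' (fst x) (snd x) * (X (fst x) (snd x) - Y x) \<partial>PM t T) +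
       (\<integral>x. \<sigma> (fst x) (snd x) * \<sigma>' (fst x) (snd x) \<partial>PM t T))"
    unfolding drift cross[OF X X' I'(1)] cross[OF X' X I(1)] ito_isometry[OF I(1) I'(1) t(1)]
    by (simp add: Y_def Y'_def)
  also have "\<dots> = expectation (\<lambda>w. \<eta> w * \<eta>' w) +
     (\<integral>x. (b (fst x) (snd x) * Y' x + b' (fst x) (snd x) * Y x)
       + b (fst x) (snd x) * (X' (fst x) (snd x) - Y' x)
       + b' (fst x) (snd x) * (X (fst x) (snd x) - Y x)
       + \<sigma> (fst x) (snd x) * \<sigma>' (fst x) (snd x) \<partial>PM t T)"
    using sq sY sI(2) sI'(2) by (simp add: sq_int_integrable_mult sq_int_diff)
  finally show ?thesis by (simp add: algebra_simps)
qed

end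

section \<open>Second moments as functions of time, with deterministic weights\<close>

lemma integral_lebesgue_on_combine:
  fixes f :: "real \<Rightarrow> 'a::euclidean_space"
  assumes f: "integrable (lebesgue_on {a..b}) f" and c: "a \<le> c" "c \<le> b"
  shows "integral\<^sup>L (lebesgue_on {a..b}) f = integral\<^sup>L (lebesgue_on {a..c}) f + integral\<^sup>L (lebesgue_on {c..b}) f"
proof -
  have f': "integrable lebesgue (\<lambda>x. indicator {a..b} x *\<^sub>R f x)"
    using f by (simp add: integrable_restrict_space)
  have i: "integrable lebesgue (\<lambda>x. indicator S x *\<^sub>R f x)" if "S \<subseteq> {a..b}" "S \<in> sets lebesgue" for S
  proof -
    have "integrable lebesgue (\<lambda>x. indicator S x *\<^sub>R (indicator {a..b} x *\<^sub>R f x))"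
      by (rule integrable_mult_indicator[OF that(2) f'])
    moreover have "(\<lambda>x. indicator S x *\<^sub>R (indicator {a..b} x *\<^sub>R f x)) = (\<lambda>x. indicator S x *\<^sub>R f x)"
      using that(1) by (intro ext) (auto simp: indicator_def)
    ultimately show ?thesis by (simp only:)
  qed
  have "AE x in lebesgue. x \<noteq> c"
    by (intro AE_I[of _ _ "{c}"]) auto
  then have "integral\<^sup>L lebesgue (\<lambda>x. indicator {a..b} x *\<^sub>R f x) =
    integral\<^sup>L lebesgue (\<lambda>x. indicator {a..c} x *\<^sub>R f x + indicator {c..b} x *\<^sub>R f x)"
    using c i[of "{a..c}"] i[of "{c..b}"] f'
    by (intro integral_cong_AE) (auto simp: indicator_def)
  also have "\<dots> = integral\<^sup>L lebesgue (\<lambda>x. indicator {a..c} x *\<^sub>R f x) + integral\<^sup>L lebesgue (\<lambda>x. indicator {c..b} x *\<^sub>R f x)"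
    using c by (intro Bochner_Integration.integral_add i) auto
  finally show ?thesis by (simp add: integral_restrict_space)
qed

lemma integrable_lebesgue_on_subset:
  fixes f :: "real \<Rightarrow> 'a::euclidean_space"
  assumes f: "integrable (lebesgue_on {a..b}) f" and c: "{c..d} \<subseteq> {a..b}"
  shows "integrable (lebesgue_on {c..d}) f"
proof -
  have f': "integrable lebesgue (\<lambda>x. indicator {a..b} x *\<^sub>R f x)"
    using f by (simp add: integrable_restrict_space)
  have "integrable lebesgue (\<lambda>x. indicator {c..d} x *\<^sub>R (indicator {a..b} x *\<^sub>R f x))"
    by (rule integrable_mult_indicator[OF _ f']) simp
  moreover have "(\<lambda>x. indicator {c..d} x *\<^sub>R (indicator {a..b} x *\<^sub>R f x)) = (\<lambda>x. indicator {c..d} x *\<^sub>R f x)"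
    using c by (intro ext) (auto simp: indicator_def)
  ultimately have "integrable lebesgue (\<lambda>x. indicator {c..d} x *\<^sub>R f x)" by (simp only:)
  then show ?thesis by (simp add: integrable_restrict_space)
qed

context adapted_bm
begin

text \<open>The product formula on every [t,r] exhibits the second moment as a primitive of m, the
  form in which the product rule can attach a weight.\<close>

lemma ito_product_time:
  assumes X: "ito_process t T \<eta> b \<sigma> X" and X': "ito_process t T \<eta>' b' \<sigma>' X'" and r: "r \<in> {t..T}"
  defines "m \<equiv> \<lambda>s. expectation (\<lambda>w. b s w * X' s w + b' s w * X s w + \<sigma> s w * \<sigma>' s w)"
  shows "expectation (\<lambda>w. X r w * X' r w) = expectation (\<lambda>w. \<eta> w * \<eta>' w) + integral\<^sup>L (lebesgue_on {t..r}) m"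
    and "integrable (PM t r) (\<lambda>(s, w). b s w * X' s w + b' s w * X s w + \<sigma> s w * \<sigma>' s w)"
proof -
  interpret Q: pair_sigma_finite "lebesgue_on {t..r}" M by (rule PM_pair)
  note X = ito_process_restrict[OF X r] and X' = ito_process_restrict[OF X' r]
  have t: "0 \<le> t" using X by (simp add: ito_process_def)
  have r: "r \<in> {t..r}" using r by simp
  from X r obtain I where "has_ito_integral M F W t r \<sigma> I" unfolding ito_process_def by blast
  from has_ito_integral_sq_int(2)[OF this t] have s\<sigma>: "sq_int (PM t r) (\<lambda>x. \<sigma> (fst x) (snd x))" .
  from X' r obtain I where "has_ito_integral M F W t r \<sigma>' I" unfolding ito_process_def by blast
  from has_ito_integral_sq_int(2)[OF this t] have s\<sigma>': "sq_int (PM t r) (\<lambda>x. \<sigma>' (fst x) (snd x))" .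
  show i: "integrable (PM t r) (\<lambda>(s, w). b s w * X' s w + b' s w * X s w + \<sigma> s w * \<sigma>' s w)"
    using X X' s\<sigma> s\<sigma>' by (auto simp: ito_process_def case_prod_unfold sq_int_integrable_mult)
  show "expectation (\<lambda>w. X r w * X' r w) = expectation (\<lambda>w. \<eta> w * \<eta>' w) + integral\<^sup>L (lebesgue_on {t..r}) m"
    using ito_product[OF X X'] Q.integral_fst'[OF i] by (simp add: m_def case_prod_unfold)
qed

text \<open>Both p and the second moment are primitives, so \<open>product_rule_integral\<close>
  applies to their product. The bound K, uniform in time, serves the term with h: since h is only
  integrable, integrability of the moment in time would not make their product integrable.\<close>

lemma weighted_ito_product:
  fixes p h :: "real \<Rightarrow> real"
  assumes X: "ito_process t T \<eta> b \<sigma> X" and X': "ito_process t T \<eta>' b' \<sigma>' X'"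
    and K: "\<And>s. s \<in> {t..T} \<Longrightarrow> sq_int M (X s) \<and> expectation (\<lambda>w. (X s w)\<^sup>2) \<le> K"
    and K': "\<And>s. s \<in> {t..T} \<Longrightarrow> sq_int M (X' s) \<and> expectation (\<lambda>w. (X' s w)\<^sup>2) \<le> K"
    and p: "continuous_on {t..T} p" and h: "integrable (lebesgue_on {t..T}) h"
    and ph: "\<And>s. s \<in> {t..T} \<Longrightarrow> p s = p T + integral\<^sup>L (lebesgue_on {s..T}) h"
  defines "k \<equiv> \<lambda>s w. p s * (b s w * X' s w + b' s w * X s w + \<sigma> s w * \<sigma>' s w) - h s * (X s w * X' s w)"
  shows "integrable (PM t T) (\<lambda>(s, w). k s w)"
    and "p T * expectation (\<lambda>w. X T w * X' T w) = p t * expectation (\<lambda>w. \<eta> w * \<eta>' w) + (\<integral>(s, w). k s w \<partial>PM t T)"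
proof -
  let ?N = "lebesgue_on {t..T}"
  interpret Q: pair_sigma_finite ?N M by (rule PM_pair)
  interpret N: finite_measure ?N by (rule finite_measure_lebesgue_on_Icc)
  have t: "t \<le> T" "T \<in> {t..T}" using X by (auto simp: ito_process_def)
  have [measurable]: "p \<in> borel_measurable ?N"
    by (rule continuous_imp_measurable_on_sets_lebesgue[OF p]) simp
  have hm[measurable]: "h \<in> borel_measurable ?N" using h by simp
  have "bounded (p ` {t..T})" by (intro compact_imp_bounded compact_continuous_image p) simp
  then obtain L where "\<forall>x\<in>p ` {t..T}. norm x \<le> L" unfolding bounded_iff ..
  then have L: "\<bar>p s\<bar> \<le> L" if "s \<in> {t..T}" for s using that by auto
  define q where "q s w = b s w * X' s w + b' s w * X s w + \<sigma> s w * \<sigma>' s w" for s w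
  define m where "m s = expectation (q s)" for s
  have qi: "integrable (PM t T) (\<lambda>(s, w). q s w)"
    using ito_product_time(2)[OF X X' t(2)] by (simp add: q_def)
  have pq: "integrable (PM t T) (\<lambda>(s, w). p s * q s w)"
  proof (rule Bochner_Integration.integrable_bound)
    show "integrable (PM t T) (\<lambda>z. L * (case z of (s, w) \<Rightarrow> q s w))" using qi by simp
    show "(\<lambda>(s, w). p s * q s w) \<in> borel_measurable (PM t T)" using qi by (auto simp: case_prod_unfold)
    show "AE x in PM t T. norm (case x of (s, w) \<Rightarrow> p s * q s w) \<le> norm (L * (case x of (s, w) \<Rightarrow> q s w))"
      by (intro AE_I2) (auto simp: space_pair_measure abs_mult intro!: mult_right_mono order_trans[OF L abs_ge_self])
  qed
  have sX: "sq_int (PM t T) (\<lambda>x. X (fst x) (snd x))" "sq_int (PM t T) (\<lambda>x. X' (fst x) (snd x))"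
    using X X' by (auto simp: ito_process_def)
  have XX: "integrable M (\<lambda>w. X s w * X' s w)" "expectation (\<lambda>w. \<bar>X s w * X' s w\<bar>) \<le> 2 * K"
    if "s \<in> {t..T}" for s
  proof -
    note k = K[OF that] K'[OF that]
    show i: "integrable M (\<lambda>w. X s w * X' s w)" using k by (auto intro: sq_int_integrable_mult)
    have "expectation (\<lambda>w. \<bar>X s w * X' s w\<bar>) \<le> expectation (\<lambda>w. (X s w)\<^sup>2 + (X' s w)\<^sup>2)"
      using k by (intro integral_mono integrable_abs i Bochner_Integration.integrable_add abs_mult_le_sum_power2)
         (auto simp: sq_int_def)
    also have "\<dots> \<le> 2 * K" using k by (simp add: sq_int_def)
    finally show "expectation (\<lambda>w. \<bar>X s w * X' s w\<bar>) \<le> 2 * K" .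
  qed
  have hXm: "(\<lambda>(s, w). h s * (X s w * X' s w)) \<in> borel_measurable (PM t T)"
    using sX by (auto simp: case_prod_unfold sq_int_def)
  have hX: "integrable (PM t T) (\<lambda>(s, w). h s * (X s w * X' s w))"
  proof (rule Q.Fubini_integrable[OF hXm])
    show "AE x in ?N. integrable M (\<lambda>y. case (x, y) of (s, w) \<Rightarrow> h s * (X s w * X' s w))"
      using XX(1) by (intro AE_I2) simp
    show "integrable ?N (\<lambda>x. expectation (\<lambda>y. norm (case (x, y) of (s, w) \<Rightarrow> h s * (X s w * X' s w))))"
    proof (rule Bochner_Integration.integrable_bound)
      show "integrable ?N (\<lambda>s. h s * (2 * K))" using h by simp
      show "(\<lambda>x. expectation (\<lambda>y. norm (case (x, y) of (s, w) \<Rightarrow> h s * (X s w * X' s w)))) \<in> borel_measurable ?N"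
        by (rule borel_measurable_lebesgue_integral) (use hXm in \<open>simp add: case_prod_unfold\<close>)
      show "AE x in ?N. norm (expectation (\<lambda>y. norm (case (x, y) of (s, w) \<Rightarrow> h s * (X s w * X' s w))))
          \<le> norm (h x * (2 * K))"
      proof (rule AE_I2)
        fix s assume "s \<in> space ?N"
        then have s: "s \<in> {t..T}" by simp
        have "expectation (\<lambda>y. norm (h s * (X s y * X' s y))) = \<bar>h s\<bar> * expectation (\<lambda>w. \<bar>X s w * X' s w\<bar>)"
          by (simp add: abs_mult)
        also have "\<dots> \<le> \<bar>h s\<bar> * (2 * K)" by (intro mult_left_mono XX s) simp
        also have "\<dots> \<le> norm (h s * (2 * K))" by (metis abs_ge_self abs_mult abs_ge_zero mult_left_mono real_norm_def)
        finally show "norm (expectation (\<lambda>y. norm (case (s, y) of (s, w) \<Rightarrow> h s * (X s w * X' s w))))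
          \<le> norm (h s * (2 * K))" by (simp add: abs_mult)
      qed
    qed
  qed
  have kq: "(\<lambda>(s, w). k s w) = (\<lambda>x. (case x of (s, w) \<Rightarrow> p s * q s w) - (case x of (s, w) \<Rightarrow> h s * (X s w * X' s w)))"
    by (auto simp: k_def q_def)
  show "integrable (PM t T) (\<lambda>(s, w). k s w)" unfolding kq by (rule Bochner_Integration.integrable_diff[OF pq hX])
  define e where "e = expectation (\<lambda>w. \<eta> w * \<eta>' w)"
  \<comment> \<open>The hypothesis describes p backwards from T, the product rule works forwards
    from t; hence the sign of h, and p s = p t + FF s below.\<close>
  define FF where "FF s = integral\<^sup>L (lebesgue_on {t..s}) (\<lambda>v. - h v)" for s
  define GG where "GG s = integral\<^sup>L (lebesgue_on {t..s}) m" for s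
  have im: "integrable ?N m" using Q.integrable_fst'[OF qi] by (simp add: m_def[abs_def])
  have ih: "integrable ?N (\<lambda>v. - h v)" using h by simp
  note pr = product_rule_integral[OF ih im, folded FF_def GG_def]
  have ps: "p s = p t + FF s" if s: "s \<in> {t..T}" for s
  proof -
    have "integral\<^sup>L ?N h = integral\<^sup>L (lebesgue_on {t..s}) h + integral\<^sup>L (lebesgue_on {s..T}) h"
      using s by (intro integral_lebesgue_on_combine h) auto
    then show ?thesis using ph[OF s] ph[of t] t(1) by (simp add: FF_def)
  qed
  have ms: "expectation (\<lambda>w. X s w * X' s w) = e + GG s" if "s \<in> {t..T}" for s
    using ito_product_time(1)[OF X X' that] by (simp add: e_def GG_def m_def[abs_def] q_def[abs_def])
  have "p T * expectation (\<lambda>w. X T w * X' T w) = p t * e + (p t * GG T + e * FF T + FF T * GG T)"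
    unfolding ps[OF t(2)] ms[OF t(2)] by (simp add: algebra_simps)
  also have "p t * GG T + e * FF T + FF T * GG T =
     (\<integral>s. (p t * m s + e * (- h s)) + ((- h s) * GG s + FF s * m s) \<partial>?N)"
  proof -
    have "(\<integral>s. (p t * m s + e * (- h s)) + ((- h s) * GG s + FF s * m s) \<partial>?N) =
      ((\<integral>s. p t * m s \<partial>?N) + (\<integral>s. e * (- h s) \<partial>?N)) + ((\<integral>s. (- h s) * GG s \<partial>?N) + (\<integral>s. FF s * m s \<partial>?N))"
      using im ih pr(1,2) by (simp only: Bochner_Integration.integral_add Bochner_Integration.integrable_add integrable_mult_right)
    also have "\<dots> = p t * GG T + e * FF T + FF T * GG T"
      unfolding pr(3) by (simp add: FF_def GG_def)
    finally show ?thesis by simp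
  qed
  also have "\<dots> = (\<integral>s. p s * m s - h s * expectation (\<lambda>w. X s w * X' s w) \<partial>?N)"
  proof (intro Bochner_Integration.integral_cong refl)
    fix s assume "s \<in> space ?N"
    then have "s \<in> {t..T}" by simp
    from ps[OF this] ms[OF this]
    show "(p t * m s + e * (- h s)) + ((- h s) * GG s + FF s * m s) = p s * m s - h s * expectation (\<lambda>w. X s w * X' s w)"
      by (simp add: algebra_simps)
  qed
  also have "\<dots> = (\<integral>s. p s * m s \<partial>?N) - (\<integral>s. h s * expectation (\<lambda>w. X s w * X' s w) \<partial>?N)"
    using Q.integrable_fst'[OF pq] Q.integrable_fst'[OF hX] by (simp add: m_def)
  also have "\<dots> = (\<integral>(s, w). p s * q s w \<partial>PM t T) - (\<integral>(s, w). h s * (X s w * X' s w) \<partial>PM t T)"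
    using Q.integral_fst'[OF pq] Q.integral_fst'[OF hX] by (simp add: m_def)
  also have "\<dots> = (\<integral>(s, w). k s w \<partial>PM t T)"
    unfolding kq by (rule Bochner_Integration.integral_diff[OF pq hX, symmetric])
  finally show "p T * expectation (\<lambda>w. X T w * X' T w) = p t * expectation (\<lambda>w. \<eta> w * \<eta>' w) + (\<integral>(s, w). k s w \<partial>PM t T)"
    by (simp add: e_def)
qed

end

section \<open>Quadratic functionals and completion of squares\<close>

lemma matrix_vector_inner_sum:
  "(A *v x) \<bullet> y = (\<Sum>i\<in>UNIV. \<Sum>j\<in>UNIV. (A $ i $ j :: real) * x $ j * y $ i)"
  by (simp add: inner_vec_def matrix_vector_mult_def sum_distrib_right)

context adapted_bm
begin

text \<open>\<open>H\<close> is minus the derivative of P, as in \<open>backward_solution\<close>,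
  hence the last sign. The two mixed terms stay separate since they arise separately when the
  products of components are summed with the entries of P as weights.\<close>

definition value_drift ::
  "(real \<Rightarrow> real^'n^'n) \<Rightarrow> (real \<Rightarrow> real^'n^'n) \<Rightarrow> (real \<Rightarrow> 'w \<Rightarrow> real^'n) \<Rightarrow> (real \<Rightarrow> 'w \<Rightarrow> real^'n) \<Rightarrow>
   (real \<Rightarrow> 'w \<Rightarrow> real^'n) \<Rightarrow> real \<Rightarrow> 'w \<Rightarrow> real" where
  "value_drift P H b \<sigma> X s w =
     (P s *v X s w) \<bullet> b s w + (P s *v b s w) \<bullet> X s w + (P s *v \<sigma> s w) \<bullet> \<sigma> s w - (H s *v X s w) \<bullet> X s w"

text \<open>Componentwise, so that the scalar product formula applies to each pair of entries; the
  bound K is shared by all components and times, as \<open>weighted_ito_product\<close>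
  asks.\<close>

definition vec_ito_process ::
  "real \<Rightarrow> real \<Rightarrow> real^'n \<Rightarrow> (real \<Rightarrow> 'w \<Rightarrow> real^'n) \<Rightarrow> (real \<Rightarrow> 'w \<Rightarrow> real^'n) \<Rightarrow>
   (real \<Rightarrow> 'w \<Rightarrow> real^'n) \<Rightarrow> bool" where
  "vec_ito_process t T x b \<sigma> X \<longleftrightarrow>
     (\<forall>i. ito_process t T (\<lambda>_. x $ i) (\<lambda>s w. b s w $ i) (\<lambda>s w. \<sigma> s w $ i) (\<lambda>s w. X s w $ i)) \<and>
     (\<exists>K. \<forall>i. \<forall>s\<in>{t..T}. sq_int M (\<lambda>w. X s w $ i) \<and> expectation (\<lambda>w. (X s w $ i)\<^sup>2) \<le> K)"

text \<open>The quadratic form is a double sum over pairs of components, and each entry of P is a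
  scalar primitive that can serve as the weight in \<open>weighted_ito_product\<close>.\<close>

lemma quadratic_moment:
  fixes P H :: "real \<Rightarrow> real^'n^'n"
  assumes X: "vec_ito_process t T x b \<sigma> X" and P: "continuous_on {t..T} P"
    and H: "integrable (lebesgue_on {t..T}) H"
    and PH: "\<And>s. s \<in> {t..T} \<Longrightarrow> P s = P T + integral\<^sup>L (lebesgue_on {s..T}) H"
    and A: "A \<in> sets (F t)"
  shows "integrable (PM t T) (\<lambda>(s, w). indicator A w * value_drift P H b \<sigma> X s w)"
    and "expectation (\<lambda>w. indicator A w * ((P T *v X T w) \<bullet> X T w)) =
       expectation (\<lambda>w. indicator A w * ((P t *v x) \<bullet> x)) +
       (\<integral>(s, w). indicator A w * value_drift P H b \<sigma> X s w \<partial>PM t T)"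
proof -
  from X obtain K where
    Xi: "\<And>i. ito_process t T (\<lambda>_. x $ i) (\<lambda>s w. b s w $ i) (\<lambda>s w. \<sigma> s w $ i) (\<lambda>s w. X s w $ i)"
    and K: "\<And>i s. s \<in> {t..T} \<Longrightarrow> sq_int M (\<lambda>w. X s w $ i) \<and> expectation (\<lambda>w. (X s w $ i)\<^sup>2) \<le> K"
    unfolding vec_ito_process_def by blast
  have t: "0 \<le> t" "t \<le> T" using Xi by (auto simp: ito_process_def)
  have AM[measurable]: "A \<in> sets M" using A subalg[OF t(1)] by (auto simp: subalgebra_def)
  let ?X = "\<lambda>i s w. indicator A w * X s w $ i :: real"
  have K1: "sq_int M (?X i s) \<and> expectation (\<lambda>w. (?X i s w)\<^sup>2) \<le> K" if s: "s \<in> {t..T}" for i s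
  proof
    note k = K[OF s, of i]
    show sq: "sq_int M (?X i s)"
      using k by (intro sq_int_bounded_mult[of _ _ _ 1]) (auto simp: indicator_def)
    have "expectation (\<lambda>w. (?X i s w)\<^sup>2) \<le> expectation (\<lambda>w. (X s w $ i)\<^sup>2)"
      using k sq by (intro integral_mono) (auto simp: sq_int_def indicator_def)
    then show "expectation (\<lambda>w. (?X i s w)\<^sup>2) \<le> K" using k by linarith
  qed
  \<comment> \<open>Only the j-th process is multiplied by the indicator, so that it occurs exactly
    once in each product.\<close>
  define k where "k i j s w = P s $ i $ j * ((indicator A w * b s w $ j) * X s w $ i + b s w $ i * ?X j s w
      + (indicator A w * \<sigma> s w $ j) * \<sigma> s w $ i) - H s $ i $ j * (?X j s w * X s w $ i)" for i j s w
  have kij: "integrable (PM t T) (\<lambda>(s, w). k i j s w) \<and>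
      P T $ i $ j * expectation (\<lambda>w. ?X j T w * X T w $ i) =
      P t $ i $ j * expectation (\<lambda>w. (indicator A w * x $ j) * x $ i) + (\<integral>(s, w). k i j s w \<partial>PM t T)" for i j
  proof -
    have bl: "bounded_linear (\<lambda>B::real^'n^'n. B $ i $ j)"
      by (rule bounded_linear_compose[OF bounded_linear_vec_nth bounded_linear_vec_nth])
    have h: "integrable (lebesgue_on {t..T}) (\<lambda>s. H s $ i $ j)"
      by (rule integrable_bounded_linear[OF bl H])
    have ph: "P s $ i $ j = P T $ i $ j + integral\<^sup>L (lebesgue_on {s..T}) (\<lambda>s. H s $ i $ j)" if s: "s \<in> {t..T}" for s
    proof -
      have "integrable (lebesgue_on {s..T}) H" by (rule integrable_lebesgue_on_subset[OF H]) (use s in auto)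
      from integral_bounded_linear[OF bl this] show ?thesis by (subst PH[OF s]) simp
    qed
    have p: "continuous_on {t..T} (\<lambda>s. P s $ i $ j)" by (intro continuous_intros P)
    from weighted_ito_product[OF ito_process_mult_indicator[OF Xi[of j] A] Xi[of i] K1 K p h ph]
    show ?thesis unfolding k_def by blast
  qed
  have "indicator A w * value_drift P H b \<sigma> X s w = (\<Sum>i\<in>UNIV. \<Sum>j\<in>UNIV. k i j s w)" for s w
    unfolding value_drift_def matrix_vector_inner_sum k_def
    by (simp add: sum_distrib_left sum_distrib_right distrib_left distrib_right right_diff_distrib
        sum.distrib sum_subtractf mult_ac del: sum_mult_indicator)
  then have vd: "(\<lambda>(s, w). indicator A w * value_drift P H b \<sigma> X s w) =
      (\<lambda>z. \<Sum>i\<in>UNIV. \<Sum>j\<in>UNIV. case z of (s, w) \<Rightarrow> k i j s w)" by (auto simp: fun_eq_iff)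
  show "integrable (PM t T) (\<lambda>(s, w). indicator A w * value_drift P H b \<sigma> X s w)"
    unfolding vd by (intro Bochner_Integration.integrable_sum) (use kij in blast)
  have iX: "integrable M (\<lambda>w. ?X j T w * X T w $ i)" for i j
    using K1[of T j] K[of T i] t by (intro sq_int_integrable_mult) auto
  have "expectation (\<lambda>w. indicator A w * ((P T *v X T w) \<bullet> X T w)) =
      expectation (\<lambda>w. \<Sum>i\<in>UNIV. \<Sum>j\<in>UNIV. P T $ i $ j * (?X j T w * X T w $ i))"
    unfolding matrix_vector_inner_sum by (simp only: sum_distrib_left mult_ac)
  also have "\<dots> = (\<Sum>i\<in>UNIV. \<Sum>j\<in>UNIV. P T $ i $ j * expectation (\<lambda>w. ?X j T w * X T w $ i))"
    using iX by (simp only: Bochner_Integration.integral_sum Bochner_Integration.integrable_sum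
        integrable_mult_right integral_mult_right_zero)
  also have "\<dots> = (\<Sum>i\<in>UNIV. \<Sum>j\<in>UNIV. P t $ i $ j * expectation (\<lambda>w. (indicator A w * x $ j) * x $ i)
      + (\<integral>(s, w). k i j s w \<partial>PM t T))"
    using kij by simp
  also have "\<dots> = (\<Sum>i\<in>UNIV. \<Sum>j\<in>UNIV. P t $ i $ j * expectation (\<lambda>w. (indicator A w * x $ j) * x $ i))
      + (\<Sum>i\<in>UNIV. \<Sum>j\<in>UNIV. (\<integral>(s, w). k i j s w \<partial>PM t T))"
    by (simp only: sum.distrib)
  also have "(\<Sum>i\<in>UNIV. \<Sum>j\<in>UNIV. P t $ i $ j * expectation (\<lambda>w. (indicator A w * x $ j) * x $ i)) =
      expectation (\<lambda>w. indicator A w * ((P t *v x) \<bullet> x))"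
  proof -
    have "expectation (\<lambda>w. indicator A w * c) = prob A * c" for c :: real by simp
    then show ?thesis
      by (simp only: mult.assoc) (simp only: matrix_vector_inner_sum sum_distrib_left mult_ac)
  qed
  also have "(\<Sum>i\<in>UNIV. \<Sum>j\<in>UNIV. (\<integral>(s, w). k i j s w \<partial>PM t T)) =
      (\<integral>(s, w). indicator A w * value_drift P H b \<sigma> X s w \<partial>PM t T)"
  proof -
    have "(\<integral>z. (\<Sum>i\<in>UNIV. \<Sum>j\<in>UNIV. case z of (s, w) \<Rightarrow> k i j s w) \<partial>PM t T) =
      (\<Sum>i\<in>UNIV. \<integral>z. (\<Sum>j\<in>UNIV. case z of (s, w) \<Rightarrow> k i j s w) \<partial>PM t T)"
      by (intro Bochner_Integration.integral_sum Bochner_Integration.integrable_sum) (use kij in blast)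
    also have "\<dots> = (\<Sum>i\<in>UNIV. \<Sum>j\<in>UNIV. (\<integral>(s, w). k i j s w \<partial>PM t T))"
      by (intro sum.cong refl Bochner_Integration.integral_sum) (use kij in blast)
    finally show ?thesis unfolding vd by simp
  qed
  finally show "expectation (\<lambda>w. indicator A w * ((P T *v X T w) \<bullet> X T w)) =
       expectation (\<lambda>w. indicator A w * ((P t *v x) \<bullet> x)) +
       (\<integral>(s, w). indicator A w * value_drift P H b \<sigma> X s w \<partial>PM t T)" .
qed

lemma sets_F_space: "0 \<le> t \<Longrightarrow> space M \<in> sets (F t)"
  using subalg[of t] by (metis sets.top subalgebra_def)

lemma quadratic_integrable:
  assumes "\<And>i. sq_int N (\<lambda>z. f z $ i)"
  shows "integrable N (\<lambda>z. (A *v f z) \<bullet> f z)"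
  unfolding matrix_vector_inner_sum mult.assoc
  by (intro Bochner_Integration.integrable_sum integrable_mult_right sq_int_integrable_mult assms)

text \<open>A constant is a version of the conditional expectation as soon as its integral over
  every A in \<open>F t\<close> is right, and \<open>quadratic_moment\<close> provides exactly this
  once Fubini has turned the integral over the product into an expectation of a path
  integral.\<close>

lemma conditional_value:
  fixes P H :: "real \<Rightarrow> real^'n^'n"
  assumes X: "vec_ito_process t T x b \<sigma> X" and P: "continuous_on {t..T} P"
    and H: "integrable (lebesgue_on {t..T}) H"
    and PH: "\<And>s. s \<in> {t..T} \<Longrightarrow> P s = P T + integral\<^sup>L (lebesgue_on {s..T}) H"
  shows "integrable (PM t T) (\<lambda>(s, w). value_drift P H b \<sigma> X s w)"
    and "integrable M (\<lambda>w. (P T *v X T w) \<bullet> X T w)"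
    and "AE w in M. real_cond_exp M (F t) (\<lambda>w. (P T *v X T w) \<bullet> X T w -
           (\<integral>s. value_drift P H b \<sigma> X s w \<partial>lebesgue_on {t..T})) w = (P t *v x) \<bullet> x"
proof -
  from X obtain K where
    Xi: "\<And>i. ito_process t T (\<lambda>_. x $ i) (\<lambda>s w. b s w $ i) (\<lambda>s w. \<sigma> s w $ i) (\<lambda>s w. X s w $ i)"
    and K: "\<And>i s. s \<in> {t..T} \<Longrightarrow> sq_int M (\<lambda>w. X s w $ i) \<and> expectation (\<lambda>w. (X s w $ i)\<^sup>2) \<le> K"
    unfolding vec_ito_process_def by blast
  have t: "0 \<le> t" "t \<le> T" using Xi by (auto simp: ito_process_def)
  interpret Q: pair_sigma_finite "lebesgue_on {t..T}" M by (rule PM_pair)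
  have sub: "subalgebra M (F t)" by (rule subalg[OF t(1)])
  interpret finite_measure_subalgebra M "F t"
    by unfold_locales (rule sub)
  \<comment> \<open>Taking A to be the whole space removes the indicator and gives integrability of
    the drift itself.\<close>
  have "integrable (PM t T) (\<lambda>(s, w). indicator (space M) w * value_drift P H b \<sigma> X s w)"
    by (rule quadratic_moment(1)[OF X P H PH sets_F_space[OF t(1)]])
  also have "?this \<longleftrightarrow> integrable (PM t T) (\<lambda>(s, w). value_drift P H b \<sigma> X s w)"
    by (intro Bochner_Integration.integrable_cong refl) (auto simp: space_pair_measure)
  finally show vi: "integrable (PM t T) (\<lambda>(s, w). value_drift P H b \<sigma> X s w)" .
  show qi: "integrable M (\<lambda>w. (P T *v X T w) \<bullet> X T w)"
    using K[of T] t by (intro quadratic_integrable) auto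
  have di: "integrable M (\<lambda>w. \<integral>s. value_drift P H b \<sigma> X s w \<partial>lebesgue_on {t..T})"
    by (rule Q.integrable_snd[OF vi])
  show "AE w in M. real_cond_exp M (F t) (\<lambda>w. (P T *v X T w) \<bullet> X T w -
           (\<integral>s. value_drift P H b \<sigma> X s w \<partial>lebesgue_on {t..T})) w = (P t *v x) \<bullet> x"
  proof (rule real_cond_exp_charact)
    fix A assume A: "A \<in> sets (F t)"
    then have AM: "A \<in> sets M" using sub by (auto simp: subalgebra_def)
    note qm = quadratic_moment[OF X P H PH A]
    have i1: "integrable M (\<lambda>w. indicator A w * ((P T *v X T w) \<bullet> X T w))"
      using integrable_mult_indicator[OF AM qi] by simp
    have "(\<integral>(s, w). indicator A w * value_drift P H b \<sigma> X s w \<partial>PM t T) =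
      expectation (\<lambda>w. \<integral>s. indicator A w * value_drift P H b \<sigma> X s w \<partial>lebesgue_on {t..T})"
      by (rule Q.integral_snd[OF qm(1), symmetric])
    also have "\<dots> = expectation (\<lambda>w. indicator A w * (\<integral>s. value_drift P H b \<sigma> X s w \<partial>lebesgue_on {t..T}))"
      by simp
    finally have e: "expectation (\<lambda>w. indicator A w * (\<integral>s. value_drift P H b \<sigma> X s w \<partial>lebesgue_on {t..T})) =
      expectation (\<lambda>w. indicator A w * ((P T *v X T w) \<bullet> X T w)) - expectation (\<lambda>w. indicator A w * ((P t *v x) \<bullet> x))"
      using qm(2) by simp
    have i2: "integrable M (\<lambda>w. indicator A w * (\<integral>s. value_drift P H b \<sigma> X s w \<partial>lebesgue_on {t..T}))"
      using integrable_mult_indicator[OF AM di] by simp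
    show "(\<integral>w\<in>A. ((P T *v X T w) \<bullet> X T w - (\<integral>s. value_drift P H b \<sigma> X s w \<partial>lebesgue_on {t..T})) \<partial>M) =
      (\<integral>w\<in>A. (P t *v x) \<bullet> x \<partial>M)"
      unfolding set_lebesgue_integral_def real_scaleR_def right_diff_distrib
        Bochner_Integration.integral_diff[OF i1 i2] e by simp
  qed (use qi di in auto)
qed

text \<open>On almost every path the terminal value minus the integrated drift is at most, or equal
  to, the total cost; conditional expectation preserves this, and \<open>conditional_value\<close>
  evaluates the left side. The exceptional times do not depend on w, so they are negligible in every
  path integral.\<close>

lemma
  fixes P H :: "real \<Rightarrow> real^'n^'n" and c :: "real \<Rightarrow> 'w \<Rightarrow> real"
  assumes X: "vec_ito_process t T x b \<sigma> X" and P: "continuous_on {t..T} P"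
    and H: "integrable (lebesgue_on {t..T}) H"
    and PH: "\<And>s. s \<in> {t..T} \<Longrightarrow> P s = P T + integral\<^sup>L (lebesgue_on {s..T}) H"
    and c: "integrable (PM t T) (\<lambda>(s, w). c s w)"
  shows conditional_cost_ge: "AE s in lebesgue_on {t..T}. \<forall>w\<in>space M. 0 \<le> c s w + value_drift P H b \<sigma> X s w \<Longrightarrow>
      AE w in M. (P t *v x) \<bullet> x \<le> real_cond_exp M (F t)
        (\<lambda>w. (\<integral>s. c s w \<partial>lebesgue_on {t..T}) + (P T *v X T w) \<bullet> X T w) w"
    and conditional_cost_eq: "AE s in lebesgue_on {t..T}. \<forall>w\<in>space M. 0 = c s w + value_drift P H b \<sigma> X s w \<Longrightarrow>
      AE w in M. real_cond_exp M (F t)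
        (\<lambda>w. (\<integral>s. c s w \<partial>lebesgue_on {t..T}) + (P T *v X T w) \<bullet> X T w) w = (P t *v x) \<bullet> x"
proof -
  have t: "0 \<le> t" "t \<le> T" using X by (auto simp: vec_ito_process_def ito_process_def)
  interpret Q: pair_sigma_finite "lebesgue_on {t..T}" M by (rule PM_pair)
  interpret finite_measure_subalgebra M "F t"
    by unfold_locales (rule subalg[OF t(1)])
  have cv: "integrable (PM t T) (\<lambda>(s, w). value_drift P H b \<sigma> X s w)"
    "integrable M (\<lambda>w. (P T *v X T w) \<bullet> X T w)"
    "AE w in M. real_cond_exp M (F t) (\<lambda>w. (P T *v X T w) \<bullet> X T w -
           (\<integral>s. value_drift P H b \<sigma> X s w \<partial>lebesgue_on {t..T})) w = (P t *v x) \<bullet> x"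
    by (rule conditional_value[OF X P H PH]; assumption)+
  let ?q = "\<lambda>w. (P T *v X T w) \<bullet> X T w" and ?c = "\<lambda>w. \<integral>s. c s w \<partial>lebesgue_on {t..T}"
    and ?v = "\<lambda>w. \<integral>s. value_drift P H b \<sigma> X s w \<partial>lebesgue_on {t..T}"
  have i: "integrable M ?c" "integrable M ?v"
    using Q.integrable_snd[OF c] Q.integrable_snd[OF cv(1)] by auto
  have ae: "AE w in M. integrable (lebesgue_on {t..T}) (\<lambda>s. c s w)"
    "AE w in M. integrable (lebesgue_on {t..T}) (\<lambda>s. value_drift P H b \<sigma> X s w)"
    using Q.AE_integrable_snd[OF c] Q.AE_integrable_snd[OF cv(1)] by auto
  have sum: "?c w + ?v w = (\<integral>s. c s w + value_drift P H b \<sigma> X s w \<partial>lebesgue_on {t..T})"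
    if "integrable (lebesgue_on {t..T}) (\<lambda>s. c s w)"
      "integrable (lebesgue_on {t..T}) (\<lambda>s. value_drift P H b \<sigma> X s w)" for w
    using that by simp
  {
    assume pos: "AE s in lebesgue_on {t..T}. \<forall>w\<in>space M. 0 \<le> c s w + value_drift P H b \<sigma> X s w"
    have "AE w in M. ?q w - ?v w \<le> ?c w + ?q w"
      using ae AE_space
    proof eventually_elim
      case (elim w)
      have "0 \<le> (\<integral>s. c s w + value_drift P H b \<sigma> X s w \<partial>lebesgue_on {t..T})"
        by (rule integral_nonneg_AE) (use pos elim(3) in \<open>auto elim: eventually_mono\<close>)
      with sum[OF elim(1,2)] show ?case by simp
    qed
    then have "AE w in M. real_cond_exp M (F t) (\<lambda>w. ?q w - ?v w) w \<le> real_cond_exp M (F t) (\<lambda>w. ?c w + ?q w) w"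
      by (rule real_cond_exp_mono) (use i cv(2) in auto)
    with cv(3) show "AE w in M. (P t *v x) \<bullet> x \<le> real_cond_exp M (F t) (\<lambda>w. ?c w + ?q w) w"
      by eventually_elim simp
  next
    assume zero: "AE s in lebesgue_on {t..T}. \<forall>w\<in>space M. 0 = c s w + value_drift P H b \<sigma> X s w"
    have "AE w in M. ?c w + ?q w = ?q w - ?v w"
      using ae AE_space
    proof eventually_elim
      case (elim w)
      have "(\<integral>s. c s w + value_drift P H b \<sigma> X s w \<partial>lebesgue_on {t..T}) = 0"
        by (rule integral_eq_zero_AE) (use zero elim(3) in \<open>auto elim: eventually_mono\<close>)
      with sum[OF elim(1,2)] show ?case by simp
    qed
    then have "AE w in M. real_cond_exp M (F t) (\<lambda>w. ?c w + ?q w) w = real_cond_exp M (F t) (\<lambda>w. ?q w - ?v w) w"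
      by (rule real_cond_exp_cong) (use i cv(2) in auto)
    with cv(3) show "AE w in M. real_cond_exp M (F t) (\<lambda>w. ?c w + ?q w) w = (P t *v x) \<bullet> x"
      by eventually_elim simp
  }
qed

end

section \<open>Essentially bounded matrix functions\<close>

lemma borel_measurable_matrix_iff:
  "(f :: 'a \<Rightarrow> real^'n^'m) \<in> borel_measurable N \<longleftrightarrow> (\<forall>i j. (\<lambda>x. f x $ i $ j) \<in> borel_measurable N)"
proof
  assume f: "f \<in> borel_measurable N"
  show "\<forall>i j. (\<lambda>x. f x $ i $ j) \<in> borel_measurable N"
    by (intro allI borel_measurable_continuous_on[OF _ f]) (intro continuous_intros)
next
  assume *: "\<forall>i j. (\<lambda>x. f x $ i $ j) \<in> borel_measurable N"
  have "(\<lambda>x. f x \<bullet> b) \<in> borel_measurable N" if "b \<in> Basis" for b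
  proof -
    from that obtain i j where "b = axis i (axis j 1)" by (auto simp: Basis_vec_def)
    then show ?thesis using * by (simp add: inner_axis)
  qed
  then show "f \<in> borel_measurable N" by (subst borel_measurable_euclidean_space) blast
qed

lemma borel_measurable_det:
  fixes f :: "'a \<Rightarrow> real^'n^'n"
  assumes "\<And>i j. (\<lambda>x. f x $ i $ j) \<in> borel_measurable N"
  shows "(\<lambda>x. det (f x)) \<in> borel_measurable N"
  unfolding det_def by (intro borel_measurable_sum borel_measurable_times borel_measurable_prod assms) simp

text \<open>Coercivity holds only at almost every time, so the family may contain singular matrices.
  Where it is regular, Cramer's rule writes an entry of the inverse as a quotient of determinants,
  \<open>D\<close> being the matrix with its i-th column replaced by the k-th unit vector.\<close>

lemma borel_measurable_matrix_inv:
  fixes f :: "'a \<Rightarrow> real^'n^'n"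
  assumes f: "f \<in> borel_measurable N"
  shows "(\<lambda>x. matrix_inv (f x)) \<in> borel_measurable N"
  unfolding borel_measurable_matrix_iff
proof (intro allI)
  fix i k :: 'n
  have c: "(\<lambda>x. f x $ a $ b) \<in> borel_measurable N" for a b
    using f by (simp add: borel_measurable_matrix_iff)
  define D where "D x = (\<chi> a b. if b = i then axis k 1 $ a else f x $ a $ b)" for x
  have D: "(\<lambda>x. det (D x)) \<in> borel_measurable N" and d[measurable]: "(\<lambda>x. det (f x)) \<in> borel_measurable N"
    using c by (auto intro!: borel_measurable_det simp: D_def)
  have "matrix_inv (f x) $ i $ k =
      (if det (f x) \<noteq> 0 then det (D x) / det (f x) else (SOME B::real^'n^'n. False) $ i $ k)" for x
  proof (cases "det (f x) = 0")
    \<comment> \<open>on singular matrices \<open>matrix_inv\<close> is the fixed junk value \<open>SOME B. False\<close>\<close>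
    case True
    then have "(\<lambda>B. f x ** B = mat 1 \<and> B ** f x = mat 1) = (\<lambda>B. False)"
      using invertible_det_nz[of "f x"] unfolding invertible_def by blast
    then show ?thesis using True by (simp only: matrix_inv_def) simp
  next
    case False
    then have "invertible (f x)" by (simp add: invertible_det_nz)
    then have "f x ** matrix_inv (f x) = mat 1"
      unfolding invertible_def matrix_inv_def by (rule someI2_ex) simp
    then have "f x *v (matrix_inv (f x) *v axis k 1) = axis k 1"
      by (simp add: matrix_vector_mul_assoc)
    from iffD1[OF cramer[OF False] this] have "(matrix_inv (f x) *v axis k 1) $ i = det (D x) / det (f x)"
      by (simp add: D_def)
    then show ?thesis using False by (simp add: matrix_vector_mul_component inner_axis)
  qed
  moreover have "(\<lambda>x. if det (f x) \<noteq> 0 then det (D x) / det (f x) else (SOME B::real^'n^'n. False) $ i $ k)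
      \<in> borel_measurable N"
    using D by measurable
  ultimately show "(\<lambda>x. matrix_inv (f x) $ i $ k) \<in> borel_measurable N" by simp
qed

lemma matrix_inv_inverse:
  fixes A :: "real^'n^'n"
  assumes "invertible A"
  shows "A ** matrix_inv A = mat 1" "matrix_inv A ** A = mat 1"
  using assms unfolding invertible_def matrix_inv_def
  by (rule someI2_ex, simp)+

lemma coercive_invertible:
  fixes A :: "real^'n^'n"
  assumes "\<delta> > 0" "\<And>x. \<delta> * (x \<bullet> x) \<le> (A *v x) \<bullet> x"
  shows "invertible A"
proof -
  have "x = 0" if "A *v x = 0" for x
    using assms(2)[of x] assms(1) that inner_ge_zero[of x] by (auto simp: mult_le_0_iff order.antisym)
  then have "\<exists>B. B ** A = mat 1" using matrix_left_invertible_ker by blast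
  then show ?thesis by (simp add: invertible_left_inverse)
qed

text \<open>Coercivity and Cauchy-Schwarz bound the inverse of A, as an operator, by 1 / \<delta>,
  hence also its entries. The norm of a matrix is the Euclidean norm of its entries; crude summation
  over rows and columns costs the two factors \<open>CARD('n)\<close>.\<close>

lemma norm_matrix_inv_coercive:
  fixes A :: "real^'n^'n"
  assumes \<delta>: "\<delta> > 0" and c: "\<And>x. \<delta> * (x \<bullet> x) \<le> (A *v x) \<bullet> x"
  shows "norm (matrix_inv A) \<le> real CARD('n) * (real CARD('n) / \<delta>)"
proof -
  have inv: "A ** matrix_inv A = mat 1" by (rule matrix_inv_inverse[OF coercive_invertible[OF \<delta> c]])
  have b: "norm (matrix_inv A *v y) \<le> norm y / \<delta>" for y
  proof -
    define x where "x = matrix_inv A *v y"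
    have "A *v x = y" by (simp add: x_def matrix_vector_mul_assoc inv)
    with c[of x] have "\<delta> * (norm x * norm x) \<le> norm y * norm x"
      using norm_cauchy_schwarz[of y x] by (simp add: dot_square_norm power2_eq_square)
    then have "\<delta> * norm x \<le> norm y" by (cases "x = 0") (auto simp: mult.assoc[symmetric])
    then show ?thesis using \<delta> by (simp add: x_def pos_le_divide_eq mult.commute)
  qed
  have e: "\<bar>matrix_inv A $ i $ j\<bar> \<le> 1 / \<delta>" for i j
  proof -
    have "matrix_inv A $ i $ j = (matrix_inv A *v axis j 1) $ i"
      by (simp add: matrix_vector_mul_component inner_axis)
    then have "\<bar>matrix_inv A $ i $ j\<bar> \<le> norm (matrix_inv A *v axis j 1)"
      using component_le_norm_cart by metis
    also have "\<dots> \<le> 1 / \<delta>" using b[of "axis j 1"] by simp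
    finally show ?thesis .
  qed
  have r: "norm (matrix_inv A $ i) \<le> real CARD('n) / \<delta>" for i
  proof -
    have "norm (matrix_inv A $ i) \<le> (\<Sum>j\<in>UNIV. \<bar>matrix_inv A $ i $ j\<bar>)" by (rule norm_le_l1_cart)
    also have "\<dots> \<le> (\<Sum>j\<in>(UNIV::'n set). 1 / \<delta>)" by (intro sum_mono e)
    finally show ?thesis by simp
  qed
  have "norm (matrix_inv A) \<le> (\<Sum>i\<in>UNIV. norm (matrix_inv A $ i))"
    unfolding norm_vec_def by (rule L2_set_le_sum) simp
  also have "\<dots> \<le> (\<Sum>i\<in>(UNIV::'n set). real CARD('n) / \<delta>)" by (intro sum_mono r)
  finally show ?thesis by simp
qed

lemma Linf_bilinear:
  fixes h :: "'a::euclidean_space \<Rightarrow> 'b::euclidean_space \<Rightarrow> 'c::euclidean_space"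
  assumes h: "bounded_bilinear h" and f: "Linf T f" and g: "Linf T g"
  shows "Linf T (\<lambda>s. h (f s) (g s))"
  unfolding Linf_def
proof
  interpret bounded_bilinear h by fact
  have m: "f \<in> borel_measurable (lebesgue_on {0..T})" "g \<in> borel_measurable (lebesgue_on {0..T})"
    using f g by (auto simp: Linf_def)
  show "(\<lambda>s. h (f s) (g s)) \<in> borel_measurable (lebesgue_on {0..T})"
    by (rule borel_measurable_continuous_Pair[OF m]) (intro continuous_on continuous_intros)
  obtain K where K: "AE s in lebesgue_on {0..T}. norm (f s) \<le> K" using f by (auto simp: Linf_def)
  obtain L where L: "AE s in lebesgue_on {0..T}. norm (g s) \<le> L" using g by (auto simp: Linf_def)
  obtain B where B: "\<And>a b. norm (h a b) \<le> norm a * norm b * B" "B \<ge> 0" using nonneg_bounded by auto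
  have "AE s in lebesgue_on {0..T}. norm (h (f s) (g s)) \<le> K * L * B"
    using K L
  proof eventually_elim
    case (elim s)
    have "norm (h (f s) (g s)) \<le> norm (f s) * norm (g s) * B" by (rule B)
    also have "\<dots> \<le> K * L * B"
      using elim B(2) by (intro mult_right_mono mult_mono order_trans[OF norm_ge_zero elim(1)]) auto
    finally show ?case .
  qed
  then show "\<exists>K. AE s in lebesgue_on {0..T}. norm (h (f s) (g s)) \<le> K" by blast
qed

lemma Linf_add:
  assumes f: "Linf T f" and g: "Linf T g"
  shows "Linf T (\<lambda>s. f s + g s)"
proof -
  obtain K where K: "AE s in lebesgue_on {0..T}. norm (f s) \<le> K" using f by (auto simp: Linf_def)
  obtain L where L: "AE s in lebesgue_on {0..T}. norm (g s) \<le> L" using g by (auto simp: Linf_def)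
  have "AE s in lebesgue_on {0..T}. norm (f s + g s) \<le> K + L"
    using K L by eventually_elim (meson norm_triangle_mono)
  then show ?thesis using f g by (auto simp: Linf_def)
qed

lemma Linf_uminus: "Linf T f \<Longrightarrow> Linf T (\<lambda>s. - f s)"
  by (auto simp: Linf_def)

lemma Linf_diff: "Linf T f \<Longrightarrow> Linf T g \<Longrightarrow> Linf T (\<lambda>s. f s - g s)"
  using Linf_add[of T f "\<lambda>s. - g s"] Linf_uminus[of T g] by simp

lemma bounded_bilinear_matrix_mult:
  "bounded_bilinear ((**) :: real^'b^'a \<Rightarrow> real^'c^'b \<Rightarrow> real^'c^'a)"
proof -
  have "bilinear ((**) :: real^'b^'a \<Rightarrow> real^'c^'b \<Rightarrow> real^'c^'a)"
    unfolding bilinear_def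
    by (auto intro!: linearI simp: matrix_matrix_mult_def vec_eq_iff sum.distrib distrib_left distrib_right
        sum_distrib_left mult_ac)
  then show ?thesis by (simp add: bilinear_conv_bounded_bilinear)
qed

lemma Linf_matrix_mult:
  fixes f :: "real \<Rightarrow> real^'b^'a" and g :: "real \<Rightarrow> real^'c^'b"
  shows "Linf T f \<Longrightarrow> Linf T g \<Longrightarrow> Linf T (\<lambda>s. f s ** g s)"
  by (rule Linf_bilinear[OF bounded_bilinear_matrix_mult])

lemma Linf_transpose:
  fixes f :: "real \<Rightarrow> real^'b^'a"
  assumes "Linf T f"
  shows "Linf T (\<lambda>s. transpose (f s))"
proof -
  have "linear (transpose :: real^'b^'a \<Rightarrow> real^'a^'b)"
    by (rule linearI) (simp_all add: transpose_def vec_eq_iff)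
  then have l: "bounded_linear (transpose :: real^'b^'a \<Rightarrow> real^'a^'b)"
    by (simp add: linear_conv_bounded_linear)
  then obtain B where B: "\<And>x::real^'b^'a. norm (transpose x) \<le> norm x * B" "B \<ge> 0"
    using bounded_linear.nonneg_bounded by blast
  obtain K where K: "AE s in lebesgue_on {0..T}. norm (f s) \<le> K" using assms by (auto simp: Linf_def)
  have "AE s in lebesgue_on {0..T}. norm (transpose (f s)) \<le> K * B"
    using K by eventually_elim (meson B mult_right_mono order_trans)
  moreover have "(\<lambda>s. transpose (f s)) \<in> borel_measurable (lebesgue_on {0..T})"
    using assms by (auto simp: Linf_def borel_measurable_matrix_iff transpose_def)
  ultimately show ?thesis by (auto simp: Linf_def)
qed

lemma Linf_continuous:
  assumes f: "continuous_on {0..T} f"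
  shows "Linf T f"
proof -
  have "bounded (f ` {0..T})" by (intro compact_imp_bounded compact_continuous_image f) simp
  then obtain K where "\<forall>x\<in>f ` {0..T}. norm x \<le> K" unfolding bounded_iff ..
  then have "AE s in lebesgue_on {0..T}. norm (f s) \<le> K" by (intro AE_I2) simp
  moreover have "f \<in> borel_measurable (lebesgue_on {0..T})"
    by (rule continuous_imp_measurable_on_sets_lebesgue[OF f]) simp
  ultimately show ?thesis by (auto simp: Linf_def)
qed

lemma Linf_matrix_inv:
  fixes f :: "real \<Rightarrow> real^'n^'n"
  assumes f: "Linf T f" and \<delta>: "\<delta> > 0"
    and c: "AE s in lebesgue_on {0..T}. \<forall>x. \<delta> * (x \<bullet> x) \<le> (f s *v x) \<bullet> x"
  shows "Linf T (\<lambda>s. matrix_inv (f s))"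
  unfolding Linf_def
proof
  show "(\<lambda>s. matrix_inv (f s)) \<in> borel_measurable (lebesgue_on {0..T})"
    using f by (intro borel_measurable_matrix_inv) (simp add: Linf_def)
  have "AE s in lebesgue_on {0..T}. norm (matrix_inv (f s)) \<le> real CARD('n) * (real CARD('n) / \<delta>)"
    using c by eventually_elim (use norm_matrix_inv_coercive[OF \<delta>] in blast)
  then show "\<exists>K. AE s in lebesgue_on {0..T}. norm (matrix_inv (f s)) \<le> K" by blast
qed

text \<open>The constant at time s is a multiple of \<open>norm (f s)\<close>, hence available at
  every time and essentially bounded: the exact shape required by the strategy classes.\<close>

lemma Linf_lipschitz_bound:
  fixes f :: "real \<Rightarrow> real^'a^'b"
  assumes "Linf T f"
  shows "\<exists>L K. (\<forall>s\<in>{0..T}. (L s)-lipschitz_on UNIV ((*v) (f s))) \<and> (AE s in lebesgue_on {0..T}. L s \<le> K)"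
proof -
  have "bilinear ((*v) :: real^'a^'b \<Rightarrow> real^'a \<Rightarrow> real^'b)"
    unfolding bilinear_def
    by (auto intro!: linearI simp: matrix_vector_mult_def vec_eq_iff sum.distrib distrib_left distrib_right
        sum_distrib_left mult_ac)
  then obtain B where B: "B > 0" "\<And>(A::real^'a^'b) x. norm (A *v x) \<le> B * norm A * norm x"
    using bilinear_bounded_pos by blast
  obtain K where K: "AE s in lebesgue_on {0..T}. norm (f s) \<le> K" using assms by (auto simp: Linf_def)
  show ?thesis
  proof (intro exI conjI ballI)
    show "(B * norm (f s))-lipschitz_on UNIV ((*v) (f s))" for s
    proof (rule lipschitz_onI)
      show "dist (f s *v x) (f s *v y) \<le> B * norm (f s) * dist x y" for x y
        using B(2)[of "f s" "x - y"] by (simp add: dist_norm matrix_vector_mult_diff_distrib)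
    qed (use B(1) in simp)
    show "AE s in lebesgue_on {0..T}. B * norm (f s) \<le> B * K"
      using K by eventually_elim (use B(1) in simp)
  qed
qed

lemma borel_measurable_matrix_vector:
  fixes f :: "'s \<Rightarrow> real^'a^'b" and x :: "'s \<Rightarrow> real^'a"
  assumes "f \<in> borel_measurable N" "x \<in> borel_measurable N"
  shows "(\<lambda>s. f s *v x s) \<in> borel_measurable N"
  by (rule borel_measurable_continuous_Pair[OF assms])
     (simp add: matrix_vector_mult_def, intro continuous_intros)

section \<open>The state process\<close>

context adapted_bm
begin

text \<open>By continuity of the paths, X is the limit of its values at the grid points floor(s
  (n+1)) / (n+1). Each approximation uses countably many times, so it is measurable piece by
  piece.\<close>

lemma continuous_paths_jointly_measurable:
  fixes X :: "real \<Rightarrow> 'w \<Rightarrow> 'a::euclidean_space"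
  assumes X: "\<And>s. s \<in> {t..T} \<Longrightarrow> X s \<in> borel_measurable M"
    and cont: "\<And>\<omega>. \<omega> \<in> space M \<Longrightarrow> continuous_on {t..T} (\<lambda>s. X s \<omega>)" and t: "t \<le> T"
  shows "(\<lambda>z. X (fst z) (snd z)) \<in> borel_measurable (PM t T)"
proof -
  \<comment> \<open>The grid point below s may lie before t, so it is clamped into [t,T], where X is
    known to be measurable and continuous. \<open>Suc n\<close> avoids division by 0.\<close>
  define G where "G n (s::real) = max t (min T (real_of_int \<lfloor>s * real (Suc n)\<rfloor> / real (Suc n)))" for n s
  show ?thesis
  proof (rule borel_measurable_LIMSEQ_metric)
    fix n
    have "(\<lambda>z. X (max t (min T (real_of_int i / real (Suc n)))) (snd z)) \<in> borel_measurable (PM t T)" for i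
    proof -
      have "max t (min T (real_of_int i / real (Suc n))) \<in> {t..T}" using t by auto
      from measurable_compose[OF measurable_snd X[OF this]] show ?thesis .
    qed
    moreover have "(\<lambda>z. \<lfloor>fst z * real (Suc n)\<rfloor>) \<in> PM t T \<rightarrow>\<^sub>M count_space UNIV"
    proof -
      have [measurable]: "fst \<in> borel_measurable (PM t T)"
        using measurable_compose[OF measurable_fst id_borel_measurable_lebesgue_on] by auto
      show ?thesis by measurable
    qed
    ultimately show "(\<lambda>z. X (G n (fst z)) (snd z)) \<in> borel_measurable (PM t T)"
      unfolding G_def by (rule measurable_compose_countable)
  next
    fix z assume z: "z \<in> space (PM t T)"
    then have s: "fst z \<in> {t..T}" and w: "snd z \<in> space M" by (auto simp: space_pair_measure)
    let ?s = "fst z"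
    have "(\<lambda>n. real_of_int \<lfloor>?s * real (Suc n)\<rfloor> / real (Suc n)) \<longlonglongrightarrow> ?s"
    proof (rule tendsto_sandwich[where f = "\<lambda>n. ?s - 1 / real (Suc n)" and h = "\<lambda>_. ?s"])
      show "\<forall>\<^sub>F n in sequentially. ?s - 1 / real (Suc n) \<le> real_of_int \<lfloor>?s * real (Suc n)\<rfloor> / real (Suc n)"
      proof (intro always_eventually allI)
        fix n
        have "?s * real (Suc n) - 1 \<le> real_of_int \<lfloor>?s * real (Suc n)\<rfloor>" by linarith
        then have "(?s * real (Suc n) - 1) / real (Suc n) \<le> real_of_int \<lfloor>?s * real (Suc n)\<rfloor> / real (Suc n)"
          by (intro divide_right_mono) auto
        then show "?s - 1 / real (Suc n) \<le> real_of_int \<lfloor>?s * real (Suc n)\<rfloor> / real (Suc n)"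
          by (simp add: diff_divide_distrib)
      qed
      show "\<forall>\<^sub>F n in sequentially. real_of_int \<lfloor>?s * real (Suc n)\<rfloor> / real (Suc n) \<le> ?s"
      proof (intro always_eventually allI)
        fix n
        have "real_of_int \<lfloor>?s * real (Suc n)\<rfloor> / real (Suc n) \<le> (?s * real (Suc n)) / real (Suc n)"
          by (intro divide_right_mono of_int_floor_le) auto
        then show "real_of_int \<lfloor>?s * real (Suc n)\<rfloor> / real (Suc n) \<le> ?s" by simp
      qed
      show "(\<lambda>n. ?s - 1 / real (Suc n)) \<longlonglongrightarrow> ?s"
        using tendsto_diff[OF tendsto_const LIMSEQ_inverse_real_of_nat, of ?s] by (simp add: inverse_eq_divide)
    qed simp
    then have "(\<lambda>n. G n ?s) \<longlonglongrightarrow> max t (min T ?s)"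
      unfolding G_def by (intro tendsto_max tendsto_min tendsto_const)
    then have "(\<lambda>n. G n ?s) \<longlonglongrightarrow> ?s" using s by simp
    then show "(\<lambda>n. X (G n ?s) (snd z)) \<longlonglongrightarrow> X ?s (snd z)"
      by (rule continuous_on_tendsto_compose[OF cont[OF w] _ s])
         (use t in \<open>simp add: G_def\<close>)
  qed
qed

lemma borel_measurable_component:
  fixes f :: "'s \<Rightarrow> real^'d"
  assumes "f \<in> borel_measurable N"
  shows "(\<lambda>x. f x $ i) \<in> borel_measurable N"
  using assms by (rule borel_measurable_continuous_on[rotated]) (intro continuous_intros)

lemma ennreal_power2_component_le: "ennreal (((v::real^'d) $ i)\<^sup>2) \<le> ennreal ((norm v)\<^sup>2)"
proof -
  have "\<bar>v $ i\<bar>\<^sup>2 \<le> (norm v)\<^sup>2" by (intro power_mono component_le_norm_cart) simp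
  then show ?thesis by (intro ennreal_leI) simp
qed

lemma L2_process_component:
  fixes \<phi> :: "real \<Rightarrow> 'w \<Rightarrow> real^'d"
  assumes "L2_process M a b \<phi>"
  shows "sq_int (PM a b) (\<lambda>z. \<phi> (fst z) (snd z) $ i)"
  unfolding sq_int_iff_nn_integral
proof
  show "(\<lambda>z. \<phi> (fst z) (snd z) $ i) \<in> borel_measurable (PM a b)"
    using assms by (intro borel_measurable_component) (simp add: L2_process_def case_prod_unfold)
  have "(\<integral>\<^sup>+ z. ennreal ((\<phi> (fst z) (snd z) $ i)\<^sup>2) \<partial>PM a b) \<le>
      (\<integral>\<^sup>+ z. ennreal ((norm (\<phi> (fst z) (snd z)))\<^sup>2) \<partial>PM a b)"
    by (intro nn_integral_mono ennreal_power2_component_le)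
  also have "\<dots> < \<infinity>" using assms by (simp add: L2_process_def case_prod_unfold)
  finally show "(\<integral>\<^sup>+ z. ennreal ((\<phi> (fst z) (snd z) $ i)\<^sup>2) \<partial>PM a b) < \<infinity>" .
qed

lemma AE_lebesgue_on_subset:
  assumes "AE s in lebesgue_on {a..b::real}. P s" "{c..d} \<subseteq> {a..b}"
  shows "AE s in lebesgue_on {c..d}. P s"
proof -
  have "AE s in lebesgue. s \<in> {a..b} \<longrightarrow> P s"
    using assms(1) by (subst (asm) AE_restrict_space_iff) auto
  then have "AE s in lebesgue. s \<in> {c..d} \<longrightarrow> P s" using assms(2) by (auto elim: eventually_mono)
  then show ?thesis by (subst AE_restrict_space_iff) auto
qed

lemma sq_int_Linf_matrix_vector:
  fixes A :: "real \<Rightarrow> real^'a^'b" and f :: "real \<times> 'w \<Rightarrow> real^'a"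
  assumes A: "Linf T A" and f: "\<And>j. sq_int (PM t T) (\<lambda>z. f z $ j)" and t: "0 \<le> t"
  shows "sq_int (PM t T) (\<lambda>z. (A (fst z) *v f z) $ i)"
proof -
  interpret Q: pair_sigma_finite "lebesgue_on {t..T}" M by (rule PM_pair)
  obtain K where K: "AE s in lebesgue_on {0..T}. norm (A s) \<le> K" using A by (auto simp: Linf_def)
  have K': "AE s in lebesgue_on {t..T}. norm (A s) \<le> K"
    by (rule AE_lebesgue_on_subset[OF K]) (use t in auto)
  have "A \<in> borel_measurable (lebesgue_on {0..T})" using A by (simp add: Linf_def)
  moreover have "{t..T} \<subseteq> {0..T}" using t by simp
  ultimately have "A \<in> borel_measurable (lebesgue_on {t..T})"
    by (rule measurable_compose[OF id_measurable_lebesgue_on_subset, rotated])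
  then have Am: "(\<lambda>z. A (fst z)) \<in> borel_measurable (PM t T)"
    by (rule measurable_compose[OF measurable_fst])
  have "AE z in PM t T. norm (A (fst z)) \<le> K"
  proof (rule Q.AE_pair_measure)
    show "{z \<in> space (PM t T). norm (A (fst z)) \<le> K} \<in> sets (PM t T)"
      by (intro borel_measurable_le measurable_compose[OF Am borel_measurable_norm] borel_measurable_const)
    show "AE x in lebesgue_on {t..T}. AE y in M. norm (A (fst (x, y))) \<le> K"
      using K' by eventually_elim simp
  qed
  then have b: "AE z in PM t T. \<bar>A (fst z) $ i $ j\<bar> \<le> K" for j
  proof eventually_elim
    case (elim z)
    have "\<bar>A (fst z) $ i $ j\<bar> \<le> norm (A (fst z) $ i)" by (rule component_le_norm_cart)
    also have "\<dots> \<le> norm (A (fst z))" by (rule Finite_Cartesian_Product.norm_nth_le)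
    finally show ?case using elim by simp
  qed
  have "sq_int (PM t T) (\<lambda>z. \<Sum>j\<in>UNIV. A (fst z) $ i $ j * f z $ j)"
    using Am by (intro sq_int_sum sq_int_bounded_mult[OF f _ b]) (simp add: borel_measurable_matrix_iff)
  then show ?thesis by (simp add: matrix_vector_mult_def)
qed

lemma integrable_Linf_quadratic:
  fixes A :: "real \<Rightarrow> real^'a^'a" and f :: "real \<times> 'w \<Rightarrow> real^'a"
  assumes A: "Linf T A" and f: "\<And>j. sq_int (PM t T) (\<lambda>z. f z $ j)" and t: "0 \<le> t"
  shows "integrable (PM t T) (\<lambda>z. (A (fst z) *v f z) \<bullet> f z)"
  unfolding inner_vec_def inner_real_def
  by (intro Bochner_Integration.integrable_sum sq_int_integrable_mult sq_int_Linf_matrix_vector A f t)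

lemma integrable_component:
  fixes f :: "'s \<Rightarrow> real^'d"
  assumes "\<And>i. integrable N (\<lambda>x. f x $ i)"
  shows "integrable N f"
proof -
  have "integrable N (\<lambda>x. \<Sum>i\<in>UNIV. (f x $ i) *\<^sub>R axis i (1::real))"
    by (intro Bochner_Integration.integrable_sum integrable_scaleR_left assms)
  moreover have "(\<Sum>i\<in>UNIV. (v $ i) *\<^sub>R axis i (1::real)) = v" for v :: "real^'d"
    using basis_expansion[of v] by (simp add: scalar_mult_eq_scaleR)
  ultimately show ?thesis by simp
qed

text \<open>The expectation of the supremum dominates every single second moment, which gives a
  bound uniform in time; over a finite interval this also gives square integrability on the
  product.\<close>

lemma
  fixes X :: "real \<Rightarrow> 'w \<Rightarrow> real^'d"
  assumes t: "0 \<le> t" "t \<le> T"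
    and X: "\<And>s. s \<in> {t..T} \<Longrightarrow> X s \<in> borel_measurable (F s)"
      "\<And>\<omega>. \<omega> \<in> space M \<Longrightarrow> continuous_on {t..T} (\<lambda>s. X s \<omega>)"
      "(\<integral>\<^sup>+ \<omega>. (SUP s\<in>{t..T}. ennreal ((norm (X s \<omega>))\<^sup>2)) \<partial>M) < \<infinity>"
  shows sup_sq_bounded: "\<exists>K. \<forall>i. \<forall>s\<in>{t..T}. sq_int M (\<lambda>\<omega>. X s \<omega> $ i) \<and> expectation (\<lambda>\<omega>. (X s \<omega> $ i)\<^sup>2) \<le> K"
    and sup_sq_int_PM: "sq_int (PM t T) (\<lambda>z. X (fst z) (snd z) $ i)"
proof -
  define K where "K = (\<integral>\<^sup>+ \<omega>. (SUP s\<in>{t..T}. ennreal ((norm (X s \<omega>))\<^sup>2)) \<partial>M)"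
  have XM: "X s \<in> borel_measurable M" if "s \<in> {t..T}" for s
    using adapted_measurable[of s] X(1)[OF that] that t by (auto simp: measurable_def)
  have Xm: "(\<lambda>z. X (fst z) (snd z)) \<in> borel_measurable (PM t T)"
    by (rule continuous_paths_jointly_measurable[OF XM X(2) t(2)])
  have le: "(\<integral>\<^sup>+ \<omega>. ennreal ((X s \<omega> $ i)\<^sup>2) \<partial>M) \<le> K" if "s \<in> {t..T}" for s i
    unfolding K_def
    by (intro nn_integral_mono order_trans[OF ennreal_power2_component_le] SUP_upper that)
  have K: "K < \<infinity>" using X(3) by (simp add: K_def)
  have sqX: "sq_int M (\<lambda>\<omega>. X s \<omega> $ i)" if "s \<in> {t..T}" for s i
    using le_less_trans[OF le[OF that] K] borel_measurable_component[OF XM[OF that]]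
    by (simp add: sq_int_iff_nn_integral)
  have EX: "expectation (\<lambda>\<omega>. (X s \<omega> $ i)\<^sup>2) \<le> enn2real K" if "s \<in> {t..T}" for s i
  proof -
    have "expectation (\<lambda>\<omega>. (X s \<omega> $ i)\<^sup>2) = enn2real (\<integral>\<^sup>+ \<omega>. ennreal ((X s \<omega> $ i)\<^sup>2) \<partial>M)"
      using sqX[OF that] by (intro integral_eq_nn_integral) (auto simp: sq_int_def)
    also have "\<dots> \<le> enn2real K" by (rule enn2real_mono[OF le[OF that]]) (use K in simp)
    finally show ?thesis .
  qed
  show "sq_int (PM t T) (\<lambda>z. X (fst z) (snd z) $ i)"
    unfolding sq_int_iff_nn_integral
  proof
    show m: "(\<lambda>z. X (fst z) (snd z) $ i) \<in> borel_measurable (PM t T)"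
      by (rule borel_measurable_component[OF Xm])
    interpret L: finite_measure "lebesgue_on {t..T}" by (rule finite_measure_lebesgue_on_Icc)
    have "(\<integral>\<^sup>+z. ennreal ((X (fst z) (snd z) $ i)\<^sup>2) \<partial>PM t T) =
        (\<integral>\<^sup>+s. (\<integral>\<^sup>+\<omega>. ennreal ((X s \<omega> $ i)\<^sup>2) \<partial>M) \<partial>lebesgue_on {t..T})"
      by (subst nn_integral_fst[symmetric]) (use m in auto)
    also have "\<dots> \<le> (\<integral>\<^sup>+s. K \<partial>lebesgue_on {t..T})" by (intro nn_integral_mono le) simp
    also have "\<dots> = K * emeasure (lebesgue_on {t..T}) {t..T}" by simp
    also have "\<dots> < \<infinity>" using K L.emeasure_finite[of "{t..T}"]
      by (auto simp: ennreal_mult_eq_top_iff less_top[symmetric])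
    finally show "(\<integral>\<^sup>+z. ennreal ((X (fst z) (snd z) $ i)\<^sup>2) \<partial>PM t T) < \<infinity>" .
  qed
  show "\<exists>K. \<forall>i. \<forall>s\<in>{t..T}. sq_int M (\<lambda>\<omega>. X s \<omega> $ i) \<and> expectation (\<lambda>\<omega>. (X s \<omega> $ i)\<^sup>2) \<le> K"
    using sqX EX by blast
qed

lemma vec_ito_processI:
  fixes b \<sigma> X :: "real \<Rightarrow> 'w \<Rightarrow> real^'d"
  assumes t: "0 \<le> t" "t \<le> T"
    and b: "\<And>i. sq_int (PM t T) (\<lambda>z. b (fst z) (snd z) $ i)" "\<And>s. s \<in> {t..T} \<Longrightarrow> b s \<in> borel_measurable (F s)"
    and X: "\<And>s. s \<in> {t..T} \<Longrightarrow> X s \<in> borel_measurable (F s)"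
      "\<And>\<omega>. \<omega> \<in> space M \<Longrightarrow> continuous_on {t..T} (\<lambda>s. X s \<omega>)"
      "(\<integral>\<^sup>+ \<omega>. (SUP s\<in>{t..T}. ennreal ((norm (X s \<omega>))\<^sup>2)) \<partial>M) < \<infinity>"
    and I: "\<And>r. r \<in> {t..T} \<Longrightarrow> \<exists>I. has_ito_integral M F W t r \<sigma> I \<and>
        (AE \<omega> in M. X r \<omega> = x + integral\<^sup>L (lebesgue_on {t..r}) (\<lambda>s. b s \<omega>) + I \<omega>)"
  shows "vec_ito_process t T x b \<sigma> X"
proof -
  \<comment> \<open>Passing to components under a Bochner integral requires an integrable integrand,
    since otherwise the vector integral is 0 by convention. Almost every path of b is integrable
    because its components are square-integrable on the product.\<close>
  have path: "AE \<omega> in M. integrable (lebesgue_on {t..T}) (\<lambda>s. b s \<omega>)"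
  proof -
    interpret L: finite_measure "lebesgue_on {t..T}" by (rule finite_measure_lebesgue_on_Icc)
    have "AE \<omega> in M. \<forall>i. sq_int (lebesgue_on {t..T}) (\<lambda>s. b s \<omega> $ i)"
      unfolding AE_all_countable using sq_int_PM_AE_path[OF b(1)] by blast
    then show ?thesis
      by eventually_elim (auto intro: integrable_component L.sq_int_imp_integrable)
  qed
  have "ito_process t T (\<lambda>_. x $ i) (\<lambda>s \<omega>. b s \<omega> $ i) (\<lambda>s \<omega>. \<sigma> s \<omega> $ i) (\<lambda>s \<omega>. X s \<omega> $ i)" for i
    unfolding ito_process_def
  proof (intro conjI ballI t b(1) sup_sq_int_PM[OF t X])
    show "sq_int M (\<lambda>_. x $ i)" by (simp add: sq_int_def)
    fix r assume r: "r \<in> {t..T}"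
    show "(\<lambda>\<omega>. b r \<omega> $ i) \<in> borel_measurable (F r)" "(\<lambda>\<omega>. X r \<omega> $ i) \<in> borel_measurable (F r)"
      by (intro borel_measurable_component b(2) X(1) r)+
    from I[OF r] obtain I where I: "has_ito_integral M F W t r \<sigma> I"
      "AE \<omega> in M. X r \<omega> = x + integral\<^sup>L (lebesgue_on {t..r}) (\<lambda>s. b s \<omega>) + I \<omega>" by blast
    have "AE \<omega> in M. X r \<omega> $ i = x $ i + integral\<^sup>L (lebesgue_on {t..r}) (\<lambda>s. b s \<omega> $ i) + I \<omega> $ i"
      using I(2) path
    proof eventually_elim
      case (elim \<omega>)
      have "integrable (lebesgue_on {t..r}) (\<lambda>s. b s \<omega>)"
        by (rule integrable_lebesgue_on_subset[OF elim(2)]) (use r in auto)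
      from integral_bounded_linear[OF bounded_linear_vec_nth this, of i] elim(1) show ?case by simp
    qed
    with has_ito_integral_component[OF I(1) t(1), of i]
    show "\<exists>I. has_ito_integral M F W t r (\<lambda>s \<omega>. \<sigma> s \<omega> $ i) I \<and>
        (AE \<omega> in M. X r \<omega> $ i = x $ i + integral\<^sup>L (lebesgue_on {t..r}) (\<lambda>s. b s \<omega> $ i) + I \<omega>)"
      by blast
  qed simp
  then show "vec_ito_process t T x b \<sigma> X"
    unfolding vec_ito_process_def using sup_sq_bounded[OF t X] by blast
qed

text \<open>Lipschitz continuity of the strategies enters through continuity: the drift at time s is
  a continuous function of \<open>X s\<close>, hence \<open>F s\<close>-measurable. Its square
  integrability comes from the conditions in \<open>state_process\<close> and the bounded
  coefficients.\<close>

lemma state_vec_ito_process: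
  fixes g :: "('n::finite, 'm1::finite, 'm2::finite) lq_game"
  assumes lq: "lq_data g" and t: "t \<in> {0..hor g}" and S: "state_process g M F W t x u w X"
    and cont: "\<And>s. s \<in> {t..hor g} \<Longrightarrow> continuous_on UNIV (u s)"
      "\<And>s. s \<in> {t..hor g} \<Longrightarrow> continuous_on UNIV (w s)"
  shows "vec_ito_process t (hor g) x
      (\<lambda>s \<omega>. cA g s *v X s \<omega> + cB1 g s *v u s (X s \<omega>) + cB2 g s *v w s (X s \<omega>))
      (\<lambda>s \<omega>. cC g s *v X s \<omega> + cD1 g s *v u s (X s \<omega>) + cD2 g s *v w s (X s \<omega>)) X"
    and "\<And>i. sq_int (PM t (hor g)) (\<lambda>z. X (fst z) (snd z) $ i)"
    and "\<And>i. sq_int (PM t (hor g)) (\<lambda>z. u (fst z) (X (fst z) (snd z)) $ i)"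
    and "\<And>i. sq_int (PM t (hor g)) (\<lambda>z. w (fst z) (X (fst z) (snd z)) $ i)"
proof -
  let ?T = "hor g"
  have t: "0 \<le> t" "t \<le> ?T" using t by auto
  show su: "sq_int (PM t ?T) (\<lambda>z. u (fst z) (X (fst z) (snd z)) $ i)"
    and sw: "sq_int (PM t ?T) (\<lambda>z. w (fst z) (X (fst z) (snd z)) $ j)" for i j
    using L2_process_component[of t ?T "\<lambda>s \<omega>. u s (X s \<omega>)"] L2_process_component[of t ?T "\<lambda>s \<omega>. w s (X s \<omega>)"] S
    by (auto simp: state_process_def)
  have X: "\<And>s. s \<in> {t..?T} \<Longrightarrow> X s \<in> borel_measurable (F s)"
      "\<And>\<omega>. \<omega> \<in> space M \<Longrightarrow> continuous_on {t..?T} (\<lambda>s. X s \<omega>)"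
      "(\<integral>\<^sup>+ \<omega>. (SUP s\<in>{t..?T}. ennreal ((norm (X s \<omega>))\<^sup>2)) \<partial>M) < \<infinity>"
    using S by (auto simp: state_process_def)
  have sX: "sq_int (PM t ?T) (\<lambda>z. X (fst z) (snd z) $ i)" for i
    by (rule sup_sq_int_PM[OF t X])
  then show "\<And>i. sq_int (PM t ?T) (\<lambda>z. X (fst z) (snd z) $ i)" .
  show "vec_ito_process t ?T x
      (\<lambda>s \<omega>. cA g s *v X s \<omega> + cB1 g s *v u s (X s \<omega>) + cB2 g s *v w s (X s \<omega>))
      (\<lambda>s \<omega>. cC g s *v X s \<omega> + cD1 g s *v u s (X s \<omega>) + cD2 g s *v w s (X s \<omega>)) X"
  proof (rule vec_ito_processI(1)[OF t _ _ X])
    show "sq_int (PM t ?T) (\<lambda>z. (cA g (fst z) *v X (fst z) (snd z) + cB1 g (fst z) *v u (fst z) (X (fst z) (snd z))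
        + cB2 g (fst z) *v w (fst z) (X (fst z) (snd z))) $ i)" for i
      unfolding vector_add_component
      using lq by (intro sq_int_add sq_int_Linf_matrix_vector sX su sw t(1)) (auto simp: lq_data_def)
    fix r assume r: "r \<in> {t..?T}"
    show "(\<lambda>\<omega>. cA g r *v X r \<omega> + cB1 g r *v u r (X r \<omega>) + cB2 g r *v w r (X r \<omega>)) \<in> borel_measurable (F r)"
      by (intro borel_measurable_add borel_measurable_matrix_vector borel_measurable_const X(1)[OF r]
          borel_measurable_continuous_on[OF cont(1)[OF r]] borel_measurable_continuous_on[OF cont(2)[OF r]])
    show "\<exists>I. has_ito_integral M F W t r
        (\<lambda>s \<omega>. cC g s *v X s \<omega> + cD1 g s *v u s (X s \<omega>) + cD2 g s *v w s (X s \<omega>)) I \<and>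
        (AE \<omega> in M. X r \<omega> = x + integral\<^sup>L (lebesgue_on {t..r})
          (\<lambda>s. cA g s *v X s \<omega> + cB1 g s *v u s (X s \<omega>) + cB2 g s *v w s (X s \<omega>)) + I \<omega>)"
      using S r unfolding state_process_def by blast
  qed
qed

end

section \<open>Completion of squares\<close>

lemma transpose_mult_inner: "(transpose A *v x) \<bullet> y = x \<bullet> (A *v (y::real^'n))"
  by (simp add: dot_lmul_matrix)

lemma symmetric_inner_commute:
  fixes P :: "real^'n^'n"
  assumes "transpose P = P"
  shows "(P *v a) \<bullet> b = (P *v b) \<bullet> a"
  using transpose_mult_inner[of P a b] assms by (simp add: inner_commute)

lemma uminus_matrix_vector_mult: "(- (A::real^'n^'m)) *v x = - (A *v x)"
  by (simp add: matrix_vector_mult_def vec_eq_iff sum_negf)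

lemma lyap_rhs_inner:
  fixes A C P Q :: "real^'n^'n" and R :: "real^'m^'m" and Th :: "real^'n^'m"
  shows "(lyap_rhs A C P Q R Th *v x) \<bullet> x =
     (P *v x) \<bullet> (A *v x) + (P *v (A *v x)) \<bullet> x + (P *v (C *v x)) \<bullet> (C *v x) + (Q *v x) \<bullet> x
       + (R *v (Th *v x)) \<bullet> (Th *v x)"
  unfolding lyap_rhs_def
  by (simp only: matrix_vector_mult_add_rdistrib matrix_vector_mul_assoc[symmetric] inner_add_left
      transpose_mult_inner)

text \<open>\<open>opt\<close> is the first-order condition for the minimiser Th x of the expression
  in u. With u = Th x + w the terms free of w cancel against the Lyapunov right-hand side, those
  linear in w cancel by \<open>opt\<close> and symmetry, and the quadratic ones remain.\<close>

lemma completion_of_squares: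
  fixes A C P Q :: "real^'n^'n" and B D :: "real^'m^'n" and R :: "real^'m^'m" and Th :: "real^'n^'m"
  assumes P: "transpose P = P" and R: "transpose R = R"
    and opt: "(R + transpose D ** P ** D) ** Th = - (transpose B ** P + transpose D ** P ** C)"
  shows "(Q *v x) \<bullet> x + (R *v u) \<bullet> u + ((P *v x) \<bullet> (A *v x + B *v u) + (P *v (A *v x + B *v u)) \<bullet> x
      + (P *v (C *v x + D *v u)) \<bullet> (C *v x + D *v u)
      - (lyap_rhs (A + B ** Th) (C + D ** Th) P Q R Th *v x) \<bullet> x)
    = ((R + transpose D ** P ** D) *v (u - Th *v x)) \<bullet> (u - Th *v x)"
proof -
  define th w where "th = Th *v x" and "w = u - th"
  have u: "u = th + w" by (simp add: w_def)
  define y z where "y = A *v x + B *v th" and "z = C *v x + D *v th"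
  have 1: "A *v x + B *v u = y + B *v w" "C *v x + D *v u = z + D *v w"
    by (simp_all add: u y_def z_def matrix_vector_right_distrib)
  have yz: "(A + B ** Th) *v x = y" "(C + D ** Th) *v x = z"
    by (simp_all add: y_def z_def th_def matrix_vector_mult_add_rdistrib matrix_vector_mul_assoc)
  have L: "(lyap_rhs (A + B ** Th) (C + D ** Th) P Q R Th *v x) \<bullet> x =
     (P *v x) \<bullet> y + (P *v y) \<bullet> x + (P *v z) \<bullet> z + (Q *v x) \<bullet> x + (R *v th) \<bullet> th"
    unfolding lyap_rhs_inner yz th_def ..
  have "((R + transpose D ** P ** D) ** Th) *v x = - (transpose B ** P + transpose D ** P ** C) *v x"
    by (simp only: opt)
  then have "R *v th + transpose D *v (P *v (D *v th)) =
     - (transpose B *v (P *v x) + transpose D *v (P *v (C *v x)))"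
    by (simp only: matrix_vector_mult_add_rdistrib matrix_vector_mul_assoc[symmetric] th_def
        uminus_matrix_vector_mult)
  then have "(R *v th + transpose D *v (P *v (D *v th))) \<bullet> w =
     (- (transpose B *v (P *v x) + transpose D *v (P *v (C *v x)))) \<bullet> w" by (rule arg_cong)
  \<comment> \<open>The first-order condition paired with the deviation w; doubled, it cancels all
    terms linear in w.\<close>
  then have opt': "(R *v th) \<bullet> w + (P *v (D *v th)) \<bullet> (D *v w) =
     - ((P *v x) \<bullet> (B *v w) + (P *v (C *v x)) \<bullet> (D *v w))"
    by (simp only: inner_add_left inner_minus_left transpose_mult_inner)
  have Pz: "(P *v z) \<bullet> (D *v w) = (P *v (C *v x)) \<bullet> (D *v w) + (P *v (D *v th)) \<bullet> (D *v w)"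
    by (simp add: z_def matrix_vector_right_distrib inner_add_left)
  have Px: "(P *v x) \<bullet> (y + B *v w) = (P *v x) \<bullet> y + (P *v x) \<bullet> (B *v w)"
    by (rule inner_add_right)
  have Rw: "(R *v u) \<bullet> u = (R *v th) \<bullet> th + 2 * ((R *v th) \<bullet> w) + (R *v w) \<bullet> w"
    using symmetric_inner_commute[OF R, of w th]
    by (simp add: u matrix_vector_right_distrib inner_add_left inner_add_right)
  have Pw: "(P *v (z + D *v w)) \<bullet> (z + D *v w) = (P *v z) \<bullet> z + 2 * ((P *v z) \<bullet> (D *v w)) + (P *v (D *v w)) \<bullet> (D *v w)"
    using symmetric_inner_commute[OF P, of "D *v w" z]
    by (simp add: matrix_vector_right_distrib inner_add_left inner_add_right)
  have Py: "(P *v (y + B *v w)) \<bullet> x = (P *v y) \<bullet> x + (P *v x) \<bullet> (B *v w)"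
    using symmetric_inner_commute[OF P, of "B *v w" x]
    by (simp add: matrix_vector_right_distrib inner_add_left)
  have S: "((R + transpose D ** P ** D) *v w) \<bullet> w = (R *v w) \<bullet> w + (P *v (D *v w)) \<bullet> (D *v w)"
    by (simp only: matrix_vector_mult_add_rdistrib matrix_vector_mul_assoc[symmetric] inner_add_left
        transpose_mult_inner)
  show ?thesis
    unfolding th_def[symmetric] w_def[symmetric] S 1 L Rw Pw Py Px
    using opt' Pz by linarith
qed

lemma loewner_scaled_identity: "loewner_le (\<delta> *\<^sub>R mat 1) R \<longleftrightarrow> (\<forall>x. \<delta> * (x \<bullet> x) \<le> (R *v x) \<bullet> x)"
  by (simp add: loewner_le_def scaleR_matrix_vector_assoc[symmetric])

text \<open>Nonnegativity of the Riccati solution enters here: the added term is a value of the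
  quadratic form of P, so the constant of R survives.\<close>

lemma coercive_gram:
  fixes P :: "real^'n^'n" and D :: "real^'m^'n"
  assumes "psd_mat P" "\<And>x. \<delta> * (x \<bullet> x) \<le> (R *v x) \<bullet> x"
  shows "\<delta> * (x \<bullet> x) \<le> ((R + transpose D ** P ** D) *v x) \<bullet> x"
proof -
  have "0 \<le> (P *v (D *v x)) \<bullet> (D *v x)"
    using assms(1) by (simp add: psd_mat_def loewner_le_def)
  moreover have "((R + transpose D ** P ** D) *v x) \<bullet> x = (R *v x) \<bullet> x + (P *v (D *v x)) \<bullet> (D *v x)"
    by (simp only: matrix_vector_mult_add_rdistrib matrix_vector_mul_assoc[symmetric] inner_add_left
        transpose_mult_inner)
  ultimately show ?thesis using assms(2)[of x] by linarith
qed

lemma matrix_mult_minus_right: "(A::real^'b^'a) ** (- B) = - (A ** (B::real^'c^'b))"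
  by (simp add: matrix_matrix_mult_def vec_eq_iff sum_negf)

lemma matrix_mult_diff_right: "(A::real^'b^'a) ** (B - C) = A ** B - A ** (C::real^'c^'b)"
  by (rule bounded_bilinear.diff_right[OF bounded_bilinear_matrix_mult])

lemma matrix_diff_mult: "((A::real^'b^'a) - B) ** C = A ** C - B ** (C::real^'c^'b)"
  by (rule bounded_bilinear.diff_left[OF bounded_bilinear_matrix_mult])

lemma optimal_gain:
  fixes S :: "real^'m^'m" and K :: "real^'n^'m"
  assumes "\<delta> > 0" "\<And>x. \<delta> * (x \<bullet> x) \<le> (S *v x) \<bullet> x"
  shows "S ** (- (matrix_inv S ** K)) = - K"
  by (simp add: matrix_mult_minus_right matrix_mul_assoc matrix_inv_inverse(1)[OF coercive_invertible[OF assms]])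

lemma backward_solution_terminal:
  assumes "backward_solution T P H G" "0 \<le> T"
  shows "P T = G"
proof -
  have "AE s in lebesgue_on {T..T}. H s = 0"
    by (rule AE_I[of _ _ "{T..T}"]) (auto simp: emeasure_restrict_space)
  then have "integral\<^sup>L (lebesgue_on {T..T}) H = 0" by (rule integral_eq_zero_AE)
  then show ?thesis using assms by (simp add: backward_solution_def)
qed

section \<open>The verification step common to both players\<close>

context adapted_bm
begin

text \<open>\<open>S\<close> and \<open>Th\<close> are abstract so that one statement serves both
  players: \<open>S\<close> will be the weight R + D^T P D of the player's control and
  \<open>Th\<close> the candidate gain. The bound depends only on (t,x), which makes costs along
  different states comparable.\<close>

lemma
  fixes P H Q :: "real \<Rightarrow> real^'n^'n" and R S :: "real \<Rightarrow> real^'m^'m" and c :: "real \<Rightarrow> 'w \<Rightarrow> real^'m"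
  assumes t: "t \<in> {0..T}" and X: "vec_ito_process t T x b \<sigma> X"
    and sX: "\<And>i. sq_int (PM t T) (\<lambda>z. X (fst z) (snd z) $ i)"
    and sc: "\<And>i. sq_int (PM t T) (\<lambda>z. c (fst z) (snd z) $ i)"
    and P: "continuous_on {0..T} P" and PH: "backward_solution T P H G"
    and Q: "Linf T Q" and R: "Linf T R"
    and square: "AE s in lebesgue_on {0..T}. \<forall>\<omega>.
      (Q s *v X s \<omega>) \<bullet> X s \<omega> + (R s *v c s \<omega>) \<bullet> c s \<omega> + value_drift P H b \<sigma> X s \<omega> =
      (S s *v (c s \<omega> - Th s *v X s \<omega>)) \<bullet> (c s \<omega> - Th s *v X s \<omega>)"
  shows quad_cost_ge: "AE s in lebesgue_on {0..T}. \<forall>y. 0 \<le> (S s *v y) \<bullet> y \<Longrightarrow>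
      AE \<omega> in M. 1/2 * ((P t *v x) \<bullet> x) \<le> quad_cost M F T Q R G t X c \<omega>"
    and quad_cost_eq: "(\<And>s \<omega>. c s \<omega> = Th s *v X s \<omega>) \<Longrightarrow>
      AE \<omega> in M. quad_cost M F T Q R G t X c \<omega> = 1/2 * ((P t *v x) \<bullet> x)"
proof -
  have t': "0 \<le> t" "t \<le> T" and sub: "{t..T} \<subseteq> {0..T}" using t by auto
  have PT: "P T = G" by (rule backward_solution_terminal[OF PH]) (use t' in simp)
  have P': "continuous_on {t..T} P" by (rule continuous_on_subset[OF P sub])
  have H': "integrable (lebesgue_on {t..T}) H"
    using PH by (intro integrable_lebesgue_on_subset[OF _ sub]) (simp add: backward_solution_def)
  have PH': "P s = P T + integral\<^sup>L (lebesgue_on {s..T}) H" if "s \<in> {t..T}" for s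
    using PH that t' unfolding PT by (auto simp: backward_solution_def)
  let ?c = "\<lambda>s \<omega>. (Q s *v X s \<omega>) \<bullet> X s \<omega> + (R s *v c s \<omega>) \<bullet> c s \<omega>"
  have ic: "integrable (PM t T) (\<lambda>(s, \<omega>). ?c s \<omega>)"
    using integrable_Linf_quadratic[OF Q sX t'(1)] integrable_Linf_quadratic[OF R sc t'(1)]
    by (simp add: case_prod_unfold)
  note sq = AE_lebesgue_on_subset[OF square sub]
  have cost: "quad_cost M F T Q R G t X c \<omega> =
     1/2 * real_cond_exp M (F t) (\<lambda>\<omega>. (\<integral>s. ?c s \<omega> \<partial>lebesgue_on {t..T}) + (P T *v X T \<omega>) \<bullet> X T \<omega>) \<omega>" for \<omega>
    by (simp add: quad_cost_def PT)
  {
    assume pos: "AE s in lebesgue_on {0..T}. \<forall>y. 0 \<le> (S s *v y) \<bullet> y"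
    have "AE s in lebesgue_on {t..T}. \<forall>\<omega>\<in>space M. 0 \<le> ?c s \<omega> + value_drift P H b \<sigma> X s \<omega>"
      using sq AE_lebesgue_on_subset[OF pos sub] by eventually_elim simp
    then have "AE \<omega> in M. (P t *v x) \<bullet> x \<le> real_cond_exp M (F t)
        (\<lambda>\<omega>. (\<integral>s. ?c s \<omega> \<partial>lebesgue_on {t..T}) + (P T *v X T \<omega>) \<bullet> X T \<omega>) \<omega>"
      by (intro conditional_cost_ge[OF X P' H' _ ic] PH')
    then show "AE \<omega> in M. 1/2 * ((P t *v x) \<bullet> x) \<le> quad_cost M F T Q R G t X c \<omega>"
      unfolding cost by eventually_elim simp
  next
    assume c: "\<And>s \<omega>. c s \<omega> = Th s *v X s \<omega>"
    have "AE s in lebesgue_on {t..T}. \<forall>\<omega>\<in>space M. 0 = ?c s \<omega> + value_drift P H b \<sigma> X s \<omega>"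
      using sq by eventually_elim (simp add: c)
    then have "AE \<omega> in M. real_cond_exp M (F t)
        (\<lambda>\<omega>. (\<integral>s. ?c s \<omega> \<partial>lebesgue_on {t..T}) + (P T *v X T \<omega>) \<bullet> X T \<omega>) \<omega> = (P t *v x) \<bullet> x"
      by (intro conditional_cost_eq[OF X P' H' _ ic] PH')
    then show "AE \<omega> in M. quad_cost M F T Q R G t X c \<omega> = 1/2 * ((P t *v x) \<bullet> x)"
      unfolding cost by eventually_elim simp
  }
qed

end

text \<open>The generator at time t consists of measurable sets, null sets included, and grows with
  t; both properties pass to the generated sigma-algebras.\<close>

lemma adapted_bm_aug_filtration:
  assumes "prob_space M" and bm: "brownian_motion M (aug_filtration M W) W"
  shows "adapted_bm M (aug_filtration M W) W"
proof -
  interpret prob_space M by fact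
  have W: "W s \<in> borel_measurable M" if "0 \<le> s" for s using bm that by (simp add: brownian_motion_def)
  let ?G = "\<lambda>t. {W s -` B \<inter> space M | s B. 0 \<le> s \<and> s \<le> t \<and> B \<in> sets borel} \<union> null_sets M"
  have G: "?G t \<subseteq> sets M" for t using measurable_sets[OF W] by auto
  then have Pow: "?G t \<subseteq> Pow (space M)" for t using sets.sets_into_space by blast
  have sp: "space (aug_filtration M W t) = space M" for t
    by (simp add: aug_filtration_def space_measure_of_conv)
  have st: "sets (aug_filtration M W t) = sigma_sets (space M) (?G t)" for t
    unfolding aug_filtration_def by (rule sets_measure_of[OF Pow])
  show ?thesis
  proof
    show "brownian_motion M (aug_filtration M W) W" by fact
    show "subalgebra M (aug_filtration M W t)" for t
      unfolding subalgebra_def sp st using sets.sigma_sets_subset[OF G] by simp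
    show "subalgebra (aug_filtration M W t) (aug_filtration M W s)" if "0 \<le> s" "s \<le> t" for s t
    proof -
      have "?G s \<subseteq> ?G t" by (intro Un_mono subset_refl) (use that order_trans in blast)
      then show ?thesis unfolding subalgebra_def sp st by (intro conjI refl sigma_sets_mono')
    qed
  qed
qed

section \<open>The equilibrium\<close>

lemma uniform_coercive:
  assumes "AE s in lebesgue_on {0..T}. loewner_le (\<delta> *\<^sub>R mat 1) (R s)"
    and "\<And>s. s \<in> {0..T} \<Longrightarrow> psd_mat (P s)"
  shows "AE s in lebesgue_on {0..T}. \<forall>x. \<delta> * (x \<bullet> x) \<le> ((R s + transpose (D s) ** P s ** D s) *v x) \<bullet> x"
  using assms(1) AE_space
proof eventually_elim
  case (elim s)
  then have "psd_mat (P s)" using assms(2) by simp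
  then show ?case using elim(1) coercive_gram unfolding loewner_scaled_identity by blast
qed

text \<open>The follower's gain is the reaction law evaluated at the leader's control u = Theta1 x.
  Hence \<open>Theta2star\<close> is the follower's equilibrium feedback, and both Riccati equations
  share one closed loop.\<close>

lemma Theta2star_eq: "Theta2star g P1 P2 s = - (gain_x g P2 s + gain_u g P2 s ** Theta1bar g P1 P2 s)"
proof -
  have "transpose (cB2 g s) ** P2 s + transpose (cD2 g s) ** P2 s ** (cC g s + cD1 g s ** Theta1bar g P1 P2 s) =
    (transpose (cB2 g s) ** P2 s + transpose (cD2 g s) ** P2 s ** cC g s)
    + transpose (cD2 g s) ** P2 s ** cD1 g s ** Theta1bar g P1 P2 s"
    by (simp add: matrix_add_ldistrib matrix_mul_assoc)
  then show ?thesis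
    by (simp add: Theta2star_def gain_x_def gain_u_def matrix_add_ldistrib matrix_mul_assoc)
qed

theorem theorem3p2:
  fixes M :: "'w measure" and W :: "real \<Rightarrow> 'w \<Rightarrow> real"
    and g :: "('n::finite, 'm1::finite, 'm2::finite) lq_game"
    and P1 P2 :: "real \<Rightarrow> real^'n^'n" and \<delta> :: real
  assumes "prob_space M" and "complete_measure M"
    and "brownian_motion M (aug_filtration M W) W"
    and "lq_data g"
    and "\<delta> > 0"
    and "AE s in lebesgue_on {0..hor g}. loewner_le 0 (wQ1 g s)"
    and "AE s in lebesgue_on {0..hor g}. loewner_le 0 (wQ2 g s)"
    and "loewner_le 0 (wG1 g)" and "loewner_le 0 (wG2 g)"
    and "AE s in lebesgue_on {0..hor g}. loewner_le (\<delta> *\<^sub>R mat 1) (wR1 g s)"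
    and "AE s in lebesgue_on {0..hor g}. loewner_le (\<delta> *\<^sub>R mat 1) (wR2 g s)"
    and "ERE_solution g P1 P2"
  shows "feedback_stackelberg_equilibrium g M (aug_filtration M W) W
           (\<lambda>t x. Theta1bar g P1 P2 t *v x)
           (\<lambda>t x u. - (gain_x g P2 t *v x) - gain_u g P2 t *v u)"
proof -
  interpret adapted_bm M "aug_filtration M W" W
    by (rule adapted_bm_aug_filtration) fact+
  let ?T = "hor g" and ?F = "aug_filtration M W"
  let ?Th = "Theta1bar g P1 P2" and ?Th2 = "Theta2star g P1 P2"
  let ?us = "\<lambda>t x. ?Th t *v x" and ?vs = "\<lambda>t x u. - (gain_x g P2 t *v x) - gain_u g P2 t *v u"
  let ?H1 = "\<lambda>s. lyap_rhs (bA g ?Th P2 s) (bC g ?Th P2 s) (P1 s) (wQ1 g s) (wR1 g s) (?Th s)"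
  let ?H2 = "\<lambda>s. lyap_rhs (bA g ?Th P2 s) (bC g ?Th P2 s) (P2 s) (wQ2 g s) (wR2 g s) (?Th2 s)"
  let ?S1 = "\<lambda>s. wR1 g s + transpose (bD g P2 s) ** P1 s ** bD g P2 s"
  let ?S2 = "\<lambda>s. wR2 g s + transpose (cD2 g s) ** P2 s ** cD2 g s"
  note \<delta> = \<open>\<delta> > 0\<close>
  have L: "Linf ?T (cA g)" "Linf ?T (cC g)" "Linf ?T (cB1 g)" "Linf ?T (cD1 g)" "Linf ?T (cB2 g)"
    "Linf ?T (cD2 g)" "Linf ?T (wQ1 g)" "Linf ?T (wQ2 g)" "Linf ?T (wR1 g)" "Linf ?T (wR2 g)"
    and symR: "AE s in lebesgue_on {0..?T}. sym_mat (wR1 g s)" "AE s in lebesgue_on {0..?T}. sym_mat (wR2 g s)"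
    using \<open>lq_data g\<close> by (auto simp: lq_data_def Linf_sym_def)
  have P: "continuous_on {0..?T} P1" "continuous_on {0..?T} P2"
    and psd: "\<And>s. s \<in> {0..?T} \<Longrightarrow> psd_mat (P1 s)" "\<And>s. s \<in> {0..?T} \<Longrightarrow> psd_mat (P2 s)"
    and backward: "backward_solution ?T P2 ?H2 (wG2 g)" "backward_solution ?T P1 ?H1 (wG1 g)"
    using \<open>ERE_solution g P1 P2\<close> by (auto simp: ERE_solution_def)
  note LP = Linf_continuous[OF P(1)] Linf_continuous[OF P(2)]
  note L_intros = Linf_add Linf_diff Linf_uminus Linf_matrix_mult Linf_transpose L LP
  have c2: "AE s in lebesgue_on {0..?T}. \<forall>x. \<delta> * (x \<bullet> x) \<le> (?S2 s *v x) \<bullet> x"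
    by (rule uniform_coercive) (fact psd | fact)+
  have c1: "AE s in lebesgue_on {0..?T}. \<forall>x. \<delta> * (x \<bullet> x) \<le> (?S1 s *v x) \<bullet> x"
    by (rule uniform_coercive) (fact psd | fact)+
  \<comment> \<open>Essential boundedness follows the nesting of the formulas: inverse, gains,
    modified control matrices, leader's gain. The two inverses are bounded by coercivity.\<close>
  have LS2: "Linf ?T (S2inv g P2)"
    unfolding S2inv_def by (intro Linf_matrix_inv[OF _ \<delta> c2] L_intros)
  have Lg: "Linf ?T (gain_x g P2)" "Linf ?T (gain_u g P2)"
    unfolding gain_x_def gain_u_def by (intro L_intros LS2)+
  have LB: "Linf ?T (bB g P2)" "Linf ?T (bD g P2)"
    unfolding bB_def bD_def by (intro L_intros Lg)+
  have LTh: "Linf ?T ?Th"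
    unfolding Theta1bar_def by (intro L_intros Lg LB Linf_matrix_inv[OF _ \<delta> c1])
  have us: "?us \<in> leader_strategies ?T"
    unfolding leader_strategies_def
  proof (rule CollectI, rule conjI)
    show "\<forall>x. (\<lambda>s. ?Th s *v x) \<in> borel_measurable (lebesgue_on {0..?T})"
      using LTh by (intro allI borel_measurable_matrix_vector) (auto simp: Linf_def)
    show "\<exists>L K. (\<forall>s\<in>{0..?T}. (L s)-lipschitz_on UNIV (?us s)) \<and> (AE s in lebesgue_on {0..?T}. L s \<le> K)"
      by (rule Linf_lipschitz_bound[OF LTh])
  qed
  have vs: "?vs \<in> follower_strategies ?T"
    unfolding follower_strategies_def
  proof (rule CollectI, rule conjI)
    show "\<forall>x w. (\<lambda>s. ?vs s x w) \<in> borel_measurable (lebesgue_on {0..?T})"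
      using Lg by (intro allI borel_measurable_diff borel_measurable_uminus borel_measurable_matrix_vector)
        (auto simp: Linf_def)
    from Linf_lipschitz_bound[OF Lg(1)] obtain L1 K1 where
      1: "\<forall>s\<in>{0..?T}. (L1 s)-lipschitz_on UNIV ((*v) (gain_x g P2 s))" "AE s in lebesgue_on {0..?T}. L1 s \<le> K1"
      by blast
    from Linf_lipschitz_bound[OF Lg(2)] obtain L2 K2 where
      2: "\<forall>s\<in>{0..?T}. (L2 s)-lipschitz_on UNIV ((*v) (gain_u g P2 s))" "AE s in lebesgue_on {0..?T}. L2 s \<le> K2"
      by blast
    have "(L1 s + L2 s)-lipschitz_on UNIV (\<lambda>(x, w). ?vs s x w)" if s: "s \<in> {0..?T}" for s
    proof (rule lipschitz_onI)
      note l1 = lipschitz_onD[OF bspec[OF 1(1) s] UNIV_I UNIV_I]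
        and l2 = lipschitz_onD[OF bspec[OF 2(1) s] UNIV_I UNIV_I]
      have nn: "0 \<le> L1 s" "0 \<le> L2 s"
        using lipschitz_on_nonneg[OF bspec[OF 1(1) s]] lipschitz_on_nonneg[OF bspec[OF 2(1) s]] by auto
      then show "0 \<le> L1 s + L2 s" by simp
      fix p q :: "(real^'n) \<times> (real^'m1)"
      obtain x w x' w' where pq: "p = (x, w)" "q = (x', w')" by (cases p, cases q) auto
      have "dist (?vs s x w) (?vs s x' w') \<le> dist (gain_x g P2 s *v x) (gain_x g P2 s *v x')
          + dist (gain_u g P2 s *v w) (gain_u g P2 s *v w')"
        unfolding dist_norm
        using norm_triangle_ineq4[of "- (gain_x g P2 s *v x) + gain_x g P2 s *v x'" "gain_u g P2 s *v w - gain_u g P2 s *v w'"]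
          norm_minus_cancel[of "gain_x g P2 s *v x - gain_x g P2 s *v x'"]
        by (simp add: algebra_simps)
      also have "\<dots> \<le> L1 s * dist x x' + L2 s * dist w w'" by (intro add_mono l1 l2)
      also have "\<dots> \<le> L1 s * dist p q + L2 s * dist p q"
        using dist_fst_le[of p q] dist_snd_le[of p q] nn by (intro add_mono mult_left_mono) (auto simp: pq)
      finally show "dist (case p of (x, w) \<Rightarrow> ?vs s x w) (case q of (x, w) \<Rightarrow> ?vs s x w) \<le> (L1 s + L2 s) * dist p q"
        by (simp add: pq algebra_simps)
    qed
    moreover have "AE s in lebesgue_on {0..?T}. L1 s + L2 s \<le> K1 + K2"
      using 1(2) 2(2) by eventually_elim simp
    ultimately show "\<exists>L K. (\<forall>s\<in>{0..?T}. (L s)-lipschitz_on UNIV (\<lambda>(x, w). ?vs s x w)) \<and>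
        (AE s in lebesgue_on {0..?T}. L s \<le> K)"
      by (intro exI[of _ "\<lambda>s. L1 s + L2 s"] exI[of _ "K1 + K2"] conjI ballI)
  qed
  have cu: "continuous_on UNIV (u s)" if "u \<in> leader_strategies ?T" "s \<in> {0..?T}"
    for u :: "real \<Rightarrow> real^'n \<Rightarrow> real^'m1" and s
    using that lipschitz_on_continuous_on unfolding leader_strategies_def by blast
  have cw: "continuous_on UNIV (response v u s)"
    if u: "u \<in> leader_strategies ?T" and v: "v \<in> follower_strategies ?T" and s: "s \<in> {0..?T}"
    for u :: "real \<Rightarrow> real^'n \<Rightarrow> real^'m1" and v :: "real \<Rightarrow> real^'n \<Rightarrow> real^'m1 \<Rightarrow> real^'m2" and s
  proof -
    have "continuous_on UNIV (\<lambda>(x, w). v s x w)"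
      using v s lipschitz_on_continuous_on unfolding follower_strategies_def by blast
    from continuous_on_compose2[OF this, of UNIV "\<lambda>x. (x, u s x)"] cu[OF u s]
    show ?thesis by (simp add: response_def continuous_on_Pair continuous_on_id)
  qed
  have vsu: "response ?vs u s x = - (gain_x g P2 s *v x) - gain_u g P2 s *v u s x" for u s x
    by (simp add: response_def)
  have vsus: "response ?vs ?us s x = ?Th2 s *v x" for s x
    unfolding vsu Theta2star_eq
    by (simp add: uminus_matrix_vector_mult matrix_vector_mult_diff_rdistrib matrix_vector_mul_assoc)

  \<comment> \<open>The follower's problem with the leader's feedback frozen; w is any feedback
    continuous in the state, linear or not. The second half yields the exact equilibrium
    cost.\<close>
  have J2: "(AE \<omega> in M. 1/2 * ((P2 t *v x) \<bullet> x) \<le> J2 g M ?F t Y w \<omega>) \<and>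
      ((\<forall>s y. w s y = ?Th2 s *v y) \<longrightarrow> (AE \<omega> in M. J2 g M ?F t Y w \<omega> = 1/2 * ((P2 t *v x) \<bullet> x)))"
    if t: "t \<in> {0..?T}" and Y: "state_process g M ?F W t x ?us w Y"
      and w: "\<And>s. s \<in> {0..?T} \<Longrightarrow> continuous_on UNIV (w s)"
    for t x w Y
  proof -
    have sub: "s \<in> {0..?T}" if "s \<in> {t..?T}" for s using that t by auto
    note V = state_vec_ito_process[OF \<open>lq_data g\<close> t Y cu[OF us sub] w[OF sub]]
    let ?b = "\<lambda>s \<omega>. cA g s *v Y s \<omega> + cB1 g s *v (?Th s *v Y s \<omega>) + cB2 g s *v w s (Y s \<omega>)"
    let ?\<sigma> = "\<lambda>s \<omega>. cC g s *v Y s \<omega> + cD1 g s *v (?Th s *v Y s \<omega>) + cD2 g s *v w s (Y s \<omega>)"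
    have sq: "AE s in lebesgue_on {0..?T}. \<forall>\<omega>.
      (wQ2 g s *v Y s \<omega>) \<bullet> Y s \<omega> + (wR2 g s *v w s (Y s \<omega>)) \<bullet> w s (Y s \<omega>) + value_drift P2 ?H2 ?b ?\<sigma> Y s \<omega> =
      (?S2 s *v (w s (Y s \<omega>) - ?Th2 s *v Y s \<omega>)) \<bullet> (w s (Y s \<omega>) - ?Th2 s *v Y s \<omega>)"
      using c2 symR(2) AE_space
    proof eventually_elim
      case (elim s)
      let ?A = "cA g s + cB1 g s ** ?Th s" and ?C = "cC g s + cD1 g s ** ?Th s"
      have P2s: "transpose (P2 s) = P2 s" using psd(2)[of s] elim(3) by (simp add: psd_mat_def sym_mat_def)
      have opt: "?S2 s ** ?Th2 s = - (transpose (cB2 g s) ** P2 s + transpose (cD2 g s) ** P2 s ** ?C)"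
        unfolding Theta2star_def S2inv_def by (rule optimal_gain[OF \<delta>]) (use elim(1) in blast)
      \<comment> \<open>These identities bring the follower's Riccati right-hand side into the form
        required by \<open>completion_of_squares\<close>, with state matrices \<open>?A\<close>,
        \<open>?C\<close> and control matrices \<open>cB2 g s\<close>,
        \<open>cD2 g s\<close>.\<close>
      have A: "bA g ?Th P2 s = ?A + cB2 g s ** ?Th2 s" and C: "bC g ?Th P2 s = ?C + cD2 g s ** ?Th2 s"
        unfolding bA_def bC_def bB_def bD_def Theta2star_eq
        by (simp_all add: matrix_mult_minus_right matrix_mult_diff_right matrix_diff_mult matrix_mul_assoc)
      show ?case
      proof
        fix \<omega>
        have b: "?b s \<omega> = ?A *v Y s \<omega> + cB2 g s *v w s (Y s \<omega>)" "?\<sigma> s \<omega> = ?C *v Y s \<omega> + cD2 g s *v w s (Y s \<omega>)"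
          by (simp_all add: matrix_vector_mult_add_rdistrib matrix_vector_mul_assoc)
        show "(wQ2 g s *v Y s \<omega>) \<bullet> Y s \<omega> + (wR2 g s *v w s (Y s \<omega>)) \<bullet> w s (Y s \<omega>) + value_drift P2 ?H2 ?b ?\<sigma> Y s \<omega> =
          (?S2 s *v (w s (Y s \<omega>) - ?Th2 s *v Y s \<omega>)) \<bullet> (w s (Y s \<omega>) - ?Th2 s *v Y s \<omega>)"
          unfolding value_drift_def b A C
          by (rule completion_of_squares[OF P2s _ opt]) (use elim(2) in \<open>simp add: sym_mat_def\<close>)
      qed
    qed
    have pos: "AE s in lebesgue_on {0..?T}. \<forall>y. 0 \<le> (?S2 s *v y) \<bullet> y"
      using c2 by eventually_elim (use \<delta> in \<open>auto intro: order_trans[rotated] mult_nonneg_nonneg\<close>)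
    note args = t V(1,2) V(4) P(2) backward(1) L(8) L(10) sq
    have "AE \<omega> in M. 1/2 * ((P2 t *v x) \<bullet> x) \<le> J2 g M ?F t Y w \<omega>"
      unfolding J2_def by (rule quad_cost_ge[OF args pos])
    moreover have "AE \<omega> in M. J2 g M ?F t Y w \<omega> = 1/2 * ((P2 t *v x) \<bullet> x)" if opt: "\<forall>s y. w s y = ?Th2 s *v y"
      unfolding J2_def by (rule quad_cost_eq[OF args]; (assumption | rule opt[rule_format]))
    ultimately show ?thesis by blast
  qed

  \<comment> \<open>A deviation u of the leader also changes the follower's action, through the
    fixed law \<open>?vs\<close>. The leader's cost puts no weight on that action, so eliminating it
    from the state equation leaves a problem in u alone, with control matrices \<open>bB\<close> and
    \<open>bD\<close>.\<close>
  have J1: "(AE \<omega> in M. 1/2 * ((P1 t *v x) \<bullet> x) \<le> J1 g M ?F t Y u \<omega>) \<and>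
      ((\<forall>s y. u s y = ?Th s *v y) \<longrightarrow> (AE \<omega> in M. J1 g M ?F t Y u \<omega> = 1/2 * ((P1 t *v x) \<bullet> x)))"
    if t: "t \<in> {0..?T}" and u: "u \<in> leader_strategies ?T" and Y: "state_process g M ?F W t x u (response ?vs u) Y"
    for t x u Y
  proof -
    have sub: "s \<in> {0..?T}" if "s \<in> {t..?T}" for s using that t by auto
    note V = state_vec_ito_process[OF \<open>lq_data g\<close> t Y cu[OF u sub] cw[OF u vs sub]]
    let ?b = "\<lambda>s \<omega>. cA g s *v Y s \<omega> + cB1 g s *v u s (Y s \<omega>) + cB2 g s *v response ?vs u s (Y s \<omega>)"
    let ?\<sigma> = "\<lambda>s \<omega>. cC g s *v Y s \<omega> + cD1 g s *v u s (Y s \<omega>) + cD2 g s *v response ?vs u s (Y s \<omega>)"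
    have sq: "AE s in lebesgue_on {0..?T}. \<forall>\<omega>.
      (wQ1 g s *v Y s \<omega>) \<bullet> Y s \<omega> + (wR1 g s *v u s (Y s \<omega>)) \<bullet> u s (Y s \<omega>) + value_drift P1 ?H1 ?b ?\<sigma> Y s \<omega> =
      (?S1 s *v (u s (Y s \<omega>) - ?Th s *v Y s \<omega>)) \<bullet> (u s (Y s \<omega>) - ?Th s *v Y s \<omega>)"
      using c1 symR(1) AE_space
    proof eventually_elim
      case (elim s)
      let ?A = "cA g s - cB2 g s ** gain_x g P2 s" and ?C = "cC g s - cD2 g s ** gain_x g P2 s"
      have P1s: "transpose (P1 s) = P1 s" using psd(1)[of s] elim(3) by (simp add: psd_mat_def sym_mat_def)
      have opt: "?S1 s ** ?Th s = - (transpose (bB g P2 s) ** P1 s + transpose (bD g P2 s) ** P1 s ** ?C)"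
        unfolding Theta1bar_def by (rule optimal_gain[OF \<delta>]) (use elim(1) in blast)
      show ?case
      proof
        fix \<omega>
        have b: "?b s \<omega> = ?A *v Y s \<omega> + bB g P2 s *v u s (Y s \<omega>)" "?\<sigma> s \<omega> = ?C *v Y s \<omega> + bD g P2 s *v u s (Y s \<omega>)"
          unfolding vsu bB_def bD_def
          by (simp_all add: matrix_vector_mult_diff_rdistrib matrix_vector_mult_diff_distrib
              matrix_vector_mul_assoc vec.neg)
        show "(wQ1 g s *v Y s \<omega>) \<bullet> Y s \<omega> + (wR1 g s *v u s (Y s \<omega>)) \<bullet> u s (Y s \<omega>) + value_drift P1 ?H1 ?b ?\<sigma> Y s \<omega> =
          (?S1 s *v (u s (Y s \<omega>) - ?Th s *v Y s \<omega>)) \<bullet> (u s (Y s \<omega>) - ?Th s *v Y s \<omega>)"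
          unfolding value_drift_def b bA_def bC_def
          by (rule completion_of_squares[OF P1s _ opt]) (use elim(2) in \<open>simp add: sym_mat_def\<close>)
      qed
    qed
    have pos: "AE s in lebesgue_on {0..?T}. \<forall>y. 0 \<le> (?S1 s *v y) \<bullet> y"
      using c1 by eventually_elim (use \<delta> in \<open>auto intro: order_trans[rotated] mult_nonneg_nonneg\<close>)
    note args = t V(1,2) V(3) P(1) backward(2) L(7) L(9) sq
    have "AE \<omega> in M. 1/2 * ((P1 t *v x) \<bullet> x) \<le> J1 g M ?F t Y u \<omega>"
      unfolding J1_def by (rule quad_cost_ge[OF args pos])
    moreover have "AE \<omega> in M. J1 g M ?F t Y u \<omega> = 1/2 * ((P1 t *v x) \<bullet> x)" if opt: "\<forall>s y. u s y = ?Th s *v y"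
      unfolding J1_def by (rule quad_cost_eq[OF args]; (assumption | rule opt[rule_format]))
    ultimately show ?thesis by blast
  qed

  show ?thesis
    unfolding feedback_stackelberg_equilibrium_def
  proof (intro conjI us vs ballI allI impI)
    fix t x X Y and u :: "real \<Rightarrow> real^'n \<Rightarrow> real^'m1" and v :: "real \<Rightarrow> real^'n \<Rightarrow> real^'m1 \<Rightarrow> real^'m2"
    assume t: "t \<in> {0..?T}" and u: "u \<in> leader_strategies ?T" and v: "v \<in> follower_strategies ?T"
      and X: "state_process g M ?F W t x ?us (response ?vs ?us) X"
    {
      assume Y: "state_process g M ?F W t x ?us (response v ?us) Y"
      have "AE \<omega> in M. J2 g M ?F t X (response ?vs ?us) \<omega> = 1/2 * ((P2 t *v x) \<bullet> x)"
        using J2[OF t X cw[OF us vs]] vsus by blast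
      moreover have "AE \<omega> in M. 1/2 * ((P2 t *v x) \<bullet> x) \<le> J2 g M ?F t Y (response v ?us) \<omega>"
        using J2[OF t Y cw[OF us v]] by blast
      ultimately show "AE \<omega> in M. J2 g M ?F t X (response ?vs ?us) \<omega> \<le> J2 g M ?F t Y (response v ?us) \<omega>"
        by eventually_elim simp
    next
      assume Y: "state_process g M ?F W t x u (response ?vs u) Y"
      have "AE \<omega> in M. J1 g M ?F t X ?us \<omega> = 1/2 * ((P1 t *v x) \<bullet> x)"
        using J1[OF t us X] by blast
      moreover have "AE \<omega> in M. 1/2 * ((P1 t *v x) \<bullet> x) \<le> J1 g M ?F t Y u \<omega>"
        using J1[OF t u Y] by blast
      ultimately show "AE \<omega> in M. J1 g M ?F t X ?us \<omega> \<le> J1 g M ?F t Y u \<omega>"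
        by eventually_elim simp
    }
  qed
qed

end
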